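(* Let $A$ be a bornological pro-$C^*$-algebra (in particular, $A$ could be a $\sigma$-$C^*$-algebra). Then the strict topology $\beta$ on the multiplier algebra $M(A)$ equals its own localization $\beta_b$ with respect to the bounded subsets of $M(A)$; that is, $\beta=\beta_b$.
   Context: A pro-$C^*$-algebra is a cofiltered limit of $C^*$-algebras in the category of topological $*$-algebras; equivalently, a complete Hausdorff topological $*$-algebra $A$ over $\mathbb{C}$ whose topology is generated by its set $S(A)$ of continuous $C^*$-seminorms. For $p\in S(A)$ put $A_p:=A/\ker p$, a $C^*$-algebra; then $A\cong\varprojlim_{p\in S(A)}A_p$. A $\sigma$-$C^*$-algebra is a pro-$C^*$-algebra that is a countable cofiltered limit of $C^*$-algebras, i.e. whose topology is generated by countably many $C^*$-seminorms. The multiplier algebra is $M(A)\cong\varprojlim_{p\in S(A)}M(A_p)$ (connecting maps being the extensions to multiplier algebras of the surjections $A_p\to A_q$, $p\ge q$). Each $p\in S(A)$ extends to $M(A)$ as the pullback of the norm of $M(A_p)$. The strict topology $\beta$ on $M(A)$ is the limit of the strict topologies of the $M(A_p)$; equivalently, it is generated by the seminorms $x\mapsto p(xa)$ and $x\mapsto p(ax)$ for $p\in S(A)$, $a\in A$. A subset of a topological vector space is bounded if it is absorbed by every neighborhood of the origin. For a locally convex topology $\sigma$ on a vector space, its localization $\sigma_b$ is the finest locally convex topology agreeing with $\sigma$ on all $\sigma$-bounded subsets (i.e. inducing the same subspace topology on each such subset). Thus $\beta_b$ is the finest locally convex topology on $M(A)$ agreeing with $\beta$ on bounded subsets. A locally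 convex topological vector space is bornological if every absolutely convex set absorbing every bounded set is a neighborhood of the origin; a pro-$C^*$-algebra is called bornological if it is so in its pro-$C^*$ topology. *)

theory Defs
  imports "HOL-Analysis.Analysis" "HOL-Algebra.Module" "HOL-Algebra.QuotRing"
begin

section \<open>Complex vector spaces and $*$-algebras with explicit carriers\<close>

definition complex_field :: "complex ring" where
  "complex_field = \<lparr>carrier = UNIV, mult = (*), one = 1, zero = 0, add = (+)\<rparr>"

lemma cring_complex_field: "cring complex_field"
proof (rule cringI)
  show "abelian_group complex_field"
  proof (rule abelian_groupI)
    fix x assume "x \<in> carrier complex_field"
    show "\<exists>y\<in>carrier complex_field. y \<oplus>\<^bsub>complex_field\<^esub> x = \<zero>\<^bsub>complex_field\<^esub>"
      by (rule bexI[of _ "- x"]) (simp_all add: complex_field_def)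
  qed (simp_all add: complex_field_def)
  show "comm_monoid complex_field"
    by (rule comm_monoidI) (simp_all add: complex_field_def)
qed (simp add: complex_field_def algebra_simps)

text \<open>As usual for \<^typ>\<open>('r, 'a) module\<close> records, unused fields are ignored: a complex vector space
  is a module over \<^term>\<open>complex_field\<close>, and a $*$-algebra need not be unital, so its field
  \<^const>\<open>one\<close> is arbitrary and carries no information.\<close>

record 'a star_algebra = "(complex, 'a) module" +
  star :: "'a \<Rightarrow> 'a"

locale star_algebra = module complex_field A for A :: "('a, 'm) star_algebra_scheme" (structure) +
  assumes m_closed: "\<lbrakk>x \<in> carrier A; y \<in> carrier A\<rbrakk> \<Longrightarrow> x \<otimes> y \<in> carrier A"
    and m_assoc: "\<lbrakk>x \<in> carrier A; y \<in> carrier A; z \<in> carrier A\<rbrakk>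
      \<Longrightarrow> (x \<otimes> y) \<otimes> z = x \<otimes> (y \<otimes> z)"
    and l_distr: "\<lbrakk>x \<in> carrier A; y \<in> carrier A; z \<in> carrier A\<rbrakk>
      \<Longrightarrow> (x \<oplus> y) \<otimes> z = x \<otimes> z \<oplus> y \<otimes> z"
    and r_distr: "\<lbrakk>x \<in> carrier A; y \<in> carrier A; z \<in> carrier A\<rbrakk>
      \<Longrightarrow> z \<otimes> (x \<oplus> y) = z \<otimes> x \<oplus> z \<otimes> y"
    and smult_mult_left: "\<lbrakk>x \<in> carrier A; y \<in> carrier A\<rbrakk> \<Longrightarrow> (c \<odot> x) \<otimes> y = c \<odot> (x \<otimes> y)"
    and smult_mult_right: "\<lbrakk>x \<in> carrier A; y \<in> carrier A\<rbrakk> \<Longrightarrow> x \<otimes> (c \<odot> y) = c \<odot> (x \<otimes> y)"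
    and star_closed: "x \<in> carrier A \<Longrightarrow> star A x \<in> carrier A"
    and star_star: "x \<in> carrier A \<Longrightarrow> star A (star A x) = x"
    and star_add: "\<lbrakk>x \<in> carrier A; y \<in> carrier A\<rbrakk> \<Longrightarrow> star A (x \<oplus> y) = star A x \<oplus> star A y"
    and star_smult: "x \<in> carrier A \<Longrightarrow> star A (c \<odot> x) = cnj c \<odot> star A x"
    and star_mult: "\<lbrakk>x \<in> carrier A; y \<in> carrier A\<rbrakk> \<Longrightarrow> star A (x \<otimes> y) = star A y \<otimes> star A x"

record 'a normed_star_algebra = "'a star_algebra" +
  nrm :: "'a \<Rightarrow> real"

record 'a top_star_algebra = "'a star_algebra" +
  topo :: "'a topology"


section \<open>Locally convex topologies\<close>

definition zero_nbhd :: "(complex, 'a, 'm) module_scheme \<Rightarrow> 'a topology \<Rightarrow> 'a set \<Rightarrow> bool" where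
  "zero_nbhd V T U \<longleftrightarrow> U \<subseteq> carrier V \<and> \<zero>\<^bsub>V\<^esub> \<in> T interior_of U"

definition convex_in :: "(complex, 'a, 'm) module_scheme \<Rightarrow> 'a set \<Rightarrow> bool" where
  "convex_in V C \<longleftrightarrow> C \<subseteq> carrier V \<and>
    (\<forall>x\<in>C. \<forall>y\<in>C. \<forall>t\<in>{0..1::real}. of_real t \<odot>\<^bsub>V\<^esub> x \<oplus>\<^bsub>V\<^esub> of_real (1 - t) \<odot>\<^bsub>V\<^esub> y \<in> C)"

definition absolutely_convex :: "(complex, 'a, 'm) module_scheme \<Rightarrow> 'a set \<Rightarrow> bool" where
  "absolutely_convex V C \<longleftrightarrow> C \<subseteq> carrier V \<and>
    (\<forall>x\<in>C. \<forall>y\<in>C. \<forall>a b. cmod a + cmod b \<le> 1 \<longrightarrow> a \<odot>\<^bsub>V\<^esub> x \<oplus>\<^bsub>V\<^esub> b \<odot>\<^bsub>V\<^esub> y \<in> C)"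

definition linear_topology :: "(complex, 'a, 'm) module_scheme \<Rightarrow> 'a topology \<Rightarrow> bool" where
  "linear_topology V T \<longleftrightarrow> topspace T = carrier V \<and>
    continuous_map (prod_topology T T) T (\<lambda>(x, y). x \<oplus>\<^bsub>V\<^esub> y) \<and>
    continuous_map (prod_topology euclidean T) T (\<lambda>(c, x). c \<odot>\<^bsub>V\<^esub> x)"

definition locally_convex :: "(complex, 'a, 'm) module_scheme \<Rightarrow> 'a topology \<Rightarrow> bool" where
  "locally_convex V T \<longleftrightarrow> linear_topology V T \<and>
    (\<forall>U. zero_nbhd V T U \<longrightarrow> (\<exists>C. convex_in V C \<and> zero_nbhd V T C \<and> C \<subseteq> U))"

definition absorbs :: "(complex, 'a, 'm) module_scheme \<Rightarrow> 'a set \<Rightarrow> 'a set \<Rightarrow> bool" where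
  "absorbs V U B \<longleftrightarrow> (\<exists>r>0. \<forall>c. r \<le> cmod c \<longrightarrow> B \<subseteq> (\<lambda>u. c \<odot>\<^bsub>V\<^esub> u) ` U)"

definition bounded_in :: "(complex, 'a, 'm) module_scheme \<Rightarrow> 'a topology \<Rightarrow> 'a set \<Rightarrow> bool" where
  "bounded_in V T B \<longleftrightarrow> B \<subseteq> carrier V \<and> (\<forall>U. zero_nbhd V T U \<longrightarrow> absorbs V U B)"

definition bornological :: "(complex, 'a, 'm) module_scheme \<Rightarrow> 'a topology \<Rightarrow> bool" where
  "bornological V T \<longleftrightarrow> locally_convex V T \<and>
    (\<forall>C. absolutely_convex V C \<and> (\<forall>B. bounded_in V T B \<longrightarrow> absorbs V C B) \<longrightarrow> zero_nbhd V T C)"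

definition complete_in :: "(complex, 'a, 'm) module_scheme \<Rightarrow> 'a topology \<Rightarrow> bool" where
  "complete_in V T \<longleftrightarrow> (\<forall>F. F \<noteq> bot \<and> (\<forall>\<^sub>F x in F. x \<in> carrier V) \<and>
      (\<forall>U. zero_nbhd V T U \<longrightarrow> (\<forall>\<^sub>F (x, y) in F \<times>\<^sub>F F. x \<ominus>\<^bsub>V\<^esub> y \<in> U))
    \<longrightarrow> (\<exists>l. limitin T (\<lambda>x. x) l F))"

definition seminorm_topology ::
    "(complex, 'a, 'm) module_scheme \<Rightarrow> ('a \<Rightarrow> real) set \<Rightarrow> 'a topology" where
  "seminorm_topology V P = topology_generated_by
    {{y \<in> carrier V. p (y \<ominus>\<^bsub>V\<^esub> x) < e} | p x e. p \<in> P \<and> x \<in> carrier V \<and> 0 < e}"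

definition agrees_on_bounded ::
    "(complex, 'a, 'm) module_scheme \<Rightarrow> 'a topology \<Rightarrow> 'a topology \<Rightarrow> bool" where
  "agrees_on_bounded V \<sigma> \<tau> \<longleftrightarrow>
    (\<forall>B. bounded_in V \<sigma> B \<longrightarrow> subtopology \<tau> B = subtopology \<sigma> B)"

definition is_localization ::
    "(complex, 'a, 'm) module_scheme \<Rightarrow> 'a topology \<Rightarrow> 'a topology \<Rightarrow> bool" where
  "is_localization V \<sigma> \<tau> \<longleftrightarrow> locally_convex V \<tau> \<and> agrees_on_bounded V \<sigma> \<tau> \<and>
    (\<forall>\<tau>'. locally_convex V \<tau>' \<and> agrees_on_bounded V \<sigma> \<tau>' \<longrightarrow> (\<forall>U. openin \<tau>' U \<longrightarrow> openin \<tau> U))"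

definition localization ::
    "(complex, 'a, 'm) module_scheme \<Rightarrow> 'a topology \<Rightarrow> 'a topology" where
  "localization V \<sigma> = (THE \<tau>. is_localization V \<sigma> \<tau>)"

lemma is_localization_unique:
  assumes "is_localization V \<sigma> \<tau>" "is_localization V \<sigma> \<tau>'"
  shows "\<tau> = \<tau>'"
  using assms unfolding is_localization_def topology_eq by blast

lemma localization_eqI: "is_localization V \<sigma> \<tau> \<Longrightarrow> localization V \<sigma> = \<tau>"
  unfolding localization_def using is_localization_unique by blast

text \<open>The localization of a locally convex topology exists (as the supremum of all locally convex
  topologies that agree with it on bounded sets), so the definite description above is proper.\<close>

lemma ex_is_localization:
  assumes "locally_convex V \<sigma>"
  shows "\<exists>\<tau>. is_localization V \<sigma> \<tau>"
proof -
  define F where "F = {\<tau>. locally_convex V \<tau> \<and> agrees_on_bounded V \<sigma> \<tau>}"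
  define S where "S = {U. \<exists>\<tau>\<in>F. openin \<tau> U}"
  define T where "T = topology_generated_by S"
  have \<sigma>: "\<sigma> \<in> F" using assms by (simp add: F_def agrees_on_bounded_def)
  have top: "topspace \<tau> = carrier V" if "\<tau> \<in> F" for \<tau>
    using that by (simp add: F_def locally_convex_def linear_topology_def)
  have finer: "openin T U" if "\<tau> \<in> F" "openin \<tau> U" for \<tau> U
    unfolding T_def using that by (intro topology_generated_by_Basis) (auto simp: S_def)
  have US: "\<Union>S = carrier V"
  proof
    show "\<Union>S \<subseteq> carrier V"
      unfolding S_def using openin_subset top by fastforce
    have "openin \<sigma> (carrier V)"
      using top[OF \<sigma>] openin_topspace by metis
    then show "carrier V \<subseteq> \<Union>S"
      unfolding S_def using \<sigma> by blast
  qed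
  have topT: "topspace T = carrier V" by (simp add: T_def US)
  have id_cont: "continuous_map T \<tau> (\<lambda>x. x)" if "\<tau> \<in> F" for \<tau>
    unfolding continuous_map_alt
  proof (intro conjI allI impI)
    fix U assume U: "openin \<tau> U"
    then have "(\<lambda>x. x) -` U \<inter> topspace T = U"
      using openin_subset[OF U] by (auto simp: topT top[OF that])
    with finer[OF that U] show "openin T ((\<lambda>x. x) -` U \<inter> topspace T)" by simp
  qed (simp add: topT top[OF that])
  have pairT: "continuous_map (prod_topology T T) (prod_topology \<tau> \<tau>) (\<lambda>z. z)"
    if "\<tau> \<in> F" for \<tau>
  proof -
    have "continuous_map (prod_topology T T) (prod_topology \<tau> \<tau>) (\<lambda>(x, y). (x, y))"
      by (subst continuous_map_prod_top) (simp add: id_cont[OF that])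
    then show ?thesis by (simp add: case_prod_beta')
  qed
  have pairC: "continuous_map (prod_topology euclidean T) (prod_topology euclidean \<tau>) (\<lambda>z. z)"
    if "\<tau> \<in> F" for \<tau>
  proof -
    have "continuous_map (prod_topology euclidean T) (prod_topology euclidean \<tau>) (\<lambda>(x, y). (x, y))"
      by (subst continuous_map_prod_top) (simp add: id_cont[OF that])
    then show ?thesis by (simp add: case_prod_beta')
  qed
  have add: "continuous_map (prod_topology T T) \<tau> (\<lambda>(x, y). x \<oplus>\<^bsub>V\<^esub> y)" if "\<tau> \<in> F" for \<tau>
  proof -
    have "continuous_map (prod_topology \<tau> \<tau>) \<tau> (\<lambda>(x, y). x \<oplus>\<^bsub>V\<^esub> y)"
      using that by (simp add: F_def locally_convex_def linear_topology_def)
    from continuous_map_compose[OF pairT[OF that] this] show ?thesis by (simp add: o_def)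
  qed
  have smul: "continuous_map (prod_topology euclidean T) \<tau> (\<lambda>(c, x). c \<odot>\<^bsub>V\<^esub> x)"
    if "\<tau> \<in> F" for \<tau>
  proof -
    have "continuous_map (prod_topology euclidean \<tau>) \<tau> (\<lambda>(c, x). c \<odot>\<^bsub>V\<^esub> x)"
      using that by (simp add: F_def locally_convex_def linear_topology_def)
    from continuous_map_compose[OF pairC[OF that] this] show ?thesis by (simp add: o_def)
  qed
  have into: "continuous_map X T f" if "\<And>\<tau>. \<tau> \<in> F \<Longrightarrow> continuous_map X \<tau> f"
    for X :: "'z topology" and f
    unfolding T_def
  proof (rule continuous_on_generated_topo)
    fix U assume "U \<in> S"
    then obtain \<tau> where "\<tau> \<in> F" "openin \<tau> U" by (auto simp: S_def)
    then show "openin X (f -` U \<inter> topspace X)"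
      using that by (simp add: continuous_map_alt)
  next
    show "f ` topspace X \<subseteq> \<Union>S"
      using that[OF \<sigma>] top[OF \<sigma>] by (auto simp: US continuous_map_def)
  qed
  have lin: "linear_topology V T"
    unfolding linear_topology_def using topT into[OF add] into[OF smul] by blast
  have base: "\<exists>C. convex_in V C \<and> zero_nbhd V T C \<and> C \<subseteq> U"
    if "generate_topology_on S U" "\<zero>\<^bsub>V\<^esub> \<in> U" for U
    using that
  proof (induction rule: generate_topology_on.induct)
    case Empty
    then show ?case by simp
  next
    case (Int a b)
    then obtain C D where C: "convex_in V C" "zero_nbhd V T C" "C \<subseteq> a"
      and D: "convex_in V D" "zero_nbhd V T D" "D \<subseteq> b" by blast
    have "convex_in V (C \<inter> D)" using C(1) D(1) by (auto simp: convex_in_def)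
    moreover have "zero_nbhd V T (C \<inter> D)"
      using C(2) D(2) by (auto simp: zero_nbhd_def interior_of_Int)
    ultimately show ?case using C(3) D(3) by blast
  next
    case (UN K)
    then show ?case by blast
  next
    case (Basis s)
    then obtain \<tau> where \<tau>: "\<tau> \<in> F" "openin \<tau> s" by (auto simp: S_def)
    have "zero_nbhd V \<tau> s"
      using \<tau> Basis top[OF \<tau>(1)] openin_subset[OF \<tau>(2)]
      by (simp add: zero_nbhd_def interior_of_openin)
    then obtain C where C: "convex_in V C" "zero_nbhd V \<tau> C" "C \<subseteq> s"
      using \<tau>(1) by (auto simp: F_def locally_convex_def)
    have "zero_nbhd V T C"
      using C(2) finer[OF \<tau>(1)] by (auto simp: zero_nbhd_def interior_of_def)
    then show ?case using C by blast
  qed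
  have lc: "locally_convex V T"
    unfolding locally_convex_def
  proof (intro conjI allI impI lin)
    fix U assume U: "zero_nbhd V T U"
    then obtain W where W: "openin T W" "\<zero>\<^bsub>V\<^esub> \<in> W" "W \<subseteq> U"
      by (auto simp: zero_nbhd_def interior_of_def)
    then have "generate_topology_on S W"
      by (simp add: T_def openin_topology_generated_by_iff)
    from base[OF this W(2)] W(3)
    show "\<exists>C. convex_in V C \<and> zero_nbhd V T C \<and> C \<subseteq> U" by blast
  qed
  have "subtopology T B = subtopology \<sigma> B" if B: "bounded_in V \<sigma> B" for B
  proof -
    have *: "openin (subtopology \<sigma> B) (U \<inter> B)" if "generate_topology_on S U" for U
      using that
    proof (induction rule: generate_topology_on.induct)
      case Empty
      then show ?case by simp
    next
      case (Int a b)
      from openin_Int[OF Int.IH] show ?case by (simp add: Int_ac)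
    next
      case (UN K)
      then have "openin (subtopology \<sigma> B) (\<Union>k\<in>K. k \<inter> B)" by blast
      moreover have "(\<Union>k\<in>K. k \<inter> B) = \<Union>K \<inter> B" by blast
      ultimately show ?case by simp
    next
      case (Basis s)
      then obtain \<tau> where \<tau>: "\<tau> \<in> F" "openin \<tau> s" by (auto simp: S_def)
      then have "subtopology \<tau> B = subtopology \<sigma> B"
        using B by (auto simp: F_def agrees_on_bounded_def)
      moreover have "openin (subtopology \<tau> B) (s \<inter> B)"
        using \<tau>(2) by (auto simp: openin_subtopology)
      ultimately show ?case by simp
    qed
    show ?thesis
      unfolding topology_eq
    proof (intro allI iffI)
      fix U assume "openin (subtopology T B) U"
      then obtain W where "openin T W" "U = W \<inter> B" by (auto simp: openin_subtopology)
      then show "openin (subtopology \<sigma> B) U"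
        using * by (simp add: T_def openin_topology_generated_by_iff)
    next
      fix U assume "openin (subtopology \<sigma> B) U"
      then show "openin (subtopology T B) U"
        using finer[OF \<sigma>] by (auto simp: openin_subtopology)
    qed
  qed
  then have "agrees_on_bounded V \<sigma> T" by (simp add: agrees_on_bounded_def)
  with lc finer have "is_localization V \<sigma> T"
    unfolding is_localization_def F_def by blast
  then show ?thesis by blast
qed


section \<open>Pro-$C^*$-algebras\<close>

text \<open>Seminorms are extensional outside the carrier, so that two continuous $C^*$-seminorms are equal
  iff they agree on the algebra.\<close>

definition cstar_seminorm :: "('a, 'm) star_algebra_scheme \<Rightarrow> ('a \<Rightarrow> real) \<Rightarrow> bool" where
  "cstar_seminorm A p \<longleftrightarrow> p \<in> extensional (carrier A) \<and>
    (\<forall>x\<in>carrier A. 0 \<le> p x) \<and>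
    (\<forall>x\<in>carrier A. \<forall>y\<in>carrier A. p (x \<oplus>\<^bsub>A\<^esub> y) \<le> p x + p y) \<and>
    (\<forall>c. \<forall>x\<in>carrier A. p (c \<odot>\<^bsub>A\<^esub> x) = cmod c * p x) \<and>
    (\<forall>x\<in>carrier A. \<forall>y\<in>carrier A. p (x \<otimes>\<^bsub>A\<^esub> y) \<le> p x * p y) \<and>
    (\<forall>x\<in>carrier A. p (star A x) = p x) \<and>
    (\<forall>x\<in>carrier A. p (star A x \<otimes>\<^bsub>A\<^esub> x) = (p x)\<^sup>2)"

definition cont_seminorms :: "('a, 'm) top_star_algebra_scheme \<Rightarrow> ('a \<Rightarrow> real) set" where
  "cont_seminorms A = {p. cstar_seminorm A p \<and> continuous_map (topo A) euclideanreal p}"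

definition topological_star_algebra :: "('a, 'm) top_star_algebra_scheme \<Rightarrow> bool" where
  "topological_star_algebra A \<longleftrightarrow> star_algebra A \<and> linear_topology A (topo A) \<and>
    continuous_map (prod_topology (topo A) (topo A)) (topo A) (\<lambda>(x, y). x \<otimes>\<^bsub>A\<^esub> y) \<and>
    continuous_map (topo A) (topo A) (star A)"

definition pro_cstar_algebra :: "('a, 'm) top_star_algebra_scheme \<Rightarrow> bool" where
  "pro_cstar_algebra A \<longleftrightarrow> topological_star_algebra A \<and>
    Hausdorff_space (topo A) \<and> complete_in A (topo A) \<and>
    topo A = seminorm_topology A (cont_seminorms A)"

definition sigma_cstar_algebra :: "('a, 'm) top_star_algebra_scheme \<Rightarrow> bool" where
  "sigma_cstar_algebra A \<longleftrightarrow> pro_cstar_algebra A \<and>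
    (\<exists>P. countable P \<and> P \<subseteq> cont_seminorms A \<and> topo A = seminorm_topology A P)"

definition seminorm_kernel :: "('a, 'm) star_algebra_scheme \<Rightarrow> ('a \<Rightarrow> real) \<Rightarrow> 'a set" where
  "seminorm_kernel A p = {x \<in> carrier A. p x = 0}"

text \<open>\<open>seminorm_quotient A p\<close> is $A_p = A/\ker p$. Its norm is the common value of \<^term>\<open>p\<close> on a coset.\<close>

definition seminorm_quotient ::
    "('a, 'm) star_algebra_scheme \<Rightarrow> ('a \<Rightarrow> real) \<Rightarrow> 'a set normed_star_algebra" where
  "seminorm_quotient A p = (let K = seminorm_kernel A p in
    \<lparr>carrier = carrier (A Quot K), mult = mult (A Quot K), one = one (A Quot K),
     zero = zero (A Quot K), add = add (A Quot K),
     smult = (\<lambda>c X. \<Union>x\<in>X. K +>\<^bsub>A\<^esub> (c \<odot>\<^bsub>A\<^esub> x)),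
     star = (\<lambda>X. \<Union>x\<in>X. K +>\<^bsub>A\<^esub> star A x),
     nrm = (\<lambda>X. the_elem (p ` X))\<rparr>)"

text \<open>For $p \ge q$ the surjection $A_p \to A_q$ sends $x + \ker p$ to $x + \ker q$.\<close>

definition quotient_proj ::
    "('a, 'm) star_algebra_scheme \<Rightarrow> ('a \<Rightarrow> real) \<Rightarrow> 'a set \<Rightarrow> 'a set" where
  "quotient_proj A q X = (\<Union>x\<in>X. seminorm_kernel A q +>\<^bsub>A\<^esub> x)"


section \<open>Multipliers of a $C^*$-algebra\<close>

definition bounded_operators :: "('b, 'm) normed_star_algebra_scheme \<Rightarrow> ('b \<Rightarrow> 'b) set" where
  "bounded_operators B = {f \<in> carrier B \<rightarrow>\<^sub>E carrier B.
    (\<forall>x\<in>carrier B. \<forall>y\<in>carrier B. f (x \<oplus>\<^bsub>B\<^esub> y) = f x \<oplus>\<^bsub>B\<^esub> f y) \<and>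
    (\<forall>c. \<forall>x\<in>carrier B. f (c \<odot>\<^bsub>B\<^esub> x) = c \<odot>\<^bsub>B\<^esub> f x) \<and>
    (\<exists>k. \<forall>x\<in>carrier B. nrm B (f x) \<le> k * nrm B x)}"

text \<open>$M(B)$ is the algebra of double centralizers $(L, R)$ of $B$; an element $m$ corresponds to
  $L\,b = mb$ and $R\,b = bm$.\<close>

definition double_centralizers ::
    "('b, 'm) normed_star_algebra_scheme \<Rightarrow> (('b \<Rightarrow> 'b) \<times> ('b \<Rightarrow> 'b)) set" where
  "double_centralizers B = {(L, R). L \<in> bounded_operators B \<and> R \<in> bounded_operators B \<and>
    (\<forall>a\<in>carrier B. \<forall>b\<in>carrier B.
      L (a \<otimes>\<^bsub>B\<^esub> b) = L a \<otimes>\<^bsub>B\<^esub> b \<and> R (a \<otimes>\<^bsub>B\<^esub> b) = a \<otimes>\<^bsub>B\<^esub> R b \<and>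
      R a \<otimes>\<^bsub>B\<^esub> b = a \<otimes>\<^bsub>B\<^esub> L b)}"

definition cstar_multiplier_algebra ::
    "('b, 'm) normed_star_algebra_scheme \<Rightarrow> (('b \<Rightarrow> 'b) \<times> ('b \<Rightarrow> 'b)) star_algebra" where
  "cstar_multiplier_algebra B =
    \<lparr>carrier = double_centralizers B,
     mult = (\<lambda>(L, R) (L', R'). (compose (carrier B) L L', compose (carrier B) R' R)),
     one = (\<lambda>b\<in>carrier B. b, \<lambda>b\<in>carrier B. b),
     zero = (\<lambda>b\<in>carrier B. \<zero>\<^bsub>B\<^esub>, \<lambda>b\<in>carrier B. \<zero>\<^bsub>B\<^esub>),
     add = (\<lambda>(L, R) (L', R'). (\<lambda>b\<in>carrier B. L b \<oplus>\<^bsub>B\<^esub> L' b, \<lambda>b\<in>carrier B. R b \<oplus>\<^bsub>B\<^esub> R' b)),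
     smult = (\<lambda>c (L, R). (\<lambda>b\<in>carrier B. c \<odot>\<^bsub>B\<^esub> L b, \<lambda>b\<in>carrier B. c \<odot>\<^bsub>B\<^esub> R b)),
     star = (\<lambda>(L, R). (\<lambda>b\<in>carrier B. star B (R (star B b)), \<lambda>b\<in>carrier B. star B (L (star B b))))\<rparr>"

definition cstar_strict_topology ::
    "('b, 'm) normed_star_algebra_scheme \<Rightarrow> (('b \<Rightarrow> 'b) \<times> ('b \<Rightarrow> 'b)) topology" where
  "cstar_strict_topology B = seminorm_topology (cstar_multiplier_algebra B)
    ((\<lambda>b (L, R). nrm B (L b)) ` carrier B \<union> (\<lambda>b (L, R). nrm B (R b)) ` carrier B)"

text \<open>For a surjective $*$-homomorphism \<open>\<pi>\<close> from $B$ onto a $C^*$-algebra $C$, the extension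
  $M(B) \to M(C)$ of \<open>\<pi>\<close> sends \<open>m\<close> to the unique \<open>n\<close> with $n\,\pi(b) = \pi(mb)$ and
  $\pi(b)\,n = \pi(bm)$ for all $b \in B$.\<close>

definition extension_maps_to ::
    "('b, 'm) normed_star_algebra_scheme \<Rightarrow> ('b \<Rightarrow> 'c) \<Rightarrow>
      ('b \<Rightarrow> 'b) \<times> ('b \<Rightarrow> 'b) \<Rightarrow> ('c \<Rightarrow> 'c) \<times> ('c \<Rightarrow> 'c) \<Rightarrow> bool" where
  "extension_maps_to B \<pi> m n \<longleftrightarrow>
    (\<forall>b\<in>carrier B. fst n (\<pi> b) = \<pi> (fst m b) \<and> snd n (\<pi> b) = \<pi> (snd m b))"


section \<open>Multipliers of a pro-$C^*$-algebra\<close>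

type_synonym 'a multiplier = "('a \<Rightarrow> real) \<Rightarrow> ('a set \<Rightarrow> 'a set) \<times> ('a set \<Rightarrow> 'a set)"

abbreviation quotient_multipliers ::
    "('a, 'm) top_star_algebra_scheme \<Rightarrow> ('a \<Rightarrow> real) \<Rightarrow>
      (('a set \<Rightarrow> 'a set) \<times> ('a set \<Rightarrow> 'a set)) star_algebra" where
  "quotient_multipliers A p \<equiv> cstar_multiplier_algebra (seminorm_quotient A p)"

text \<open>$M(A) = \varprojlim_{p \in S(A)} M(A_p)$, realised as the algebra of compatible families.\<close>

definition multiplier_algebra ::
    "('a, 'm) top_star_algebra_scheme \<Rightarrow> 'a multiplier star_algebra" where
  "multiplier_algebra A = (let S = cont_seminorms A; M = quotient_multipliers A in
    \<lparr>carrier = {x \<in> (\<Pi>\<^sub>E p\<in>S. carrier (M p)).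
       \<forall>p\<in>S. \<forall>q\<in>S. (\<forall>a\<in>carrier A. q a \<le> p a) \<longrightarrow>
         extension_maps_to (seminorm_quotient A p) (quotient_proj A q) (x p) (x q)},
     mult = (\<lambda>x y. \<lambda>p\<in>S. x p \<otimes>\<^bsub>M p\<^esub> y p),
     one = (\<lambda>p\<in>S. \<one>\<^bsub>M p\<^esub>),
     zero = (\<lambda>p\<in>S. \<zero>\<^bsub>M p\<^esub>),
     add = (\<lambda>x y. \<lambda>p\<in>S. x p \<oplus>\<^bsub>M p\<^esub> y p),
     smult = (\<lambda>c x. \<lambda>p\<in>S. c \<odot>\<^bsub>M p\<^esub> x p),
     star = (\<lambda>x. \<lambda>p\<in>S. star (M p) (x p))\<rparr>)"

definition strict_topology :: "('a, 'm) top_star_algebra_scheme \<Rightarrow> 'a multiplier topology" where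
  "strict_topology A = subtopology
    (product_topology (\<lambda>p. cstar_strict_topology (seminorm_quotient A p)) (cont_seminorms A))
    (carrier (multiplier_algebra A))"

end

theory Submission
  imports Defs
begin

text \<open>
  Let $\tau$ be a locally convex topology agreeing with $\beta$ on bounded sets and $W$ an absolutely
  convex $\tau$-neighbourhood of $0$ in $M(A)$. Then $W$ absorbs bounded sets, so, $A$ being
  bornological, $W$ contains a ball of some $p \in S(A)$ in $A$. Up to a small error the elements of a
  $p$-ball lift to elements on which all seminorms are bounded by one constant, and on these $W$
  contains a strict neighbourhood; hence for a suitable $e$ from a bounded approximate unit the
  compression $T_e y = (1 - e) y (1 - e)$ maps a prescribed $p$-ball into $W$. Choose $e_0, e_1, \dots$
  inductively such that $T_{e_0} \cdots T_{e_n}$ maps the $p$-ball of radius $4^{n+1} d$ into $W$. In the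
  telescoping series $x = \sum_n T_{e_0} \cdots T_{e_{n-1}} (x - T_{e_n} x)$ the terms are controlled by
  $p(e_n x)$ and $p(x e_n)$, and by Cohen's factorization argument these are at most $2^{n+3} p(a x)$ and
  $2^{n+3} p(x a^*)$ for the single element $a = \sum_n 2^{-(n+1)} e_n$. So $W \cap A$ contains a strict
  neighbourhood, and for $x \in M(A)$ one writes $x = (x - x e) + x e$.

  Continuous functional calculus is avoided: for self-adjoint $k$ the unitary
  $u = \exp(i k) = \lim_n (1 + i k / 2^n)^{2^n}$ exists by completeness and satisfies
  $p(u - 1 - i k) = O(p(k)^2)$. Means of powers of $u$ yield the approximate unit, and $u - 1$ yields
  the lifts.
\<close>


section \<open>Complex modules and $*$-algebras\<close>

text \<open>Agreement on bounded sets says nothing directly about a \<open>p\<close>-ball, which in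
  general is unbounded for the other seminorms; hence the lifts bounded by one constant for all of
  \<open>S\<close>, paid for by an error that is small for \<open>p\<close> alone. \<open>W\<close>
  is not assumed closed, so the telescoping series is never summed: it is stopped at some
  \<open>n\<close> for which \<open>2 x\<close> lies in the ball of radius \<open>4 ^ n * d\<close>,
  and the remainder enters with weight 1/2. The rate 4 balances two losses of order
  \<open>2 ^ n\<close>: the \<open>n\<close>-th term has convex weight
  \<open>1 / 2 ^ (n + 2)\<close>, and the factorization bounds it only by a multiple of
  \<open>2 ^ n\<close>. The factorization must be built into the choice of the \<open>e n\<close>:
  each \<open>e n\<close> must also nearly fix, from the right, the products of the
  \<open>e k\<close>, \<open>k < n\<close>, with the inverse of
  \<open>2^-n + sum_{j<n} 2^-(j+1) e_j\<close>. These involve only earlier elements, so one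
  recursion meets all demands. \<open>A\<close> need not have a unit; elements of its unitization
  are represented by what is left after removing the scalar part, or by their action on
  \<open>A\<close>.\<close>

lemma complex_field_simps [simp]:
  "carrier complex_field = UNIV" "mult complex_field = (*)" "one complex_field = 1"
  "zero complex_field = 0" "add complex_field = (+)"
  by (simp_all add: complex_field_def)

locale complex_module = module complex_field V for V (structure)
begin

lemma smult_closed' [simp, intro]: "x \<in> carrier V \<Longrightarrow> c \<odot> x \<in> carrier V"
  by simp

lemma smult_add_left: "x \<in> carrier V \<Longrightarrow> (c + d) \<odot> x = c \<odot> x \<oplus> d \<odot> x"
  using smult_l_distr[of c d x] by simp

lemma smult_add_right: "\<lbrakk>x \<in> carrier V; y \<in> carrier V\<rbrakk> \<Longrightarrow> c \<odot> (x \<oplus> y) = c \<odot> x \<oplus> c \<odot> y"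
  using smult_r_distr[of c x y] by simp

lemma smult_smult [simp]: "x \<in> carrier V \<Longrightarrow> c \<odot> (d \<odot> x) = (c * d) \<odot> x"
  using smult_assoc1[of c d x] by simp

lemma smult_1 [simp]: "x \<in> carrier V \<Longrightarrow> 1 \<odot> x = x"
  using smult_one by simp

lemma smult_0 [simp]: "x \<in> carrier V \<Longrightarrow> 0 \<odot> x = \<zero>"
  using smult_l_null by simp

lemma smult_zero [simp]: "c \<odot> \<zero> = \<zero>"
  using smult_r_null by simp

lemma smult_minus_1: "x \<in> carrier V \<Longrightarrow> (-1) \<odot> x = \<ominus> x"
proof -
  assume x: "x \<in> carrier V"
  have "(-1) \<odot> x \<oplus> x = (-1 + 1) \<odot> x" using x by (subst smult_add_left) simp_all
  then show ?thesis using x by (intro M.minus_equality[symmetric]) simp_all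
qed

lemma smult_uminus_left: "x \<in> carrier V \<Longrightarrow> (- c) \<odot> x = \<ominus> (c \<odot> x)"
  using smult_minus_1[of "c \<odot> x"] by simp

lemma smult_uminus_right: "x \<in> carrier V \<Longrightarrow> c \<odot> (\<ominus> x) = \<ominus> (c \<odot> x)"
  using smult_minus_1[of "c \<odot> x"] smult_minus_1[of x, symmetric] by simp

lemma smult_diff_right: "\<lbrakk>x \<in> carrier V; y \<in> carrier V\<rbrakk> \<Longrightarrow> c \<odot> (x \<ominus> y) = c \<odot> x \<ominus> c \<odot> y"
  by (simp add: a_minus_def smult_add_right smult_uminus_right)

lemma smult_diff_left: "x \<in> carrier V \<Longrightarrow> (c - d) \<odot> x = c \<odot> x \<ominus> d \<odot> x"
  using smult_add_left[of x c "-d"] by (simp add: a_minus_def smult_uminus_left)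

lemma minus_zero [simp]: "\<ominus> \<zero> = \<zero>"
  using smult_uminus_left[of \<zero> 1] by simp

lemma add_half: "x \<in> carrier V \<Longrightarrow> (1/2) \<odot> x \<oplus> (1/2) \<odot> x = x"
  using smult_add_left[of x "1/2" "1/2"] by simp

text \<open>Normal forms for the \<open>algebra\<close> method. Sums of scalars are not distributed
  (\<open>smult_add_left\<close> is absent), so multiples of one vector are merged by hand, for
  instance with \<open>add_half\<close>.\<close>

lemmas module_normal =
  M.a_closed M.zero_closed M.a_inv_closed M.minus_closed smult_closed'
  M.a_assoc M.l_zero M.l_neg M.a_comm M.r_zero M.r_neg M.a_lcomm M.minus_minus M.minus_add
  minus_zero a_minus_def M.r_neg1 M.r_neg2
  smult_add_right smult_uminus_right smult_smult smult_zero smult_1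

lemmas [algebra complex_module "zero V" "add V" "a_inv V" "a_minus V" "smult V"] = module_normal

lemma diff_eq_zero_iff: "\<lbrakk>x \<in> carrier V; y \<in> carrier V\<rbrakk> \<Longrightarrow> x \<ominus> y = \<zero> \<longleftrightarrow> x = y"
proof
  assume c: "x \<in> carrier V" "y \<in> carrier V"
  { assume "x \<ominus> y = \<zero>"
    moreover have "x = (x \<ominus> y) \<oplus> y" using c by algebra
    ultimately show "x = y" using c by simp }
  { assume "x = y" then show "x \<ominus> y = \<zero>" using c by (simp add: a_minus_def M.r_neg) }
qed

end

text \<open>Kept apart from C*-seminorms because the strict seminorms on \<open>M(A)\<close> are
  plain seminorms.\<close>

locale cseminorm = complex_module V for V (structure) +
  fixes p :: "'b \<Rightarrow> real"
  assumes nonneg [simp]: "x \<in> carrier V \<Longrightarrow> 0 \<le> p x"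
    and triangle: "\<lbrakk>x \<in> carrier V; y \<in> carrier V\<rbrakk> \<Longrightarrow> p (x \<oplus> y) \<le> p x + p y"
    and homogeneous: "x \<in> carrier V \<Longrightarrow> p (c \<odot> x) = cmod c * p x"
begin

lemma at_zero [simp]: "p \<zero> = 0"
  using homogeneous[of \<zero> 0] by simp

lemma at_minus [simp]: "x \<in> carrier V \<Longrightarrow> p (\<ominus> x) = p x"
  using homogeneous[of x "-1"] by (simp add: smult_minus_1)

lemma triangle_diff: "\<lbrakk>x \<in> carrier V; y \<in> carrier V\<rbrakk> \<Longrightarrow> p (x \<ominus> y) \<le> p x + p y"
  using triangle[of x "\<ominus> y"] by (simp add: a_minus_def)

lemma diff_commute: "\<lbrakk>x \<in> carrier V; y \<in> carrier V\<rbrakk> \<Longrightarrow> p (x \<ominus> y) = p (y \<ominus> x)"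
proof -
  assume c: "x \<in> carrier V" "y \<in> carrier V"
  have "x \<ominus> y = \<ominus> (y \<ominus> x)" using c by algebra
  then show ?thesis using c by simp
qed

lemma triangle_via:
  "\<lbrakk>x \<in> carrier V; y \<in> carrier V; z \<in> carrier V\<rbrakk> \<Longrightarrow> p (x \<ominus> z) \<le> p (x \<ominus> y) + p (y \<ominus> z)"
proof -
  assume c: "x \<in> carrier V" "y \<in> carrier V" "z \<in> carrier V"
  have "x \<ominus> z = (x \<ominus> y) \<oplus> (y \<ominus> z)" using c by algebra
  then show ?thesis using c triangle[of "x \<ominus> y" "y \<ominus> z"] by simp
qed

lemma le_add_diff: "\<lbrakk>x \<in> carrier V; y \<in> carrier V\<rbrakk> \<Longrightarrow> p x \<le> p y + p (x \<ominus> y)"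
proof -
  assume c: "x \<in> carrier V" "y \<in> carrier V"
  have "x = y \<oplus> (x \<ominus> y)" using c by algebra
  then show ?thesis using c triangle[of y "x \<ominus> y"] by simp
qed

end

context star_algebra
begin

sublocale complex_module A
  by unfold_locales

lemma l_null [simp]: "x \<in> carrier A \<Longrightarrow> \<zero> \<otimes> x = \<zero>"
  using smult_mult_left[of \<zero> x 0] m_closed[of \<zero> x] by simp

lemma r_null [simp]: "x \<in> carrier A \<Longrightarrow> x \<otimes> \<zero> = \<zero>"
  using smult_mult_right[of x \<zero> 0] m_closed[of x \<zero>] by simp

lemma mult_minus_left: "\<lbrakk>x \<in> carrier A; y \<in> carrier A\<rbrakk> \<Longrightarrow> (\<ominus> x) \<otimes> y = \<ominus> (x \<otimes> y)"
  using smult_mult_left[of x y "-1"] by (simp add: smult_minus_1 m_closed)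

lemma mult_minus_right: "\<lbrakk>x \<in> carrier A; y \<in> carrier A\<rbrakk> \<Longrightarrow> x \<otimes> (\<ominus> y) = \<ominus> (x \<otimes> y)"
  using smult_mult_right[of x y "-1"] by (simp add: smult_minus_1 m_closed)

lemma star_zero [simp]: "star A \<zero> = \<zero>"
  using star_smult[of \<zero> 0] star_closed[of \<zero>] by simp

lemma star_minus: "x \<in> carrier A \<Longrightarrow> star A (\<ominus> x) = \<ominus> star A x"
  using star_smult[of x "-1"] by (simp add: smult_minus_1 star_closed)

lemma star_diff: "\<lbrakk>x \<in> carrier A; y \<in> carrier A\<rbrakk> \<Longrightarrow> star A (x \<ominus> y) = star A x \<ominus> star A y"
  by (simp add: a_minus_def star_add star_minus)

lemmas [simp, intro] = m_closed star_closed
lemmas [simp] = star_star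

lemmas star_algebra_normal = module_normal m_closed m_assoc l_distr r_distr
  mult_minus_left mult_minus_right l_null r_null smult_mult_left smult_mult_right
  star_closed star_star star_add star_minus star_mult star_smult star_zero

lemmas [algebra star_algebra "zero A" "add A" "a_inv A" "a_minus A" "mult A" "smult A" "star A"] =
  star_algebra_normal

end

locale cstar_seminorm_on = star_algebra A for A (structure) +
  fixes p
  assumes cstar_seminorm: "cstar_seminorm A p"
begin

sublocale cseminorm A p
  using cstar_seminorm by unfold_locales (auto simp: cstar_seminorm_def)

lemma submultiplicative: "\<lbrakk>x \<in> carrier A; y \<in> carrier A\<rbrakk> \<Longrightarrow> p (x \<otimes> y) \<le> p x * p y"
  and at_star [simp]: "x \<in> carrier A \<Longrightarrow> p (star A x) = p x"
  and cstar_identity: "x \<in> carrier A \<Longrightarrow> p (star A x \<otimes> x) = (p x)\<^sup>2"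
  using cstar_seminorm by (auto simp: cstar_seminorm_def)

lemma cstar_identity': "x \<in> carrier A \<Longrightarrow> p (x \<otimes> star A x) = (p x)\<^sup>2"
  using cstar_identity[of "star A x"] by simp

end


section \<open>Topologies generated by seminorms\<close>

text \<open>The family need not be directed, so basic neighbourhoods come from its finite subsets.
  The space of a generated topology is the union of the generators, which would be empty for empty
  \<open>P\<close>.\<close>

locale seminorm_family = complex_module V for V (structure) +
  fixes P :: "('b \<Rightarrow> real) set"
  assumes nonempty: "P \<noteq> {}"
    and seminorms: "p \<in> P \<Longrightarrow> cseminorm V p"
begin

abbreviation "T \<equiv> seminorm_topology V P"

lemma topspace [simp]: "topspace T = carrier V"
proof -
  obtain p where p: "p \<in> P" using nonempty by blast
  then interpret cseminorm V p by (rule seminorms)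
  have "\<zero> \<in> carrier V" by simp
  have "x \<in> {y \<in> carrier V. p (y \<ominus> x) < 1}" if "x \<in> carrier V" for x
    using that by (simp add: a_minus_def M.r_neg)
  then show ?thesis
    unfolding seminorm_topology_def topology_generated_by_topspace
    using p by (auto intro!: exI[of _ p] zero_less_one) 
qed

lemma openin_subbasic: "\<lbrakk>p \<in> P; x \<in> carrier V\<rbrakk> \<Longrightarrow> openin T {y \<in> carrier V. p (y \<ominus> x) < e}"
proof (cases "0 < e")
  case True
  assume "p \<in> P" "x \<in> carrier V"
  with True show ?thesis unfolding seminorm_topology_def
    by (intro topology_generated_by_Basis) blast
next
  case False
  assume p: "p \<in> P" and x: "x \<in> carrier V"
  interpret cseminorm V p by (rule seminorms) fact
  have "{y \<in> carrier V. p (y \<ominus> x) < e} = {}"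
    using False x nonneg[OF M.minus_closed[OF _ x]] by (fastforce simp: not_less)
  then show ?thesis by (metis openin_empty)
qed

lemma openin_basic:
  assumes "finite F" "F \<subseteq> P" "x \<in> carrier V"
  shows "openin T {y \<in> carrier V. \<forall>p\<in>F. p (y \<ominus> x) < e}"
  using assms
proof (induction F rule: finite_induct)
  case empty
  then show ?case using openin_topspace[of T] by simp
next
  case (insert p F)
  have "{y \<in> carrier V. \<forall>q\<in>insert p F. q (y \<ominus> x) < e} =
      {y \<in> carrier V. p (y \<ominus> x) < e} \<inter> {y \<in> carrier V. \<forall>p\<in>F. p (y \<ominus> x) < e}" by blast
  then show ?case using insert openin_subbasic by auto
qed

lemma openin_iff:
  "openin T U \<longleftrightarrow> U \<subseteq> carrier V \<and>
    (\<forall>x\<in>U. \<exists>F e. finite F \<and> F \<subseteq> P \<and> 0 < e \<and> {y \<in> carrier V. \<forall>p\<in>F. p (y \<ominus> x) < e} \<subseteq> U)"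
    (is "_ \<longleftrightarrow> _ \<and> (\<forall>x\<in>U. ?Q x U)")
proof (intro iffI conjI ballI)
  assume "openin T U"
  then show "U \<subseteq> carrier V" using openin_subset by fastforce
  fix x assume x: "x \<in> U"
  have "generate_topology_on {{y \<in> carrier V. p (y \<ominus> x) < e} | p x e. p \<in> P \<and> x \<in> carrier V \<and> 0 < e} U"
    using \<open>openin T U\<close> by (simp add: seminorm_topology_def openin_topology_generated_by_iff)
  then show "?Q x U" using x
  proof (induction rule: generate_topology_on.induct)
    case Empty
    then show ?case by simp
  next
    case (Int a b)
    then obtain F e F' e' where "finite F" "F \<subseteq> P" "0 < e" "{y \<in> carrier V. \<forall>p\<in>F. p (y \<ominus> x) < e} \<subseteq> a"
      "finite F'" "F' \<subseteq> P" "0 < e'" "{y \<in> carrier V. \<forall>p\<in>F'. p (y \<ominus> x) < e'} \<subseteq> b" by blast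
    then show ?case
      by (intro exI[of _ "F \<union> F'"] exI[of _ "min e e'"]) auto
  next
    case (UN K)
    then show ?case by (meson Union_iff Union_upper subset_trans)
  next
    case (Basis s)
    then obtain p z e where p: "p \<in> P" "z \<in> carrier V" "s = {y \<in> carrier V. p (y \<ominus> z) < e}" by blast
    interpret cseminorm V p by (rule seminorms) fact
    have x: "x \<in> carrier V" "p (x \<ominus> z) < e" using Basis p by auto
    have "p (y \<ominus> z) < e" if "y \<in> carrier V" "p (y \<ominus> x) < e - p (x \<ominus> z)" for y
      using triangle_via[of y x z] that x p by simp
    then show ?case using p x
      by (intro exI[of _ "{p}"] exI[of _ "e - p (x \<ominus> z)"]) auto
  qed
next
  assume U: "U \<subseteq> carrier V \<and> (\<forall>x\<in>U. ?Q x U)"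
  show "openin T U"
  proof (subst openin_subopen, intro ballI)
    fix x assume x: "x \<in> U"
    then obtain F e where F: "finite F" "F \<subseteq> P" "0 < e" "{y \<in> carrier V. \<forall>p\<in>F. p (y \<ominus> x) < e} \<subseteq> U"
      using U by blast
    have xV: "x \<in> carrier V" using U x by blast
    have "p (x \<ominus> x) < e" if "p \<in> F" for p
    proof -
      interpret cseminorm V p using that F seminorms by blast
      show ?thesis using xV F by (simp add: a_minus_def M.r_neg)
    qed
    with openin_basic[OF F(1,2) xV, of e] F(4) xV
    show "\<exists>W. openin T W \<and> x \<in> W \<and> W \<subseteq> U" by blast
  qed
qed

lemma zero_nbhd_iff:
  "zero_nbhd V T U \<longleftrightarrow> U \<subseteq> carrier V \<and>
    (\<exists>F e. finite F \<and> F \<subseteq> P \<and> 0 < e \<and> {y \<in> carrier V. \<forall>p\<in>F. p y < e} \<subseteq> U)"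
proof -
  have z: "y \<ominus> \<zero> = y" if "y \<in> carrier V" for y using that by algebra
  have "\<zero> \<in> T interior_of U \<longleftrightarrow>
    (\<exists>F e. finite F \<and> F \<subseteq> P \<and> 0 < e \<and> {y \<in> carrier V. \<forall>p\<in>F. p y < e} \<subseteq> U)"
    (is "?l \<longleftrightarrow> ?r") if U: "U \<subseteq> carrier V"
  proof
    assume ?l
    then obtain W where W: "openin T W" "\<zero> \<in> W" "W \<subseteq> U" by (auto simp: interior_of_def)
    then obtain F e where F: "finite F" "F \<subseteq> P" "0 < e" "{y \<in> carrier V. \<forall>p\<in>F. p (y \<ominus> \<zero>) < e} \<subseteq> W"
      unfolding openin_iff by blast
    have "{y \<in> carrier V. \<forall>p\<in>F. p y < e} \<subseteq> U" using F(4) W(3) z by auto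
    with F(1-3) show ?r by blast
  next
    assume ?r
    then obtain F e where F: "finite F" "F \<subseteq> P" "0 < e" "{y \<in> carrier V. \<forall>p\<in>F. p y < e} \<subseteq> U" by blast
    have "p \<zero> < e" if "p \<in> F" for p
    proof -
      interpret cseminorm V p using that F seminorms by blast
      show ?thesis using F by simp
    qed
    then have "\<zero> \<in> {y \<in> carrier V. \<forall>p\<in>F. p (y \<ominus> \<zero>) < e}" using z by auto
    moreover have "{y \<in> carrier V. \<forall>p\<in>F. p (y \<ominus> \<zero>) < e} \<subseteq> U" using F(4) z by auto
    ultimately show ?l
      using openin_basic[OF F(1,2) M.zero_closed, of e] unfolding interior_of_def by blast
  qed
  then show ?thesis by (auto simp: zero_nbhd_def)
qed

text \<open>Subbasic sets suffice; the distance of \<open>f s\<close> from the centre of such a set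
  is taken off its radius before the hypothesis at \<open>s\<close> is applied.\<close>

lemma continuous_mapI:
  assumes "\<And>s. s \<in> topspace X \<Longrightarrow> f s \<in> carrier V"
    and "\<And>s p e. \<lbrakk>s \<in> topspace X; p \<in> P; 0 < e\<rbrakk> \<Longrightarrow>
      \<exists>U. openin X U \<and> s \<in> U \<and> (\<forall>s'\<in>U. p (f s' \<ominus> f s) < e)"
  shows "continuous_map X T f"
  unfolding seminorm_topology_def
proof (rule continuous_on_generated_topo)
  fix U assume "U \<in> {{y \<in> carrier V. p (y \<ominus> x) < e} | p x e. p \<in> P \<and> x \<in> carrier V \<and> 0 < e}"
  then obtain p x e where p: "p \<in> P" "x \<in> carrier V" and U: "U = {y \<in> carrier V. p (y \<ominus> x) < e}" by blast
  interpret cseminorm V p by (rule seminorms) fact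
  show "openin X (f -` U \<inter> topspace X)"
  proof (subst openin_subopen, intro ballI)
    fix s assume s: "s \<in> f -` U \<inter> topspace X"
    then have "0 < e - p (f s \<ominus> x)" using U by simp
    then obtain W where W: "openin X W" "s \<in> W" "\<forall>s'\<in>W. p (f s' \<ominus> f s) < e - p (f s \<ominus> x)"
      using assms(2)[of s p] s p by blast
    have WX: "W \<subseteq> topspace X" using W(1) by (rule openin_subset)
    have *: "f s' \<in> U" if "s' \<in> W" for s'
    proof -
      have "s' \<in> topspace X" using WX that by (rule subsetD)
      then have fs: "f s' \<in> carrier V" "f s \<in> carrier V" using assms(1) s by auto
      have "p (f s' \<ominus> x) \<le> p (f s' \<ominus> f s) + p (f s \<ominus> x)"
        using fs p(2) by (intro triangle_via)
      also have "\<dots> < e" using bspec[OF W(3) that] by simp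
      finally show ?thesis using fs by (simp add: U)
    qed
    have "W \<subseteq> f -` U \<inter> topspace X" using WX * by (simp add: subset_iff)
    with W(1,2) show "\<exists>W. openin X W \<and> s \<in> W \<and> W \<subseteq> f -` U \<inter> topspace X" by (intro exI conjI)
  qed
next
  show "f ` topspace X \<subseteq> \<Union> {{y \<in> carrier V. p (y \<ominus> x) < e} | p x e. p \<in> P \<and> x \<in> carrier V \<and> 0 < e}"
    using assms(1) topspace by (auto simp: seminorm_topology_def topology_generated_by_topspace)
qed

lemma linear_topology: "linear_topology V T"
  unfolding linear_topology_def
proof (intro conjI topspace continuous_mapI)
  fix s p and e :: real
  assume s: "s \<in> topspace (prod_topology T T)" and p: "p \<in> P" and e: "0 < e"
  interpret cseminorm V p by (rule seminorms) fact
  obtain x y where xy: "s = (x, y)" "x \<in> carrier V" "y \<in> carrier V" using s by auto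
  let ?U = "\<lambda>z. {z' \<in> carrier V. p (z' \<ominus> z) < e / 2}"
  have *: "p ((x' \<oplus> y') \<ominus> (x \<oplus> y)) < e" if "x' \<in> ?U x" "y' \<in> ?U y" for x' y'
  proof -
    have "(x' \<oplus> y') \<ominus> (x \<oplus> y) = (x' \<ominus> x) \<oplus> (y' \<ominus> y)"
      using that xy by simp algebra
    then show ?thesis
      using that xy triangle[of "x' \<ominus> x" "y' \<ominus> y"] by simp
  qed
  have "openin (prod_topology T T) (?U x \<times> ?U y)"
    using xy openin_subbasic[OF p, of _ "e / 2"] by (simp add: openin_prod_Times_iff del: less_divide_eq_numeral1)
  moreover have "s \<in> ?U x \<times> ?U y" using xy e by (simp add: a_minus_def M.r_neg)
  ultimately show "\<exists>U. openin (prod_topology T T) U \<and> s \<in> U \<and>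
      (\<forall>s'\<in>U. p ((case s' of (x, y) \<Rightarrow> x \<oplus> y) \<ominus> (case s of (x, y) \<Rightarrow> x \<oplus> y)) < e)"
    using * xy by (intro exI[of _ "?U x \<times> ?U y"]) auto
next
  fix s :: "complex \<times> 'b" and p and e :: real
  assume s: "s \<in> topspace (prod_topology euclidean T)" and p: "p \<in> P" and e: "0 < e"
  interpret cseminorm V p by (rule seminorms) fact
  obtain c x where cx: "s = (c, x)" "x \<in> carrier V" using s by auto
  define d where "d = min 1 (e / (2 * (p x + 1)))"
  have px: "p x + 1 > 0" using cx(2) by (simp add: add_nonneg_pos)
  have d: "0 < d" "d \<le> 1" "d * (p x + 1) \<le> e / 2"
  proof -
    show "0 < d" "d \<le> 1" using px e by (auto simp: d_def)
    have "d * (p x + 1) \<le> e / (2 * (p x + 1)) * (p x + 1)"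
      using px by (intro mult_right_mono) (auto simp: d_def)
    also have "\<dots> = e / 2" using px by (simp add: field_simps)
    finally show "d * (p x + 1) \<le> e / 2" .
  qed
  define r where "r = e / (2 * (cmod c + 1))"
  have c: "cmod c + 1 > 0" by (simp add: add_nonneg_pos)
  have r: "0 < r" "(cmod c + 1) * r = e / 2" using e c by (auto simp: r_def field_simps)
  let ?U = "{z \<in> carrier V. p (z \<ominus> x) < r}"
  have *: "p (c' \<odot> x' \<ominus> c \<odot> x) < e" if "c' \<in> ball c d" "x' \<in> ?U" for c' x'
  proof -
    have eq: "c' \<odot> x' \<ominus> c \<odot> x = c' \<odot> (x' \<ominus> x) \<oplus> (c' - c) \<odot> x"
      using that cx by (simp add: smult_diff_left) algebra
    have "cmod c' \<le> cmod c + cmod (c' - c)" by (metis add.commute diff_add_cancel norm_triangle_ineq)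
    moreover have cd: "cmod (c' - c) < d" using that by (simp add: dist_norm norm_minus_commute)
    ultimately have c': "cmod c' \<le> cmod c + 1" using d by simp
    have "p (c' \<odot> x' \<ominus> c \<odot> x) \<le> cmod c' * p (x' \<ominus> x) + cmod (c' - c) * p x"
      unfolding eq using that cx triangle[of "c' \<odot> (x' \<ominus> x)" "(c' - c) \<odot> x"]
      by (simp add: homogeneous)
    also have "cmod c' * p (x' \<ominus> x) \<le> (cmod c + 1) * p (x' \<ominus> x)"
      using c' that cx by (intro mult_right_mono) auto
    also have "(cmod c + 1) * p (x' \<ominus> x) < (cmod c + 1) * r"
      using c that by (intro mult_strict_left_mono) auto
    also have "cmod (c' - c) * p x \<le> d * (p x + 1)"
      using cd cx d by (intro mult_mono) auto
    finally show ?thesis using r d by simp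
  qed
  have "openin (prod_topology euclidean T) (ball c d \<times> ?U)"
    using openin_subbasic[OF p cx(2)] by (simp add: openin_prod_Times_iff)
  moreover have "s \<in> ball c d \<times> ?U" using cx r d by (simp add: a_minus_def M.r_neg)
  ultimately show "\<exists>U. openin (prod_topology euclidean T) U \<and> s \<in> U \<and>
      (\<forall>s'\<in>U. p ((case s' of (c, x) \<Rightarrow> c \<odot> x) \<ominus> (case s of (c, x) \<Rightarrow> c \<odot> x)) < e)"
    using * cx by (intro exI[of _ "ball c d \<times> ?U"]) auto
qed auto

lemma locally_convex: "locally_convex V T"
  unfolding locally_convex_def
proof (intro conjI linear_topology allI impI)
  fix U assume "zero_nbhd V T U"
  then obtain F e where F: "finite F" "F \<subseteq> P" "0 < e" and FU: "{y \<in> carrier V. \<forall>p\<in>F. p y < e} \<subseteq> U"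
    unfolding zero_nbhd_iff by blast
  let ?C = "{y \<in> carrier V. \<forall>p\<in>F. p y < e}"
  have "convex_in V ?C"
    unfolding convex_in_def
  proof (intro conjI ballI)
    fix x y and t :: real assume x: "x \<in> ?C" and y: "y \<in> ?C" and t: "t \<in> {0..1}"
    have "p (of_real t \<odot> x \<oplus> of_real (1 - t) \<odot> y) < e" if p: "p \<in> F" for p
    proof -
      interpret cseminorm V p using p F seminorms by blast
      have "p (of_real t \<odot> x \<oplus> of_real (1 - t) \<odot> y) \<le> t * p x + (1 - t) * p y"
        using x y t triangle[of "of_real t \<odot> x" "of_real (1 - t) \<odot> y"]
        by (simp add: homogeneous del: of_real_diff)
      also have "\<dots> < e"
        using x y t p convex_bound_lt[of "p x" e "p y" t "1 - t"] by simp
      finally show ?thesis .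
    qed
    then show "of_real t \<odot> x \<oplus> of_real (1 - t) \<odot> y \<in> ?C" using x y by simp
  qed auto
  moreover have "zero_nbhd V T ?C" unfolding zero_nbhd_iff using F by blast
  ultimately show "\<exists>C. convex_in V C \<and> zero_nbhd V T C \<and> C \<subseteq> U" using FU by blast
qed

lemma seminorm_nbhd: "\<lbrakk>p \<in> P; 0 < e\<rbrakk> \<Longrightarrow> zero_nbhd V T {y \<in> carrier V. p y < e}"
  unfolding zero_nbhd_iff by (intro conjI exI[of _ "{p}"] exI[of _ e]) auto

text \<open>Absorption by the unit ball of \<open>p\<close>, already for the scalar
  \<open>r\<close>, gives a bound for \<open>p\<close>. Conversely, a basic neighbourhood involves
  finitely many seminorms, whose bounds are added.\<close>

lemma bounded_in_iff:
  "bounded_in V T B \<longleftrightarrow> B \<subseteq> carrier V \<and> (\<forall>p\<in>P. \<exists>K. \<forall>b\<in>B. p b \<le> K)"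
proof (intro iffI conjI ballI)
  assume B: "bounded_in V T B"
  then show "B \<subseteq> carrier V" by (simp add: bounded_in_def)
  fix p assume p: "p \<in> P"
  interpret cseminorm V p by (rule seminorms) fact
  from B have "absorbs V {y \<in> carrier V. p y < 1} B"
    using seminorm_nbhd[OF p, of 1] by (simp add: bounded_in_def)
  then obtain r where r: "0 < r" "\<forall>c. r \<le> cmod c \<longrightarrow> B \<subseteq> (\<lambda>u. c \<odot> u) ` {y \<in> carrier V. p y < 1}"
    by (auto simp: absorbs_def)
  then have *: "B \<subseteq> (\<lambda>u. of_real r \<odot> u) ` {y \<in> carrier V. p y < 1}"
    using spec[OF r(2), of "of_real r"] by simp
  have "p b \<le> r" if b: "b \<in> B" for b
  proof -
    from subsetD[OF * b] obtain u where u: "b = of_real r \<odot> u" "u \<in> {y \<in> carrier V. p y < 1}"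
      by (rule imageE)
    then show ?thesis using r homogeneous[of u "of_real r"] by simp
  qed
  then show "\<exists>K. \<forall>b\<in>B. p b \<le> K" by blast
next
  assume B: "B \<subseteq> carrier V \<and> (\<forall>p\<in>P. \<exists>K. \<forall>b\<in>B. p b \<le> K)"
  then obtain K where K: "\<And>p b. \<lbrakk>p \<in> P; b \<in> B\<rbrakk> \<Longrightarrow> p b \<le> K p" by metis
  show "bounded_in V T B"
    unfolding bounded_in_def
  proof (intro conjI allI impI)
    show "B \<subseteq> carrier V" using B by blast
    fix U assume "zero_nbhd V T U"
    then obtain F e where F: "finite F" "F \<subseteq> P" "0 < e" and FU: "{y \<in> carrier V. \<forall>p\<in>F. p y < e} \<subseteq> U"
      unfolding zero_nbhd_iff by blast
    define M where "M = (\<Sum>p\<in>F. \<bar>K p\<bar>)"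
    have M: "K p \<le> M" if "p \<in> F" for p
      unfolding M_def using that F(1) member_le_sum[of p F "\<lambda>p. \<bar>K p\<bar>"] by auto
    have M0: "0 \<le> M" by (simp add: M_def sum_nonneg)
    define r where "r = (M + 1) / e"
    have r: "0 < r" using F M0 by (simp add: r_def)
    have "b \<in> (\<lambda>u. c \<odot> u) ` U" if c: "r \<le> cmod c" and b: "b \<in> B" for c b
    proof
      have c0: "c \<noteq> 0" using r c by auto
      have bV: "b \<in> carrier V" using b B by blast
      then show "b = c \<odot> ((1 / c) \<odot> b)" using c0 by simp
      have "p ((1 / c) \<odot> b) < e" if p: "p \<in> F" for p
      proof -
        interpret cseminorm V p using p F seminorms by blast
        have "p b < r * e" using K[of p b] M[OF p] p F b by (auto simp: r_def)
        also have "\<dots> \<le> cmod c * e" using c F by simp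
        finally show ?thesis using bV c0
          by (simp add: homogeneous norm_divide field_simps)
      qed
      then show "(1 / c) \<odot> b \<in> U" using FU bV by auto
    qed
    then show "absorbs V U B" using r unfolding absorbs_def by blast
  qed
qed

end


section \<open>Exponentials of self-adjoint elements\<close>

lemma one_plus_div_power_le_exp:
  fixes x :: real
  assumes "0 \<le> x"
  shows "(1 + x / 2 ^ n) ^ (2 ^ n) \<le> exp x"
proof -
  have "(1 + x / 2 ^ n) ^ (2 ^ n) \<le> exp (x / 2 ^ n) ^ (2 ^ n)"
    using assms by (intro power_mono exp_ge_add_one_self) simp
  also have "\<dots> = exp x" by (simp flip: exp_of_nat_mult)
  finally show ?thesis .
qed

text \<open>All that the construction inside \<open>A\<close> uses of a pro-C*-algebra. Completeness
  enters through sequences with summable increments, where the majorant may depend on the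
  seminorm.\<close>

locale cstar_family = star_algebra A for A (structure) +
  fixes S :: "('b \<Rightarrow> real) set"
  assumes cstar: "p \<in> S \<Longrightarrow> cstar_seminorm A p"
    and separating: "\<lbrakk>x \<in> carrier A; \<And>p. p \<in> S \<Longrightarrow> p x = 0\<rbrakk> \<Longrightarrow> x = \<zero>"
    and directed: "\<lbrakk>p \<in> S; q \<in> S\<rbrakk> \<Longrightarrow> \<exists>r\<in>S. \<forall>x\<in>carrier A. p x \<le> r x \<and> q x \<le> r x"
    and summable_limit: "\<lbrakk>\<And>n. s n \<in> carrier A;
        \<And>p. p \<in> S \<Longrightarrow> \<exists>t. summable t \<and> (\<forall>n. p (s (Suc n) \<ominus> s n) \<le> t n)\<rbrakk>
      \<Longrightarrow> \<exists>l\<in>carrier A. \<forall>p\<in>S. (\<lambda>n. p (s n \<ominus> l)) \<longlonglongrightarrow> 0"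
begin

lemma cstar_on: "p \<in> S \<Longrightarrow> cstar_seminorm_on A p"
  using cstar by unfold_locales

text \<open>\<open>circ a b\<close> encodes multiplication in the unitization: \<open>1 + circ a b = (1 + a) (1 + b)\<close>.\<close>

abbreviation circ :: "'b \<Rightarrow> 'b \<Rightarrow> 'b" where
  "circ a b \<equiv> a \<oplus> b \<oplus> a \<otimes> b"

text \<open>\<open>1 + sq a = (1 + a)^2\<close>, so \<open>(sq ^^ n) a\<close> stands for
  \<open>(1 + a)^(2^n) - 1\<close>.\<close>

abbreviation sq :: "'b \<Rightarrow> 'b" where
  "sq a \<equiv> circ a a"

section \<open>Iterated squaring in the unitization\<close>

lemma sq_pow_closed [simp]: "a \<in> carrier A \<Longrightarrow> (sq ^^ n) a \<in> carrier A"
  by (induction n) auto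

lemma seminorm_sq:
  assumes p: "p \<in> S" and a: "a \<in> carrier A"
  shows "p (sq a) \<le> (1 + p a)\<^sup>2 - 1"
proof -
  interpret cstar_seminorm_on A p using p by (rule cstar_on)
  show ?thesis
    using triangle[of "a \<oplus> a" "a \<otimes> a"] triangle[of a a] submultiplicative[of a a] a
    by (simp add: power2_eq_square algebra_simps)
qed

lemma seminorm_sq_diff:
  assumes p: "p \<in> S" and cl: "a \<in> carrier A" "b \<in> carrier A"
  shows "p (sq a \<ominus> sq b) \<le> p (a \<ominus> b) * (2 + p a + p b)"
proof -
  interpret cstar_seminorm_on A p using p by (rule cstar_on)
  have "sq a \<ominus> sq b = ((a \<ominus> b) \<oplus> (a \<ominus> b)) \<oplus> ((a \<ominus> b) \<otimes> a \<oplus> b \<otimes> (a \<ominus> b))"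
    using cl by algebra
  then show ?thesis
    using triangle[of "(a \<ominus> b) \<oplus> (a \<ominus> b)" "(a \<ominus> b) \<otimes> a \<oplus> b \<otimes> (a \<ominus> b)"]
      triangle[of "a \<ominus> b" "a \<ominus> b"] triangle[of "(a \<ominus> b) \<otimes> a" "b \<otimes> (a \<ominus> b)"]
      submultiplicative[of "a \<ominus> b" a] submultiplicative[of b "a \<ominus> b"] cl
    by (simp add: algebra_simps)
qed

lemma seminorm_sq_pow:
  assumes p: "p \<in> S" and a: "a \<in> carrier A"
  shows "p ((sq ^^ n) a) \<le> (1 + p a) ^ (2 ^ n) - 1"
proof (induction n)
  case (Suc n)
  interpret cstar_seminorm_on A p using p by (rule cstar_on)
  let ?b = "(sq ^^ n) a"
  have b: "?b \<in> carrier A" using a by simp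
  have "p (sq ?b) \<le> (1 + p ?b)\<^sup>2 - 1"
    using seminorm_sq[OF p b] .
  also have "\<dots> \<le> ((1 + p a) ^ (2 ^ n))\<^sup>2 - 1"
    using Suc b by (simp add: power_mono)
  finally show ?case by (simp add: power_mult[symmetric] mult.commute)
qed simp

text \<open>A Lipschitz estimate for the \<open>2^n\<close>-th power: passing from \<open>i\<close>
  to \<open>i + 1\<close> squarings multiplies the distance by at most
  \<open>2 (1 + \<rho>)^(2^i)\<close>, and the exponents \<open>2^0 + ... + 2^(n-1)\<close> add up
  to less than \<open>2^n\<close>.\<close>

lemma seminorm_sq_pow_diff:
  assumes p: "p \<in> S" and ab: "a \<in> carrier A" "b \<in> carrier A" and \<rho>: "p a \<le> \<rho>" "p b \<le> \<rho>"
  shows "p ((sq ^^ n) a \<ominus> (sq ^^ n) b) \<le> 2 ^ n * (1 + \<rho>) ^ (2 ^ n) * p (a \<ominus> b)"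
proof (induction n)
  case 0
  interpret cstar_seminorm_on A p using p by (rule cstar_on)
  have "0 \<le> \<rho>" by (rule order_trans[OF nonneg[OF ab(1)] \<rho>(1)])
  then have "1 * p (a \<ominus> b) \<le> (1 + \<rho>) * p (a \<ominus> b)"
    using ab by (intro mult_right_mono) auto
  then show ?case by simp
next
  case (Suc n)
  interpret cstar_seminorm_on A p using p by (rule cstar_on)
  have \<rho>0: "0 \<le> \<rho>" by (rule order_trans[OF nonneg[OF ab(1)] \<rho>(1)])
  have double: "(1 + \<rho>) ^ (2 ^ Suc n) = (1 + \<rho>) ^ (2 ^ n) * (1 + \<rho>) ^ (2 ^ n)"
    by (simp flip: power_add mult_2)
  let ?a = "(sq ^^ n) a" and ?b = "(sq ^^ n) b"
  have cl: "?a \<in> carrier A" "?b \<in> carrier A" using ab by auto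
  have "(1 + p a) ^ (2 ^ n) \<le> (1 + \<rho>) ^ (2 ^ n)" "(1 + p b) ^ (2 ^ n) \<le> (1 + \<rho>) ^ (2 ^ n)"
    using \<rho> ab by (auto intro!: power_mono)
  then have le: "p ?a \<le> (1 + \<rho>) ^ (2 ^ n) - 1" "p ?b \<le> (1 + \<rho>) ^ (2 ^ n) - 1"
    using seminorm_sq_pow[OF p, of a n] seminorm_sq_pow[OF p, of b n] ab by linarith+
  have "p (sq ?a \<ominus> sq ?b) \<le> p (?a \<ominus> ?b) * (2 + p ?a + p ?b)"
    using seminorm_sq_diff[OF p cl] .
  also have "\<dots> \<le> p (?a \<ominus> ?b) * (2 * (1 + \<rho>) ^ (2 ^ n))"
    using le cl by (intro mult_left_mono) auto
  also have "\<dots> \<le> (2 ^ n * (1 + \<rho>) ^ (2 ^ n) * p (a \<ominus> b)) * (2 * (1 + \<rho>) ^ (2 ^ n))"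
    using Suc \<rho>0 by (intro mult_right_mono) auto
  also have "\<dots> = 2 ^ Suc n * (1 + \<rho>) ^ (2 ^ Suc n) * p (a \<ominus> b)"
    unfolding double by (simp add: mult_ac)
  finally show ?case by simp
qed

lemma circ_assoc:
  "\<lbrakk>a \<in> carrier A; b \<in> carrier A; c \<in> carrier A\<rbrakk> \<Longrightarrow> circ (circ a b) c = circ a (circ b c)"
  by algebra

text \<open>For \<open>u = 1 + a\<close> and \<open>v = 1 + b\<close> this is
  \<open>u^2 v^2 = (u v)^2\<close>, obtained by rebracketing with \<open>circ_assoc\<close> and
  \<open>u v = v u\<close>. The second conclusion carries commutation through the induction in
  \<open>sq_pow_circ\<close>.\<close>

lemma sq_circ_commuting:
  assumes cl: "a \<in> carrier A" "b \<in> carrier A" and ab: "a \<otimes> b = b \<otimes> a"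
  shows "circ (sq a) (sq b) = sq (circ a b)" "sq a \<otimes> sq b = sq b \<otimes> sq a"
proof -
  have c: "circ a b = circ b a" using cl ab by (simp add: M.a_comm)
  have c': "circ a b \<in> carrier A" "sq b \<in> carrier A" "sq a \<in> carrier A" using cl by auto
  have s: "circ a (sq b) = circ (sq b) a"
    using circ_assoc[OF cl(1,2,2)] circ_assoc[OF cl(2,1,2)] circ_assoc[OF cl(2,2,1)] c by simp
  show "circ (sq a) (sq b) = sq (circ a b)"
    using circ_assoc[OF cl(1,1) c'(2)] circ_assoc[OF cl c'(1)] circ_assoc[OF cl(2,1,2)]
      circ_assoc[OF cl(2,2,1)] c circ_assoc[OF cl(1,2,2)] by simp
  have "circ (sq a) (sq b) = circ (sq b) (sq a)"
    using circ_assoc[OF cl(1,1) c'(2)] circ_assoc[OF cl(1) c'(2) cl(1)] circ_assoc[OF c'(2) cl(1,1)] s by simp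
  \<comment> \<open>Commutation for \<open>circ\<close> becomes commutation for the product, because
    the product is \<open>circ\<close> minus a symmetric sum.\<close>
  moreover have "x \<otimes> y = circ x y \<ominus> (x \<oplus> y)" if "x \<in> carrier A" "y \<in> carrier A" for x y
    using that by algebra
  ultimately show "sq a \<otimes> sq b = sq b \<otimes> sq a"
    using c'(2,3) M.a_comm[OF c'(2,3)] by metis
qed

lemma sq_pow_circ:
  assumes "a \<in> carrier A" "b \<in> carrier A" "a \<otimes> b = b \<otimes> a"
  shows "circ ((sq ^^ n) a) ((sq ^^ n) b) = (sq ^^ n) (circ a b)"
proof -
  have "circ ((sq ^^ n) a) ((sq ^^ n) b) = (sq ^^ n) (circ a b) \<and>
      (sq ^^ n) a \<otimes> (sq ^^ n) b = (sq ^^ n) b \<otimes> (sq ^^ n) a"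
  proof (induction n)
    case (Suc n)
    let ?a = "(sq ^^ n) a" and ?b = "(sq ^^ n) b"
    have cl: "?a \<in> carrier A" "?b \<in> carrier A" using assms by auto
    have IH: "circ ?a ?b = (sq ^^ n) (circ a b)" "?a \<otimes> ?b = ?b \<otimes> ?a" using Suc by blast+
    have "circ (sq ?a) (sq ?b) = sq ((sq ^^ n) (circ a b))"
      using sq_circ_commuting(1)[OF cl IH(2)] unfolding IH(1) .
    then show ?case using sq_circ_commuting(2)[OF cl IH(2)] by simp
  qed (use assms in auto)
  then show ?thesis ..
qed

lemma star_sq_pow: "a \<in> carrier A \<Longrightarrow> star A ((sq ^^ n) a) = (sq ^^ n) (star A a)"
  by (induction n) (simp_all add: star_add star_mult)

text \<open>For each seminorm, continuity of the product in the unitization: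
  \<open>u_n v_n - u v = (u_n - u) v + u_n (v_n - v)\<close>, where \<open>u_n\<close>,
  \<open>v_n\<close>, \<open>u\<close>, \<open>v\<close> are 1 plus the given elements. Separation
  turns vanishing seminorms into zero.\<close>

lemma circ_limit_zero:
  assumes cl: "\<And>n. a n \<in> carrier A" "\<And>n. b n \<in> carrier A" "x \<in> carrier A" "y \<in> carrier A"
    and lim: "\<And>p. p \<in> S \<Longrightarrow> (\<lambda>n. p (a n \<ominus> x)) \<longlonglongrightarrow> 0" "\<And>p. p \<in> S \<Longrightarrow> (\<lambda>n. p (b n \<ominus> y)) \<longlonglongrightarrow> 0"
    and zero: "\<And>p. p \<in> S \<Longrightarrow> (\<lambda>n. p (circ (a n) (b n))) \<longlonglongrightarrow> 0"
  shows "circ x y = \<zero>"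
proof (rule separating)
  fix p assume p: "p \<in> S"
  interpret cstar_seminorm_on A p using p by (rule cstar_on)
  define d where "d n = p (a n \<ominus> x)" for n
  define d' where "d' n = p (b n \<ominus> y)" for n
  have le: "p (circ x y) \<le> p (circ (a n) (b n)) + (d n + d' n + d n * p y + (p x + d n) * d' n)" for n
  proof -
    note c = cl(1)[of n] cl(2)[of n] cl(3,4)
    have eq: "circ (a n) (b n) \<ominus> circ x y =
        ((a n \<ominus> x) \<oplus> (b n \<ominus> y)) \<oplus> ((a n \<ominus> x) \<otimes> y \<oplus> a n \<otimes> (b n \<ominus> y))"
      using c by algebra
    have "p (a n) \<le> p x + d n" using le_add_diff[of "a n" x] c by (simp add: d_def)
    then have "p (a n) * d' n \<le> (p x + d n) * d' n" using c by (intro mult_right_mono) (auto simp: d'_def)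
    then have "p (circ (a n) (b n) \<ominus> circ x y) \<le> d n + d' n + d n * p y + (p x + d n) * d' n"
      unfolding eq
      using c triangle[of "(a n \<ominus> x) \<oplus> (b n \<ominus> y)" "(a n \<ominus> x) \<otimes> y \<oplus> a n \<otimes> (b n \<ominus> y)"]
        triangle[of "a n \<ominus> x" "b n \<ominus> y"] triangle[of "(a n \<ominus> x) \<otimes> y" "a n \<otimes> (b n \<ominus> y)"]
        submultiplicative[of "a n \<ominus> x" y] submultiplicative[of "a n" "b n \<ominus> y"]
      by (simp add: d_def d'_def)
    then show ?thesis
      using le_add_diff[of "circ x y" "circ (a n) (b n)"] diff_commute[of "circ x y" "circ (a n) (b n)"] c
      by simp
  qed
  have lim': "(\<lambda>n. p (circ (a n) (b n)) + (d n + d' n + d n * p y + (p x + d n) * d' n))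
      \<longlonglongrightarrow> 0 + (0 + 0 + 0 * p y + (p x + 0) * 0)"
    unfolding d_def d'_def by (intro tendsto_intros lim zero p)
  have "p (circ x y) \<le> 0 + (0 + 0 + 0 * p y + (p x + 0) * 0)"
    by (rule LIMSEQ_le_const[OF lim']) (intro exI allI impI le)
  then have "p (circ x y) \<le> 0" by simp
  then show "p (circ x y) = 0" using cl by (intro antisym nonneg) auto
qed (use cl in auto)

lemma telescope_le:
  assumes p: "p \<in> S" and s: "\<And>n. s n \<in> carrier A" and t: "\<And>n. p (s (Suc n) \<ominus> s n) \<le> t n"
  shows "p (s n \<ominus> s 0) \<le> sum t {..<n}"
proof (induction n)
  case 0
  interpret cstar_seminorm_on A p using p by (rule cstar_on)
  show ?case using s by (simp add: a_minus_def M.r_neg)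
next
  case (Suc n)
  interpret cstar_seminorm_on A p using p by (rule cstar_on)
  have "p (s (Suc n) \<ominus> s 0) \<le> p (s (Suc n) \<ominus> s n) + p (s n \<ominus> s 0)"
    using s by (intro triangle_via)
  then show ?case using Suc t[of n] by simp
qed

text \<open>$w = \exp(i k) - 1$, the limit of $(1 + i k / 2^n)^{2^n} - 1$.\<close>

lemma exp_unitary:
  assumes k: "k \<in> carrier A" "star A k = k"
  obtains w where "w \<in> carrier A" "circ (star A w) w = \<zero>" "circ w (star A w) = \<zero>"
    "\<And>p. p \<in> S \<Longrightarrow> p (w \<ominus> \<i> \<odot> k) \<le> exp (p k) / 2 * (p k)\<^sup>2"
proof -
  define D where "D n = (\<i> / 2 ^ n) \<odot> k" for n :: nat
  define w where "w n = (sq ^^ n) (D n)" for n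
  have D [simp]: "D n \<in> carrier A" for n using k by (simp add: D_def)
  have w [simp]: "w n \<in> carrier A" for n by (simp add: w_def)
  have pD: "p (D n) = p k / 2 ^ n" if "p \<in> S" for p n
  proof -
    interpret cstar_seminorm_on A p using that by (rule cstar_on)
    show ?thesis using k by (simp add: D_def homogeneous norm_divide norm_power)
  qed
  have step: "p (w (Suc n) \<ominus> w n) \<le> exp (p k) / 4 * (p k)\<^sup>2 * (1 / 2) ^ n" if p: "p \<in> S" for p n
  proof -
    interpret cstar_seminorm_on A p using that by (rule cstar_on)
    have ws: "w (Suc n) = (sq ^^ n) (sq (D (Suc n)))"
      unfolding w_def funpow_Suc_right by simp
    \<comment> \<open>\<open>1 + \<rho>\<close> is the square of \<open>1 + p k / 2^(n+1)\<close>,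
      so its \<open>2^n\<close>-th power is at most \<open>exp (p k)\<close>, uniformly in
      \<open>n\<close>.\<close>
    define \<rho> where "\<rho> = (1 + p k / 2 ^ Suc n)\<^sup>2 - 1"
    \<comment> \<open>Both approximants are \<open>2^n\<close>-th powers, of
      \<open>(1 + D (n+1))^2\<close> and of \<open>1 + D n\<close>; these differ only by the
      second-order term \<open>D (n+1)^2\<close>.\<close>
    have eq: "sq (D (Suc n)) \<ominus> D n = (- 1 / 4 ^ Suc n) \<odot> (k \<otimes> k)"
    proof -
      have "D (Suc n) \<oplus> D (Suc n) = D n"
        using k by (simp add: D_def smult_add_left[symmetric])
      moreover have "D (Suc n) \<otimes> D (Suc n) = (- 1 / 4 ^ Suc n) \<odot> (k \<otimes> k)"
        using k by (simp add: D_def smult_mult_left smult_mult_right power_mult_distrib[symmetric])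
      moreover have "(D n \<oplus> x) \<ominus> D n = x" if "x \<in> carrier A" for x
        using D[of n] that by algebra
      ultimately show ?thesis using k by simp
    qed
    have a1: "p (sq (D (Suc n)) \<ominus> D n) \<le> (p k)\<^sup>2 / 4 ^ Suc n"
      unfolding eq using k submultiplicative[of k k]
      by (simp add: homogeneous norm_divide norm_power power2_eq_square divide_right_mono)
    have b1: "p (sq (D (Suc n))) \<le> \<rho>"
      using seminorm_sq[OF p D[of "Suc n"]] pD[OF p, of "Suc n"] by (simp add: \<rho>_def)
    have b2: "p (D n) \<le> \<rho>"
      using pD[OF p] by (simp add: \<rho>_def power2_eq_square algebra_simps)
    have "p ((sq ^^ n) (sq (D (Suc n))) \<ominus> (sq ^^ n) (D n))
        \<le> 2 ^ n * (1 + \<rho>) ^ (2 ^ n) * p (sq (D (Suc n)) \<ominus> D n)"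
      using seminorm_sq_pow_diff[OF p _ _ b1 b2] by simp
    also have "\<dots> \<le> 2 ^ n * (1 + \<rho>) ^ (2 ^ n) * ((p k)\<^sup>2 / 4 ^ Suc n)"
      by (rule mult_left_mono[OF a1]) (simp add: \<rho>_def)
    also have "(1 + \<rho>) ^ (2 ^ n) = (1 + p k / 2 ^ Suc n) ^ (2 ^ Suc n)"
      by (simp add: \<rho>_def power_mult[symmetric])
    also have "2 ^ n * (1 + p k / 2 ^ Suc n) ^ (2 ^ Suc n) * ((p k)\<^sup>2 / 4 ^ Suc n)
        \<le> 2 ^ n * exp (p k) * ((p k)\<^sup>2 / 4 ^ Suc n)"
      by (intro mult_right_mono mult_left_mono one_plus_div_power_le_exp nonneg k) auto
    finally have "p (w (Suc n) \<ominus> w n) \<le> 2 ^ n * exp (p k) * ((p k)\<^sup>2 / 4 ^ Suc n)"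
      unfolding ws by (simp add: w_def)
    also have "\<dots> = exp (p k) / 4 * (p k)\<^sup>2 * (1 / 2) ^ n"
    proof -
      have "(4::real) ^ n = 2 ^ n * 2 ^ n" by (simp add: power_mult_distrib[symmetric])
      then show ?thesis by (simp add: field_simps)
    qed
    finally show ?thesis .
  qed
  have summ: "summable (\<lambda>n. c * (1 / 2) ^ n :: real)" for c by (intro summable_mult summable_geometric) simp
  obtain l where l: "l \<in> carrier A" "\<And>p. p \<in> S \<Longrightarrow> (\<lambda>n. p (w n \<ominus> l)) \<longlonglongrightarrow> 0"
    using summable_limit[of w] step summ w by metis
  have starD: "star A (D n) = \<ominus> D n" for n
    using k by (simp add: D_def star_smult smult_uminus_left[symmetric])
  \<comment> \<open>\<open>D n\<close> is skew-adjoint, so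
    \<open>(1 - D n) (1 + D n) = 1 + k^2 / 4^n\<close>. The \<open>2^n\<close>-th power of this
    tends to 1, which makes the limit unitary.\<close>
  have circ: "circ (star A (w n)) (w n) = (sq ^^ n) ((1 / 4 ^ n) \<odot> (k \<otimes> k))"
    "circ (w n) (star A (w n)) = (sq ^^ n) ((1 / 4 ^ n) \<odot> (k \<otimes> k))" for n
  proof -
    have c: "\<ominus> D n \<otimes> D n = (1 / 4 ^ n) \<odot> (k \<otimes> k)" "D n \<otimes> \<ominus> D n = (1 / 4 ^ n) \<odot> (k \<otimes> k)"
      using k by (simp_all add: D_def smult_mult_left smult_mult_right power_mult_distrib[symmetric]
        mult_minus_left mult_minus_right smult_uminus_left[symmetric])
    then show "circ (star A (w n)) (w n) = (sq ^^ n) ((1 / 4 ^ n) \<odot> (k \<otimes> k))"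
      "circ (w n) (star A (w n)) = (sq ^^ n) ((1 / 4 ^ n) \<odot> (k \<otimes> k))"
      unfolding w_def using sq_pow_circ[of "\<ominus> D n" "D n" n] sq_pow_circ[of "D n" "\<ominus> D n" n] k
      by (simp_all add: star_sq_pow starD M.l_neg M.r_neg)
  qed
  have lim: "(\<lambda>n. p ((sq ^^ n) ((1 / 4 ^ n) \<odot> (k \<otimes> k)))) \<longlonglongrightarrow> 0" if p: "p \<in> S" for p
  proof (rule tendsto_sandwich[of "\<lambda>_. 0" _ _ "\<lambda>n. exp ((p k)\<^sup>2 * (1 / 2) ^ n) - 1"])
    interpret cstar_seminorm_on A p using that by (rule cstar_on)
    show "\<forall>\<^sub>F n in sequentially. 0 \<le> p ((sq ^^ n) ((1 / 4 ^ n) \<odot> (k \<otimes> k)))" using k by simp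
    have "p ((sq ^^ n) ((1 / 4 ^ n) \<odot> (k \<otimes> k))) \<le> exp ((p k)\<^sup>2 * (1 / 2) ^ n) - 1" for n
    proof -
      have "p ((1 / 4 ^ n) \<odot> (k \<otimes> k)) \<le> (p k)\<^sup>2 * (1 / 2) ^ n / 2 ^ n"
        using k submultiplicative[of k k]
        by (simp add: homogeneous norm_divide norm_power power2_eq_square power_divide
            power_mult_distrib[symmetric] divide_right_mono)
      then have "(1 + p ((1 / 4 ^ n) \<odot> (k \<otimes> k))) ^ (2 ^ n) \<le> (1 + (p k)\<^sup>2 * (1 / 2) ^ n / 2 ^ n) ^ (2 ^ n)"
        using k by (intro power_mono) auto
      also have "\<dots> \<le> exp ((p k)\<^sup>2 * (1 / 2) ^ n)"
        by (intro one_plus_div_power_le_exp) simp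
      finally show ?thesis
        using seminorm_sq_pow[OF p, of "(1 / 4 ^ n) \<odot> (k \<otimes> k)" n] k by simp
    qed
    then show "\<forall>\<^sub>F n in sequentially. p ((sq ^^ n) ((1 / 4 ^ n) \<odot> (k \<otimes> k))) \<le> exp ((p k)\<^sup>2 * (1 / 2) ^ n) - 1"
      by simp
    have "(\<lambda>n. (p k)\<^sup>2 * (1 / 2) ^ n) \<longlonglongrightarrow> (p k)\<^sup>2 * 0"
      by (intro tendsto_mult_left LIMSEQ_power_zero) simp
    then have "(\<lambda>n. exp ((p k)\<^sup>2 * (1 / 2) ^ n) - 1) \<longlonglongrightarrow> exp ((p k)\<^sup>2 * 0) - 1"
      by (intro tendsto_diff tendsto_exp tendsto_const)
    then show "(\<lambda>n. exp ((p k)\<^sup>2 * (1 / 2) ^ n) - 1) \<longlonglongrightarrow> 0" by simp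
  qed simp
  have l': "(\<lambda>n. p (star A (w n) \<ominus> star A l)) \<longlonglongrightarrow> 0" if "p \<in> S" for p
  proof -
    interpret cstar_seminorm_on A p using that by (rule cstar_on)
    show ?thesis using l(2)[OF that] l(1) by (simp add: star_diff[symmetric])
  qed
  show ?thesis
  proof
    show "l \<in> carrier A" by fact
    show "circ (star A l) l = \<zero>"
      using l l' lim by (intro circ_limit_zero[of "\<lambda>n. star A (w n)" w]) (auto simp: circ)
    show "circ l (star A l) = \<zero>"
      using l l' lim by (intro circ_limit_zero[of w "\<lambda>n. star A (w n)"]) (auto simp: circ)
    fix p assume p: "p \<in> S"
    interpret cstar_seminorm_on A p using p by (rule cstar_on)
    define C where "C = exp (p k) / 4 * (p k)\<^sup>2"
    have C0: "0 \<le> C" by (simp add: C_def)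
    have w0: "w 0 = \<i> \<odot> k" by (simp add: w_def D_def)
    \<comment> \<open>\<open>w 0\<close> is \<open>i k\<close>, and the increments are at most
      \<open>C / 2^i\<close>. Their total \<open>2 * C\<close> is the asserted bound.\<close>
    have "p (w n \<ominus> w 0) \<le> 2 * C" for n
    proof -
      have "p (w n \<ominus> w 0) \<le> (\<Sum>i<n. C * (1 / 2) ^ i)"
        using step[OF p] by (intro telescope_le[OF p]) (auto simp: C_def)
      also have "\<dots> \<le> (\<Sum>i. C * (1 / 2) ^ i)"
        using summ C0 by (intro sum_le_suminf) auto
      also have "\<dots> = 2 * C"
        by (simp add: suminf_mult summable_geometric suminf_geometric)
      finally show ?thesis .
    qed
    note bound = this
    have "p (l \<ominus> w 0) \<le> p (w n \<ominus> l) + 2 * C" for n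
      using triangle_via[OF l(1) w[of n] w[of 0]] diff_commute[OF l(1) w[of n]] bound[of n] by linarith
    then have "p (l \<ominus> w 0) \<le> 0 + 2 * C"
      by (intro LIMSEQ_le_const[OF tendsto_add[OF l(2)[OF p] tendsto_const]] exI allI impI)
    then show "p (l \<ominus> \<i> \<odot> k) \<le> exp (p k) / 2 * (p k)\<^sup>2" by (simp add: C_def w0)
  qed
qed

end


section \<open>Bounded approximate units\<close>

context cstar_family
begin

text \<open>\<open>unitary_shift w\<close> means that $1 + w$ is unitary; correspondingly \<open>unitary_pow w n\<close> below is
  $(1 + w)^n - 1$ and \<open>unitary_sum w n\<close> is $\sum_{j<n} ((1 + w)^j - 1)$.\<close>

definition unitary_shift :: "'b \<Rightarrow> bool" where
  "unitary_shift w \<longleftrightarrow> w \<in> carrier A \<and> circ (star A w) w = \<zero> \<and> circ w (star A w) = \<zero>"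

lemma unitary_shift_star: "unitary_shift w \<Longrightarrow> unitary_shift (star A w)"
  by (simp add: unitary_shift_def)

text \<open>For \<open>u = 1 + w\<close> the products \<open>star (u y) (u y)\<close> and
  \<open>star y y\<close> coincide, and the C*-identity turns this into an isometry for every
  seminorm.\<close>

lemma unitary_left:
  assumes w: "unitary_shift w" and y: "y \<in> carrier A" and p: "p \<in> S"
  shows "p (y \<oplus> w \<otimes> y) = p y"
proof -
  interpret cstar_seminorm_on A p using p by (rule cstar_on)
  have wA: "w \<in> carrier A" and z: "circ (star A w) w = \<zero>" using w by (auto simp: unitary_shift_def)
  have "star A (y \<oplus> w \<otimes> y) \<otimes> (y \<oplus> w \<otimes> y) = star A y \<otimes> y \<oplus> star A y \<otimes> (circ (star A w) w \<otimes> y)"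
    using wA y by algebra
  also have "\<dots> = star A y \<otimes> y" using z y by simp
  finally have eq: "star A (y \<oplus> w \<otimes> y) \<otimes> (y \<oplus> w \<otimes> y) = star A y \<otimes> y" .
  have yw: "y \<oplus> w \<otimes> y \<in> carrier A" using wA y by simp
  have "(p (y \<oplus> w \<otimes> y))\<^sup>2 = (p y)\<^sup>2"
    using cstar_identity[OF yw] cstar_identity[OF y] unfolding eq by metis
  then show ?thesis by (rule power2_eq_imp_eq[OF _ nonneg[OF yw] nonneg[OF y]])
qed

lemma unitary_right:
  assumes w: "unitary_shift w" and y: "y \<in> carrier A" and p: "p \<in> S"
  shows "p (y \<oplus> y \<otimes> w) = p y"
proof -
  interpret cstar_seminorm_on A p using p by (rule cstar_on)
  have wA: "w \<in> carrier A" using w by (auto simp: unitary_shift_def)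
  have "star A (y \<oplus> y \<otimes> w) = star A y \<oplus> star A w \<otimes> star A y"
    using wA y by algebra
  then show ?thesis
    using unitary_left[OF unitary_shift_star[OF w] star_closed[OF y] p] at_star[of "y \<oplus> y \<otimes> w"] wA y
    by simp
qed

text \<open>The seminorm is defined on \<open>A\<close> only, so the bound cannot be read off from
  \<open>u - 1\<close> by the triangle inequality. Instead
  \<open>w star(w) = u star(w) - star(w)\<close> and the isometry give
  \<open>p(w)^2 <= 2 p(w)\<close>.\<close>

lemma unitary_seminorm_le:
  assumes w: "unitary_shift w" and p: "p \<in> S"
  shows "p w \<le> 2"
proof -
  interpret cstar_seminorm_on A p using p by (rule cstar_on)
  have wA: "w \<in> carrier A" using w by (auto simp: unitary_shift_def)
  have "w \<otimes> star A w = (star A w \<oplus> w \<otimes> star A w) \<ominus> star A w"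
    using wA by algebra
  then have "(p w)\<^sup>2 \<le> p (star A w \<oplus> w \<otimes> star A w) + p (star A w)"
    using triangle_diff[of "star A w \<oplus> w \<otimes> star A w" "star A w"] cstar_identity'[OF wA] wA by simp
  also have "\<dots> = 2 * p w"
    using unitary_left[OF w _ p, of "star A w"] wA by simp
  finally have le: "p w * p w \<le> 2 * p w" by (simp add: power2_eq_square)
  show ?thesis
  proof (rule ccontr)
    assume "\<not> p w \<le> 2"
    then have "2 * p w < p w * p w" by (intro mult_strict_right_mono) auto
    with le show False by simp
  qed
qed

text \<open>\<open>damping e\<close> means that $1 - e$ is a self-adjoint contraction for all seminorms.\<close>

definition damping :: "'b \<Rightarrow> bool" where
  "damping e \<longleftrightarrow> e \<in> carrier A \<and> star A e = e \<and> (\<forall>p\<in>S. \<forall>y\<in>carrier A. p (y \<ominus> e \<otimes> y) \<le> p y)"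

lemma damping_closed [simp, intro]: "damping e \<Longrightarrow> e \<in> carrier A"
  and damping_star [simp]: "damping e \<Longrightarrow> star A e = e"
  and damping_left: "\<lbrakk>damping e; p \<in> S; y \<in> carrier A\<rbrakk> \<Longrightarrow> p (y \<ominus> e \<otimes> y) \<le> p y"
  by (simp_all add: damping_def)

lemma damping_right:
  assumes e: "damping e" and p: "p \<in> S" and y: "y \<in> carrier A"
  shows "p (y \<ominus> y \<otimes> e) \<le> p y"
proof -
  interpret cstar_seminorm_on A p using p by (rule cstar_on)
  have "star A (star A y \<ominus> e \<otimes> star A y) = y \<ominus> y \<otimes> e"
    using e y by (simp add: star_diff star_mult)
  then have "p (y \<ominus> y \<otimes> e) = p (star A y \<ominus> e \<otimes> star A y)"
    using at_star[of "star A y \<ominus> e \<otimes> star A y"] e y by simp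
  also have "\<dots> \<le> p y" using damping_left[OF e p, of "star A y"] y by simp
  finally show ?thesis .
qed

lemma damping_mult_le:
  assumes e: "damping e" and p: "p \<in> S" and y: "y \<in> carrier A"
  shows "p (y \<otimes> e) \<le> 2 * p y"
proof -
  interpret cstar_seminorm_on A p using p by (rule cstar_on)
  have "y \<otimes> e = y \<ominus> (y \<ominus> y \<otimes> e)" using y damping_closed[OF e] by algebra
  then show ?thesis
    using triangle_diff[of y "y \<ominus> y \<otimes> e"] damping_right[OF e p y] e y by simp
qed

text \<open>The same device as for unitaries: the C*-identity gives
  \<open>p(e)^2 = p(e e) <= 2 p(e)\<close>.\<close>

lemma damping_seminorm_le:
  assumes e: "damping e" and p: "p \<in> S"
  shows "p e \<le> 2"
proof -
  interpret cstar_seminorm_on A p using p by (rule cstar_on)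
  have "p e * p e \<le> 2 * p e"
    using damping_mult_le[OF e p, of e] cstar_identity[of e] e by (simp add: power2_eq_square)
  show ?thesis
  proof (rule ccontr)
    assume "\<not> p e \<le> 2"
    then have "2 * p e < p e * p e" by (intro mult_strict_right_mono) auto
    with \<open>p e * p e \<le> 2 * p e\<close> show False by simp
  qed
qed

section \<open>Means of powers of a unitary\<close>

primrec unitary_pow :: "'b \<Rightarrow> nat \<Rightarrow> 'b" where
  "unitary_pow w 0 = \<zero>"
| "unitary_pow w (Suc n) = circ w (unitary_pow w n)"

primrec unitary_sum :: "'b \<Rightarrow> nat \<Rightarrow> 'b" where
  "unitary_sum w 0 = \<zero>"
| "unitary_sum w (Suc n) = unitary_sum w n \<oplus> unitary_pow w n"

lemma unitary_pow_closed [simp]: "w \<in> carrier A \<Longrightarrow> unitary_pow w n \<in> carrier A"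
  by (induction n) auto

lemma unitary_sum_closed [simp]: "w \<in> carrier A \<Longrightarrow> unitary_sum w n \<in> carrier A"
  by (induction n) auto

lemma unitary_pow_commute: "w \<in> carrier A \<Longrightarrow> unitary_pow w n \<otimes> w = w \<otimes> unitary_pow w n"
  by (induction n) (simp_all add: l_distr r_distr m_assoc)

lemma unitary_sum_commute: "w \<in> carrier A \<Longrightarrow> unitary_sum w n \<otimes> w = w \<otimes> unitary_sum w n"
  by (induction n) (simp_all add: l_distr r_distr unitary_pow_commute)

text \<open>The geometric sum \<open>(u - 1) (1 + u + ... + u^(n-1)) = u^n - 1\<close>, where the
  sum of the powers is \<open>n + unitary_sum w n\<close>.\<close>

lemma unitary_sum_telescope:
  assumes w: "w \<in> carrier A"
  shows "of_nat n \<odot> w \<oplus> w \<otimes> unitary_sum w n = unitary_pow w n"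
proof (induction n)
  case (Suc n)
  have "of_nat (Suc n) \<odot> w \<oplus> w \<otimes> unitary_sum w (Suc n)
      = (of_nat n \<odot> w \<oplus> w \<otimes> unitary_sum w n) \<oplus> (w \<oplus> w \<otimes> unitary_pow w n)"
    using w by (simp add: smult_add_left r_distr M.a_ac)
  then show ?case using Suc w by (simp add: M.a_ac)
qed (use w in simp)

lemma unitary_shift_pow:
  assumes w: "unitary_shift w"
  shows "unitary_shift (unitary_pow w n)"
proof (induction n)
  case (Suc n)
  define v where "v = unitary_pow w n"
  have wA: "w \<in> carrier A" and w0: "circ (star A w) w = \<zero>" "circ w (star A w) = \<zero>"
    using w by (auto simp: unitary_shift_def)
  have v: "v \<in> carrier A" and v0: "circ (star A v) v = \<zero>" "circ v (star A v) = \<zero>"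
    using Suc by (auto simp: unitary_shift_def v_def)
  have st: "star A (circ w v) = circ (star A v) (star A w)"
    using wA v by algebra
  have cl: "star A v \<in> carrier A" "star A w \<in> carrier A" "circ w v \<in> carrier A"
    "circ (star A v) (star A w) \<in> carrier A" using wA v by auto
  have c: "circ \<zero> x = x" if "x \<in> carrier A" for x using that by simp
  have "circ (circ (star A v) (star A w)) (circ w v) = circ (star A v) (circ (circ (star A w) w) v)"
    by (simp only: circ_assoc[OF cl(1,2,3)] circ_assoc[OF cl(2) wA v])
  also have "\<dots> = \<zero>" unfolding w0 using c[OF v] v0 by simp
  finally have 1: "circ (circ (star A v) (star A w)) (circ w v) = \<zero>" .
  have "circ (circ w v) (circ (star A v) (star A w)) = circ w (circ (circ v (star A v)) (star A w))"
    by (simp only: circ_assoc[OF wA v cl(4)] circ_assoc[OF v cl(1,2)])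
  also have "\<dots> = \<zero>" unfolding v0 using c[of "star A w"] wA w0 by simp
  finally have 2: "circ (circ w v) (circ (star A v) (star A w)) = \<zero>" .
  show ?case unfolding unitary_pow.simps v_def[symmetric] unitary_shift_def st
    using 1 2 wA v by simp
qed (simp add: unitary_shift_def)

text \<open>The element acting on \<open>y\<close> is \<open>1 + u + ... + u^(n-1)\<close>, a sum of
  \<open>n\<close> isometries.\<close>

lemma unitary_sum_left:
  assumes w: "unitary_shift w" and y: "y \<in> carrier A" and p: "p \<in> S"
  shows "p (of_nat n \<odot> y \<oplus> unitary_sum w n \<otimes> y) \<le> n * p y"
proof (induction n)
  case 0
  interpret cstar_seminorm_on A p using p by (rule cstar_on)
  show ?case using y by simp
next
  case (Suc n)
  interpret cstar_seminorm_on A p using p by (rule cstar_on)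
  have wA: "w \<in> carrier A" using w by (auto simp: unitary_shift_def)
  have "of_nat (Suc n) \<odot> y \<oplus> unitary_sum w (Suc n) \<otimes> y
      = (of_nat n \<odot> y \<oplus> unitary_sum w n \<otimes> y) \<oplus> (y \<oplus> unitary_pow w n \<otimes> y)"
    using wA y by (simp add: smult_add_left l_distr M.a_ac)
  then show ?case
    using triangle[of "of_nat n \<odot> y \<oplus> unitary_sum w n \<otimes> y" "y \<oplus> unitary_pow w n \<otimes> y"]
      Suc unitary_left[OF unitary_shift_pow[OF w] y p, of n] wA y by (simp add: algebra_simps)
qed

lemma unitary_sum_right:
  assumes w: "unitary_shift w" and y: "y \<in> carrier A" and p: "p \<in> S"
  shows "p (of_nat n \<odot> y \<oplus> y \<otimes> unitary_sum w n) \<le> n * p y"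
proof (induction n)
  case 0
  interpret cstar_seminorm_on A p using p by (rule cstar_on)
  show ?case using y by simp
next
  case (Suc n)
  interpret cstar_seminorm_on A p using p by (rule cstar_on)
  have wA: "w \<in> carrier A" using w by (auto simp: unitary_shift_def)
  have "of_nat (Suc n) \<odot> y \<oplus> y \<otimes> unitary_sum w (Suc n)
      = (of_nat n \<odot> y \<oplus> y \<otimes> unitary_sum w n) \<oplus> (y \<oplus> y \<otimes> unitary_pow w n)"
    using wA y by (simp add: smult_add_left r_distr M.a_ac)
  then show ?case
    using triangle[of "of_nat n \<odot> y \<oplus> y \<otimes> unitary_sum w n" "y \<oplus> y \<otimes> unitary_pow w n"]
      Suc unitary_right[OF unitary_shift_pow[OF w] y p, of n] wA y by (simp add: algebra_simps)
qed

text \<open>$1 - e$ is the real part of the mean of $1, u, \dots, u^{N-1}$ for $u = \exp(i s k)$. Since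
  $(u - 1) \sum_{j<N} u^j = u^N - 1$ is bounded and $u - 1 \approx i s k$, this mean almost annihilates $k$.\<close>

lemma damping_selfadjoint:
  assumes k: "k \<in> carrier A" "star A k = k" and p: "p \<in> S" and \<epsilon>: "0 < \<epsilon>"
  obtains e where "damping e" "p (k \<ominus> e \<otimes> k) \<le> \<epsilon>"
proof -
  interpret P: cstar_seminorm_on A p using p by (rule cstar_on)
  \<comment> \<open>The first bound keeps \<open>exp (s * p k) <= exp 1 <= 3\<close>. The second
    makes the quadratic error of \<open>exp_unitary\<close>, at most \<open>2 (s p k)^2\<close>, no
    larger than \<open>s * \<epsilon> / 2\<close>, since everything is divided by \<open>s\<close>
    in the end. \<open>N\<close> takes care of the other half.\<close>
  define s where "s = min (1 / (p k + 1)) (\<epsilon> / (2 * (p k + 1)\<^sup>2 * 2))"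
  have pk: "0 \<le> p k" using k by (intro P.nonneg)
  have s: "0 < s" "s * p k \<le> 1" "s * (2 * (p k)\<^sup>2) \<le> \<epsilon> / 2"
  proof -
    show s0: "0 < s" using pk \<epsilon> by (simp add: s_def)
    have "s * p k \<le> 1 / (p k + 1) * (p k + 1)"
      using pk s0 by (intro mult_mono) (auto simp: s_def)
    also have "\<dots> = 1" using pk by simp
    finally show "s * p k \<le> 1" .
    have "s * (2 * (p k)\<^sup>2) \<le> \<epsilon> / (2 * (p k + 1)\<^sup>2 * 2) * (2 * (p k + 1)\<^sup>2)"
      using pk s0 by (intro mult_mono power_mono) (auto simp: s_def)
    also have "\<dots> = \<epsilon> / 2" using pk by (simp add: field_simps add_nonneg_eq_0_iff)
    finally show "s * (2 * (p k)\<^sup>2) \<le> \<epsilon> / 2" .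
  qed
  obtain N :: nat where N: "4 / (s * \<epsilon>) < N" using reals_Archimedean2 by blast
  have N0: "0 < real N" using N s \<epsilon> by (smt (verit) divide_pos_pos mult_pos_pos)
  have N1: "2 / (N * s) \<le> \<epsilon> / 2" using N N0 s \<epsilon> by (simp add: field_simps)
  have sk: "of_real s \<odot> k \<in> carrier A" "star A (of_real s \<odot> k) = of_real s \<odot> k"
    using k by (simp_all add: star_smult)
  obtain w where w: "w \<in> carrier A" "circ (star A w) w = \<zero>" "circ w (star A w) = \<zero>"
    and wS: "\<And>p. p \<in> S \<Longrightarrow> p (w \<ominus> \<i> \<odot> (of_real s \<odot> k)) \<le> exp (p (of_real s \<odot> k)) / 2 * (p (of_real s \<odot> k))\<^sup>2"
    using exp_unitary[OF sk] by metis
  note wk = wS[OF p]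
  have u: "unitary_shift w" using w by (simp add: unitary_shift_def)
  have psk: "p (of_real s \<odot> k) = s * p k" using k s by (simp add: P.homogeneous)
  have "exp (s * p k) \<le> exp 1" using s by simp
  also have "\<dots> \<le> 3" by (rule exp_le)
  finally have "exp (s * p k) / 2 * (s * p k)\<^sup>2 \<le> 2 * (s * p k)\<^sup>2"
    by (intro mult_right_mono) auto
  with wk have wk': "p (w \<ominus> \<i> \<odot> (of_real s \<odot> k)) \<le> s * (s * (2 * (p k)\<^sup>2))"
    unfolding psk by (simp add: power2_eq_square algebra_simps)
  define m where "m = (1 / of_nat N) \<odot> unitary_sum w N"
  have m: "m \<in> carrier A" using w by (simp add: m_def)
  have N0': "(of_nat N :: complex) \<noteq> 0" using N0 by simp
  have mean: "p (y \<oplus> m \<otimes> y) \<le> p y" if "y \<in> carrier A" "p \<in> S" for y p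
  proof -
    interpret cstar_seminorm_on A p using that(2) by (rule cstar_on)
    have "y \<oplus> m \<otimes> y = (1 / of_nat N) \<odot> (of_nat N \<odot> y \<oplus> unitary_sum w N \<otimes> y)"
      using that w N0' by (simp add: m_def smult_add_right smult_mult_left)
    then show ?thesis
      using unitary_sum_left[OF u that, of N] that w N0
      by (simp add: homogeneous norm_divide field_simps)
  qed
  have mean': "p (y \<oplus> y \<otimes> m) \<le> p y" if "y \<in> carrier A" "p \<in> S" for y p
  proof -
    interpret cstar_seminorm_on A p using that(2) by (rule cstar_on)
    have "y \<oplus> y \<otimes> m = (1 / of_nat N) \<odot> (of_nat N \<odot> y \<oplus> y \<otimes> unitary_sum w N)"
      using that w N0' by (simp add: m_def smult_add_right smult_mult_right)
    then show ?thesis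
      using unitary_sum_right[OF u that, of N] that w N0
      by (simp add: homogeneous norm_divide field_simps)
  qed
  have wm: "w \<otimes> m = m \<otimes> w"
    using w by (simp add: m_def smult_mult_left smult_mult_right unitary_sum_commute del: unitary_sum.simps)
  have wmN: "w \<oplus> w \<otimes> m = (1 / of_nat N) \<odot> unitary_pow w N"
  proof -
    have "w \<oplus> w \<otimes> m = (1 / of_nat N) \<odot> (of_nat N \<odot> w \<oplus> w \<otimes> unitary_sum w N)"
      using w N0' by (simp add: m_def smult_add_right smult_mult_right)
    then show ?thesis using unitary_sum_telescope w by simp
  qed
  then have pwm: "p (w \<oplus> w \<otimes> m) \<le> 2 / N"
    using unitary_seminorm_le[OF unitary_shift_pow[OF u] p, of N] N0 w
    by (simp add: P.homogeneous norm_divide divide_right_mono)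
  define d where "d = w \<ominus> \<i> \<odot> (of_real s \<odot> k)"
  have d: "d \<in> carrier A" using w k by (simp add: d_def)
  define c where "c = \<i> * of_real s"
  have c: "c \<noteq> 0" "cmod c = s" using s by (simp_all add: c_def norm_mult)
  have ck: "c \<odot> k = w \<ominus> d"
  proof -
    have "w \<ominus> (w \<ominus> c \<odot> k) = c \<odot> k" using w(1) k(1) by algebra
    then show ?thesis using k by (simp add: d_def c_def)
  qed
  \<comment> \<open>Used for \<open>z = (1 + m) k\<close> and for \<open>z = k (1 + m)\<close>:
    multiplied by \<open>c = i s\<close>, such a \<open>z\<close> becomes \<open>w (1 + m)\<close>,
    of seminorm at most \<open>2 / N\<close>, minus the image of the error \<open>d\<close> under a
    contraction.\<close>
  have bound: "s * p z \<le> 2 / N + p d" if "c \<odot> z = (w \<oplus> w \<otimes> m) \<ominus> dd" "p dd \<le> p d"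
      "z \<in> carrier A" "dd \<in> carrier A" for z dd
  proof -
    have "s * p z = p ((w \<oplus> w \<otimes> m) \<ominus> dd)" using that P.homogeneous[of z c] c by simp
    also have "\<dots> \<le> 2 / N + p d"
      using P.triangle_diff[of "w \<oplus> w \<otimes> m" dd] that w m pwm by simp
    finally show ?thesis .
  qed
  have small: "p z \<le> \<epsilon>" if "s * p z \<le> 2 / N + p d" for z
  proof -
    have "s * p z \<le> s * \<epsilon>"
    proof -
      have "2 / N = s * (2 / (N * s))" using s by simp
      also have "\<dots> \<le> s * (\<epsilon> / 2)" using N1 s by (intro mult_left_mono) auto
      finally have "2 / N \<le> s * (\<epsilon> / 2)" .
      moreover have "p d \<le> s * (\<epsilon> / 2)"
        unfolding d_def by (rule order_trans[OF wk' mult_left_mono[OF s(3)]]) (use s in simp)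
      ultimately have "2 / N + p d \<le> s * (\<epsilon> / 2) + s * (\<epsilon> / 2)" by (rule add_mono)
      also have "\<dots> = s * \<epsilon>" by (simp add: field_simps)
      finally show ?thesis using that by simp
    qed
    then show ?thesis using s by simp
  qed
  have mk: "p (k \<oplus> m \<otimes> k) \<le> \<epsilon>"
  proof (rule small, rule bound)
    have "c \<odot> (k \<oplus> m \<otimes> k) = c \<odot> k \<oplus> m \<otimes> (c \<odot> k)"
      using k m by (simp add: smult_add_right smult_mult_right)
    also have "\<dots> = (w \<oplus> m \<otimes> w) \<ominus> (d \<oplus> m \<otimes> d)" unfolding ck using w(1) d m by algebra
    finally show "c \<odot> (k \<oplus> m \<otimes> k) = (w \<oplus> w \<otimes> m) \<ominus> (d \<oplus> m \<otimes> d)" unfolding wm .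
  qed (use mean[OF d p] k m d in auto)
  have km: "p (k \<oplus> k \<otimes> m) \<le> \<epsilon>"
  proof (rule small, rule bound)
    have "c \<odot> (k \<oplus> k \<otimes> m) = c \<odot> k \<oplus> (c \<odot> k) \<otimes> m"
      using k m by (simp add: smult_add_right smult_mult_left)
    also have "\<dots> = (w \<oplus> w \<otimes> m) \<ominus> (d \<oplus> d \<otimes> m)" unfolding ck using w(1) d m by algebra
    finally show "c \<odot> (k \<oplus> k \<otimes> m) = (w \<oplus> w \<otimes> m) \<ominus> (d \<oplus> d \<otimes> m)" .
  qed (use mean'[OF d p] k m d in auto)
  define e where "e = \<ominus> ((1 / 2) \<odot> (m \<oplus> star A m))"
  have e: "e \<in> carrier A" "star A e = e"
    using m by (simp_all add: e_def star_minus star_smult star_add M.a_comm)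
  \<comment> \<open>The half coming from \<open>star A m\<close> is the adjoint of
    \<open>star(y) (1 + m)\<close>; for this reason the estimates with \<open>m\<close> on the right
    are needed as well.\<close>
  have eq: "y \<ominus> e \<otimes> y = (1 / 2) \<odot> ((y \<oplus> m \<otimes> y) \<oplus> star A (star A y \<oplus> star A y \<otimes> m))"
    if "y \<in> carrier A" for y
  proof -
    have "y \<ominus> e \<otimes> y = y \<oplus> (1 / 2) \<odot> (m \<otimes> y \<oplus> star A m \<otimes> y)"
      unfolding e_def using that m by algebra
    also have "\<dots> = ((1 / 2) \<odot> y \<oplus> (1 / 2) \<odot> y) \<oplus> (1 / 2) \<odot> (m \<otimes> y \<oplus> star A m \<otimes> y)"
      using that by (simp add: add_half)
    also have "\<dots> = (1 / 2) \<odot> ((y \<oplus> m \<otimes> y) \<oplus> star A (star A y \<oplus> star A y \<otimes> m))"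
      using that m by algebra
    finally show ?thesis .
  qed
  have le: "p (y \<ominus> e \<otimes> y) \<le> 1 / 2 * (p (y \<oplus> m \<otimes> y) + p (star A y \<oplus> star A y \<otimes> m))"
    if "y \<in> carrier A" "p \<in> S" for y p
  proof -
    interpret cstar_seminorm_on A p using that(2) by (rule cstar_on)
    show ?thesis unfolding eq[OF that(1)]
      using triangle[of "y \<oplus> m \<otimes> y" "star A (star A y \<oplus> star A y \<otimes> m)"] that m
      by (simp add: homogeneous norm_divide)
  qed
  have "p (y \<ominus> e \<otimes> y) \<le> p y" if "y \<in> carrier A" "p \<in> S" for y p
  proof -
    interpret cstar_seminorm_on A p using that(2) by (rule cstar_on)
    show ?thesis
      using le[OF that] mean[OF that] mean'[OF star_closed[OF that(1)] that(2)] that by simp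
  qed
  then have "damping e" unfolding damping_def by (intro conjI ballI e)
  moreover have "p (k \<ominus> e \<otimes> k) \<le> \<epsilon>"
    using le[OF k(1) p] mk km k(2) by simp
  ultimately show ?thesis by (rule that)
qed

end


section \<open>Lifting with uniform bounds\<close>

context cstar_family
begin

text \<open>Reduction to the self-adjoint \<open>k = a star(a)\<close>: the square of
  \<open>p (a - e a)\<close> equals \<open>p ((1 - e) k (1 - e))\<close>, which is at most
  \<open>p (k - e k)\<close>. Hence precision \<open>\<epsilon>^2\<close> is requested for
  \<open>k\<close>.\<close>

lemma damping_single:
  assumes a: "a \<in> carrier A" and p: "p \<in> S" and \<epsilon>: "0 < \<epsilon>"
  obtains e where "damping e" "p (a \<ominus> e \<otimes> a) \<le> \<epsilon>"
proof -
  interpret cstar_seminorm_on A p using p by (rule cstar_on)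
  define k where "k = a \<otimes> star A a"
  have k: "k \<in> carrier A" "star A k = k" using a by (simp_all add: k_def star_mult)
  obtain e where e: "damping e" "p (k \<ominus> e \<otimes> k) \<le> \<epsilon>\<^sup>2"
    using damping_selfadjoint[OF k p, of "\<epsilon>\<^sup>2"] \<epsilon> by auto
  have eA: "e \<in> carrier A" "star A e = e" using e by auto
  have "(a \<ominus> e \<otimes> a) \<otimes> star A (a \<ominus> e \<otimes> a) = (a \<ominus> e \<otimes> a) \<otimes> (star A a \<ominus> star A a \<otimes> e)"
    using a eA by (simp add: star_diff star_mult)
  also have "\<dots> = (k \<ominus> e \<otimes> k) \<ominus> (k \<ominus> e \<otimes> k) \<otimes> e"
    unfolding k_def using a eA(1) by algebra
  finally have "(p (a \<ominus> e \<otimes> a))\<^sup>2 = p ((k \<ominus> e \<otimes> k) \<ominus> (k \<ominus> e \<otimes> k) \<otimes> e)"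
    using cstar_identity'[of "a \<ominus> e \<otimes> a"] a eA(1) by simp
  also have "\<dots> \<le> \<epsilon>\<^sup>2"
    by (rule order_trans[OF damping_right[OF e(1) p] e(2)]) (intro M.minus_closed m_closed k eA)
  finally have "p (a \<ominus> e \<otimes> a) \<le> \<epsilon>" by (rule power2_le_imp_le) (use \<epsilon> in simp)
  with e(1) show ?thesis by (rule that)
qed

text \<open>A common approximate unit for finitely many elements is first found without any norm control;
  damping it afterwards loses only a constant (Wichmann).\<close>

lemma approx_unit_finite:
  assumes p: "p \<in> S" and "finite F" "F \<subseteq> carrier A" and \<epsilon>: "0 < \<epsilon>"
  shows "\<exists>v\<in>carrier A. \<forall>a\<in>F. p (a \<ominus> v \<otimes> a) \<le> \<epsilon>"
  using assms(2,3)
proof (induction F rule: finite_induct)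
  case empty
  then show ?case by auto
next
  case (insert b F)
  then obtain v where v: "v \<in> carrier A" "\<forall>a\<in>F. p (a \<ominus> v \<otimes> a) \<le> \<epsilon>" by auto
  have b: "b \<in> carrier A" using insert by simp
  obtain e where e: "damping e" "p ((b \<ominus> v \<otimes> b) \<ominus> e \<otimes> (b \<ominus> v \<otimes> b)) \<le> \<epsilon>"
    using damping_single[of "b \<ominus> v \<otimes> b" p \<epsilon>] v b p \<epsilon> by auto
  have eA: "e \<in> carrier A" using e by auto
  \<comment> \<open>\<open>1 - v' = (1 - e) (1 - v)\<close>: the contraction \<open>1 - e\<close>
    spoils none of the estimates already reached, and \<open>e\<close> is chosen for the residue
    \<open>b - v b\<close>.\<close>
  define v' where "v' = (v \<oplus> e) \<ominus> e \<otimes> v"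
  have eq: "a \<ominus> v' \<otimes> a = (a \<ominus> v \<otimes> a) \<ominus> e \<otimes> (a \<ominus> v \<otimes> a)" if "a \<in> carrier A" for a
    unfolding v'_def using that v(1) eA by algebra
  have "p (a \<ominus> v' \<otimes> a) \<le> \<epsilon>" if "a \<in> insert b F" for a
  proof (cases "a = b")
    case True
    then show ?thesis using eq[OF b] e(2) by simp
  next
    case False
    then have "a \<in> F" "a \<in> carrier A" using that insert.prems by auto
    then show ?thesis
      using eq damping_left[OF e(1) p, of "a \<ominus> v \<otimes> a"] v by fastforce
  qed
  moreover have "v' \<in> carrier A" using v(1) eA by (simp add: v'_def)
  ultimately show ?case by blast
qed

lemma damping_finite_left:
  assumes p: "p \<in> S" and F: "finite F" "F \<subseteq> carrier A" and \<epsilon>: "0 < \<epsilon>"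
  obtains e where "damping e" "\<And>a. a \<in> F \<Longrightarrow> p (a \<ominus> e \<otimes> a) \<le> \<epsilon>"
proof -
  interpret cstar_seminorm_on A p using p by (rule cstar_on)
  obtain v where v: "v \<in> carrier A" "\<forall>a\<in>F. p (a \<ominus> v \<otimes> a) \<le> \<epsilon> / 2"
    using approx_unit_finite[OF p F, of "\<epsilon> / 2"] \<epsilon> by auto
  define M where "M = 1 + (\<Sum>a\<in>F. p a)"
  have s0: "0 \<le> (\<Sum>a\<in>F. p a)" using F by (intro sum_nonneg) auto
  then have M: "0 < M" by (simp add: M_def)
  have pM: "p a \<le> M" if "a \<in> F" for a
  proof -
    have "p a \<le> (\<Sum>a\<in>F. p a)" using that F by (intro member_le_sum) auto
    then show ?thesis by (simp add: M_def)
  qed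
  obtain e where e: "damping e" "p (v \<ominus> e \<otimes> v) \<le> \<epsilon> / (2 * M)"
    using damping_single[OF v(1) p, of "\<epsilon> / (2 * M)"] \<epsilon> M by auto
  have eA: "e \<in> carrier A" using e by auto
  have "p (a \<ominus> e \<otimes> a) \<le> \<epsilon>" if a: "a \<in> F" for a
  proof -
    have aA: "a \<in> carrier A" using a F by auto
    define z where "z = a \<ominus> v \<otimes> a"
    define y where "y = v \<ominus> e \<otimes> v"
    have z: "z \<in> carrier A" "p z \<le> \<epsilon> / 2" using v a aA by (auto simp: z_def)
    have y: "y \<in> carrier A" "p y \<le> \<epsilon> / (2 * M)" using v eA e by (auto simp: y_def)
    \<comment> \<open>The first summand is \<open>1 - e\<close> applied to the small
      \<open>a - v a\<close>. The second is \<open>(v - e v) a\<close>, which is small since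
      \<open>e\<close> was chosen for the single element \<open>v\<close> with the common bound
      \<open>M\<close> of the \<open>p a\<close> taken into account.\<close>
    have eq: "a \<ominus> e \<otimes> a = (z \<ominus> e \<otimes> z) \<oplus> y \<otimes> a"
      unfolding z_def y_def using aA v(1) eA by algebra
    have "p (y \<otimes> a) \<le> p y * p a" using y aA by (intro submultiplicative)
    also have "\<dots> \<le> \<epsilon> / (2 * M) * M" using y pM[OF a] aA M \<epsilon> by (intro mult_mono) auto
    also have "\<dots> = \<epsilon> / 2" using M by simp
    finally have "p (y \<otimes> a) \<le> \<epsilon> / 2" .
    moreover have "p (z \<ominus> e \<otimes> z) \<le> \<epsilon> / 2" using damping_left[OF e(1) p z(1)] z(2) by simp
    ultimately show ?thesis
      unfolding eq using triangle[of "z \<ominus> e \<otimes> z" "y \<otimes> a"] z y aA eA by simp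
  qed
  with e(1) show ?thesis by (rule that)
qed

text \<open>\<open>e\<close> is self-adjoint, so the right-hand estimate for \<open>a\<close> is the
  left-hand one for \<open>star A a\<close>.\<close>

lemma damping_finite:
  assumes p: "p \<in> S" and F: "finite F" "F \<subseteq> carrier A" and \<epsilon>: "0 < \<epsilon>"
  obtains e where "damping e" "\<And>a. a \<in> F \<Longrightarrow> p (a \<ominus> e \<otimes> a) \<le> \<epsilon>"
    "\<And>a. a \<in> F \<Longrightarrow> p (a \<ominus> a \<otimes> e) \<le> \<epsilon>"
proof -
  interpret cstar_seminorm_on A p using p by (rule cstar_on)
  obtain e where e: "damping e" "\<And>a. a \<in> F \<union> star A ` F \<Longrightarrow> p (a \<ominus> e \<otimes> a) \<le> \<epsilon>"
    using damping_finite_left[OF p, of "F \<union> star A ` F" \<epsilon>] F \<epsilon> by (auto simp: subset_iff image_iff)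
  have eA: "e \<in> carrier A" "star A e = e" using e by auto
  have "p (a \<ominus> a \<otimes> e) \<le> \<epsilon>" if a: "a \<in> F" for a
  proof -
    have aA: "a \<in> carrier A" using a F by auto
    have "star A (a \<ominus> a \<otimes> e) = star A a \<ominus> e \<otimes> star A a"
      using aA eA by (simp add: star_diff star_mult)
    then have "p (a \<ominus> a \<otimes> e) = p (star A a \<ominus> e \<otimes> star A a)"
      using at_star[of "a \<ominus> a \<otimes> e"] aA eA by simp
    then show ?thesis using e(2)[of "star A a"] a by simp
  qed
  then show ?thesis using e by (intro that[of e]) auto
qed

text \<open>For \<open>u = exp (i k)\<close> the element \<open>x = (u - star u) / (2 i)\<close> is
  \<open>sin k\<close>. It agrees with \<open>k\<close> up to second order for \<open>p\<close>,
  while every seminorm of it is at most 2 because \<open>u\<close> is unitary. Rescaling gives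
  \<open>z\<close>.\<close>

lemma approx_lift_step:
  assumes p: "p \<in> S" and y: "y \<in> carrier A" "star A y = y" "p y \<le> r" and r: "0 < r"
  obtains z where "z \<in> carrier A" "star A z = z" "p (y \<ominus> z) \<le> r / 2" "\<And>q. q \<in> S \<Longrightarrow> q z \<le> 4 * r"
proof -
  interpret cstar_seminorm_on A p using p by (rule cstar_on)
  \<comment> \<open>Scaled so that \<open>p k <= 1/2\<close>. The error
    \<open>exp (1/2) / 2 * (1/2)^2\<close> is then at most 1/4, which becomes \<open>r / 2\<close>
    after multiplication by \<open>2 * r\<close>.\<close>
  define k where "k = of_real (1 / (2 * r)) \<odot> y"
  have k: "k \<in> carrier A" "star A k = k" using y by (simp_all add: k_def star_smult)
  have pk: "p k \<le> 1 / 2" using y r by (simp add: k_def homogeneous norm_divide norm_mult field_simps)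
  have pk0: "0 \<le> p k" using k by (intro nonneg)
  obtain w where w: "w \<in> carrier A" "circ (star A w) w = \<zero>" "circ w (star A w) = \<zero>"
    and wS: "\<And>p. p \<in> S \<Longrightarrow> p (w \<ominus> \<i> \<odot> k) \<le> exp (p k) / 2 * (p k)\<^sup>2"
    using exp_unitary[OF k] by metis
  have u: "unitary_shift w" using w by (simp add: unitary_shift_def)
  have "exp (p k) \<le> exp (1 / 2)" using pk by simp
  also have "\<dots> \<le> 2" by (rule exp_half_le2)
  finally have "exp (p k) / 2 * (p k)\<^sup>2 \<le> 1 * (1 / 2)\<^sup>2"
    using pk pk0 by (intro mult_mono power_mono) auto
  with wS[OF p] have "p (w \<ominus> \<i> \<odot> k) \<le> 1 * (1 / 2)\<^sup>2" by (rule order_trans)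
  then have d: "p (w \<ominus> \<i> \<odot> k) \<le> 1 / 4" by (simp add: power2_eq_square)
  define x where "x = (- \<i> / 2) \<odot> (w \<ominus> star A w)"
  have x: "x \<in> carrier A" using w by (simp add: x_def)
  have xs: "star A x = x"
  proof -
    have "star A x = (\<i> / 2) \<odot> (star A w \<ominus> w)"
      using w(1) by (simp add: x_def star_smult star_diff)
    also have "\<dots> = (\<i> / 2) \<odot> (\<ominus> (w \<ominus> star A w))"
    proof -
      have "star A w \<ominus> w = \<ominus> (w \<ominus> star A w)" using w(1) by algebra
      then show ?thesis by simp
    qed
    also have "\<dots> = x" using w(1) by (simp add: x_def smult_uminus_right smult_uminus_left[symmetric])
    finally show ?thesis .
  qed
  define dd where "dd = w \<ominus> \<i> \<odot> k"
  have dd: "dd \<in> carrier A" "p dd \<le> 1 / 4" using w k d by (simp_all add: dd_def)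
  have kx: "k \<ominus> x = (\<i> / 2) \<odot> (dd \<ominus> star A dd)"
  proof -
    have st: "star A dd = star A w \<ominus> (- \<i>) \<odot> k"
      using w(1) k by (simp add: dd_def star_diff star_smult)
    have 1: "dd \<ominus> star A dd = (w \<ominus> star A w) \<ominus> (\<i> \<odot> k \<oplus> \<i> \<odot> k)"
      unfolding st unfolding dd_def smult_uminus_left[OF k(1)] using w(1) k(1) by algebra
    have 2: "(\<i> / 2) \<odot> (\<i> \<odot> k \<oplus> \<i> \<odot> k) = (- 1) \<odot> k"
      using k by (simp add: smult_add_right smult_add_left[symmetric])
    have "(\<i> / 2) \<odot> (dd \<ominus> star A dd) = (\<i> / 2) \<odot> (w \<ominus> star A w) \<ominus> (- 1) \<odot> k"
      unfolding 1 using w(1) k(1) 2 by (simp add: smult_diff_right[of "w \<ominus> star A w" "\<i> \<odot> k \<oplus> \<i> \<odot> k"])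
    also have "\<dots> = k \<ominus> x"
    proof -
      have "x = \<ominus> ((\<i> / 2) \<odot> (w \<ominus> star A w))"
        using w(1) by (simp add: x_def flip: smult_uminus_left)
      moreover have "a \<ominus> (\<ominus> k) = k \<ominus> (\<ominus> a)" if "a \<in> carrier A" for a
        using that k(1) by algebra
      ultimately show ?thesis using w(1) k(1) by (simp add: smult_minus_1)
    qed
    finally show ?thesis by simp
  qed
  have pkx: "p (k \<ominus> x) \<le> 1 / 4"
    unfolding kx using triangle_diff[of dd "star A dd"] dd by (simp add: homogeneous norm_divide)
  have qx: "q x \<le> 2" if q: "q \<in> S" for q
  proof -
    interpret Q: cstar_seminorm_on A q using q by (rule cstar_on)
    show ?thesis
      using Q.triangle_diff[of w "star A w"] unitary_seminorm_le[OF u q] w(1)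
      by (simp add: x_def Q.homogeneous norm_divide)
  qed
  define z where "z = of_real (2 * r) \<odot> x"
  have "y \<ominus> z = of_real (2 * r) \<odot> (k \<ominus> x)"
    using y r x k by (simp add: z_def smult_diff_right k_def)
  then have "p (y \<ominus> z) = 2 * r * p (k \<ominus> x)"
    using k x r by (simp add: homogeneous norm_mult)
  also have "\<dots> \<le> 2 * r * (1 / 4)" using pkx r by (intro mult_left_mono) auto
  finally have 1: "p (y \<ominus> z) \<le> r / 2" by simp
  have 2: "q z \<le> 4 * r" if q: "q \<in> S" for q
  proof -
    interpret Q: cstar_seminorm_on A q using q by (rule cstar_on)
    show ?thesis using qx[OF q] x r by (simp add: z_def Q.homogeneous norm_mult)
  qed
  have "z \<in> carrier A" "star A z = z" using x xs by (simp_all add: z_def star_smult)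
  then show ?thesis using 1 by (rule that) (rule 2)
qed

text \<open>The step is iterated on the remainder \<open>y - z\<close>. The errors halve, and the
  bounds \<open>4 * r / 2^i\<close> of the corrections add up to less than \<open>8 * r\<close> for
  every seminorm.\<close>

lemma approx_lift_selfadjoint:
  assumes p: "p \<in> S" and y: "y \<in> carrier A" "star A y = y" "p y \<le> r" and r: "0 < r"
  shows "\<exists>z\<in>carrier A. star A z = z \<and> p (y \<ominus> z) \<le> r / 2 ^ n \<and> (\<forall>q\<in>S. q z \<le> 8 * r * (1 - 1 / 2 ^ n))"
proof (induction n)
  case 0
  have y0: "y \<ominus> \<zero> = y" using y(1) by algebra
  have "\<forall>q\<in>S. q \<zero> \<le> 8 * r * (1 - 1 / 2 ^ 0)"
  proof
    fix q assume "q \<in> S"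
    then interpret cstar_seminorm_on A q by (rule cstar_on)
    show "q \<zero> \<le> 8 * r * (1 - 1 / 2 ^ 0)" by simp
  qed
  then show ?case using y y0 by (intro bexI[of _ \<zero>] conjI) simp_all
next
  case (Suc n)
  then obtain z where z: "z \<in> carrier A" "star A z = z" "p (y \<ominus> z) \<le> r / 2 ^ n"
    "\<forall>q\<in>S. q z \<le> 8 * r * (1 - 1 / 2 ^ n)" by blast
  have yz: "y \<ominus> z \<in> carrier A" "star A (y \<ominus> z) = y \<ominus> z" "0 < r / 2 ^ n"
    using y z r by (simp_all add: star_diff)
  obtain x where x: "x \<in> carrier A" "star A x = x" "p ((y \<ominus> z) \<ominus> x) \<le> r / 2 ^ n / 2"
    "\<And>q. q \<in> S \<Longrightarrow> q x \<le> 4 * (r / 2 ^ n)"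
    using approx_lift_step[OF p _ _ z(3)] yz by metis
  have "y \<ominus> (z \<oplus> x) = (y \<ominus> z) \<ominus> x" using y(1) z(1) x(1) by algebra
  moreover have "q (z \<oplus> x) \<le> 8 * r * (1 - 1 / 2 ^ Suc n)" if q: "q \<in> S" for q
  proof -
    interpret cstar_seminorm_on A q using that by (rule cstar_on)
    have "q (z \<oplus> x) \<le> 8 * r * (1 - 1 / 2 ^ n) + 4 * (r / 2 ^ n)"
      using triangle[OF z(1) x(1)] bspec[OF z(4) q] x(4)[OF q] by linarith
    also have "\<dots> = 8 * r * (1 - 1 / 2 ^ Suc n)" by (simp add: field_simps)
    finally show ?thesis .
  qed
  moreover have "z \<oplus> x \<in> carrier A" "star A (z \<oplus> x) = z \<oplus> x" using x(1,2) z(1,2) by (simp_all add: star_add)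
  moreover have "p ((y \<ominus> z) \<ominus> x) \<le> r / 2 ^ Suc n" using x(3) by (simp add: field_simps)
  ultimately show ?case by (intro bexI[of _ "z \<oplus> x"] conjI ballI) simp_all
qed

text \<open>Real and imaginary part are lifted separately, whence twice the constant 8.\<close>

lemma approx_lift:
  assumes p: "p \<in> S" and y: "y \<in> carrier A" "p y \<le> r" and r: "0 < r" and \<delta>: "0 < \<delta>"
  obtains z where "z \<in> carrier A" "p (y \<ominus> z) \<le> \<delta>" "\<And>q. q \<in> S \<Longrightarrow> q z \<le> 16 * r"
proof -
  interpret cstar_seminorm_on A p using p by (rule cstar_on)
  define a where "a = (1 / 2) \<odot> (y \<oplus> star A y)"
  define b where "b = (- \<i> / 2) \<odot> (y \<ominus> star A y)"
  have aA: "a \<in> carrier A" and bA: "b \<in> carrier A" using y by (simp_all add: a_def b_def)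
  have as: "star A a = a" using y by (simp add: a_def star_smult star_add M.a_comm)
  have bs: "star A b = b"
  proof -
    have "star A b = (\<i> / 2) \<odot> (star A y \<ominus> y)"
      using y(1) by (simp add: b_def star_smult star_diff)
    also have "star A y \<ominus> y = \<ominus> (y \<ominus> star A y)" using y(1) by algebra
    finally show ?thesis using y(1) by (simp add: b_def smult_uminus_right smult_uminus_left[symmetric])
  qed
  have ab: "y = a \<oplus> \<i> \<odot> b"
  proof -
    have "a \<oplus> \<i> \<odot> b = (1 / 2) \<odot> (y \<oplus> star A y) \<oplus> (1 / 2) \<odot> (y \<ominus> star A y)"
      using y by (simp add: a_def b_def)
    also have "\<dots> = (1 / 2) \<odot> y \<oplus> (1 / 2) \<odot> y" using y(1) by algebra
    finally show ?thesis using y(1) by (simp add: add_half)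
  qed
  have pa: "p a \<le> r" using y triangle[of y "star A y"] by (simp add: a_def homogeneous norm_divide)
  have pb: "p b \<le> r" using y triangle_diff[of y "star A y"] by (simp add: b_def homogeneous norm_divide)
  obtain n where n: "r / 2 ^ n \<le> \<delta> / 2"
  proof -
    obtain n where "(1 / 2 :: real) ^ n < \<delta> / (2 * r)"
      using real_arch_pow_inv[of "\<delta> / (2 * r)" "1 / 2"] \<delta> r by auto
    then have "r / 2 ^ n \<le> \<delta> / 2" using r by (simp add: power_divide field_simps)
    then show ?thesis by (rule that)
  qed
  obtain a' where a': "a' \<in> carrier A" "p (a \<ominus> a') \<le> r / 2 ^ n" "\<forall>q\<in>S. q a' \<le> 8 * r * (1 - 1 / 2 ^ n)"
    using approx_lift_selfadjoint[OF p aA as pa r, of n] by blast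
  obtain b' where b': "b' \<in> carrier A" "p (b \<ominus> b') \<le> r / 2 ^ n" "\<forall>q\<in>S. q b' \<le> 8 * r * (1 - 1 / 2 ^ n)"
    using approx_lift_selfadjoint[OF p bA bs pb r, of n] by blast
  have eq: "y \<ominus> (a' \<oplus> \<i> \<odot> b') = (a \<ominus> a') \<oplus> \<i> \<odot> (b \<ominus> b')"
    unfolding ab using aA bA a'(1) b'(1) by algebra
  have "p ((a \<ominus> a') \<oplus> \<i> \<odot> (b \<ominus> b')) \<le> p (a \<ominus> a') + p (b \<ominus> b')"
    using triangle[of "a \<ominus> a'" "\<i> \<odot> (b \<ominus> b')"] aA bA a'(1) b'(1) by (simp add: homogeneous)
  then have 1: "p (y \<ominus> (a' \<oplus> \<i> \<odot> b')) \<le> \<delta>"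
    unfolding eq using a'(2) b'(2) n by linarith
  have 2: "q (a' \<oplus> \<i> \<odot> b') \<le> 16 * r" if q: "q \<in> S" for q
  proof -
    interpret Q: cstar_seminorm_on A q using q by (rule cstar_on)
    have "8 * r * (1 - 1 / 2 ^ n) \<le> 8 * r" using r by simp
    then show ?thesis
      using Q.triangle[of a' "\<i> \<odot> b'"] bspec[OF a'(3) q] bspec[OF b'(3) q] a'(1) b'(1)
      by (simp add: Q.homogeneous)
  qed
  have "a' \<oplus> \<i> \<odot> b' \<in> carrier A" using a' b' by simp
  then show ?thesis using 1 by (rule that) (rule 2)
qed

end


section \<open>Cohen factorization\<close>

context cstar_family
begin

text \<open>Neumann iteration \<open>s (n+1) = s n + (r - f (s n))\<close>. The residue shrinks by
  the same factor \<open>\<rho>\<close> for all seminorms at once, so the increments are summable in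
  each of them.\<close>

lemma near_identity_surj:
  assumes cl: "\<And>y. y \<in> carrier A \<Longrightarrow> f y \<in> carrier A"
    and add: "\<And>x y. \<lbrakk>x \<in> carrier A; y \<in> carrier A\<rbrakk> \<Longrightarrow> f (x \<oplus> y) = f x \<oplus> f y"
    and near: "\<And>p y. \<lbrakk>p \<in> S; y \<in> carrier A\<rbrakk> \<Longrightarrow> p (y \<ominus> f y) \<le> \<rho> * p y"
    and \<rho>: "0 \<le> \<rho>" "\<rho> < 1" and r: "r \<in> carrier A"
  shows "\<exists>y\<in>carrier A. f y = r"
proof -
  define s where "s = rec_nat \<zero> (\<lambda>_ y. y \<oplus> (r \<ominus> f y))"
  have s0: "s 0 = \<zero>" and sS: "s (Suc n) = s n \<oplus> (r \<ominus> f (s n))" for n by (simp_all add: s_def)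
  have s: "s n \<in> carrier A" for n by (induction n) (use s0 sS cl r in auto)
  have fs: "f (s n) \<in> carrier A" for n using s cl by blast
  define d where "d n = r \<ominus> f (s n)" for n
  have d: "d n \<in> carrier A" for n using fs r by (simp add: d_def)
  have f0: "f \<zero> = \<zero>"
  proof -
    have "f \<zero> \<oplus> f \<zero> = f \<zero>" using add[of \<zero> \<zero>] by simp
    moreover have "f \<zero> = (f \<zero> \<oplus> f \<zero>) \<ominus> f \<zero>" using cl[of \<zero>] by simp algebra
    ultimately show ?thesis using cl[of \<zero>] by (simp add: a_minus_def M.r_neg)
  qed
  have dS: "d (Suc n) = d n \<ominus> f (d n)" for n
  proof -
    have "f (s (Suc n)) = f (s n) \<oplus> f (d n)" unfolding sS d_def[symmetric] by (rule add[OF s d])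
    then have "d (Suc n) = r \<ominus> (f (s n) \<oplus> f (d n))" by (simp add: d_def)
    also have "\<dots> = (r \<ominus> f (s n)) \<ominus> f (d n)" using r fs cl[OF d[of n]] by algebra
    finally show ?thesis by (simp add: d_def)
  qed
  have pd: "p (d n) \<le> \<rho> ^ n * p r" if p: "p \<in> S" for p n
  proof (induction n)
    case 0
    have "d 0 = r" unfolding d_def s0 f0 using r by algebra
    then show ?case by simp
  next
    case (Suc n)
    have "p (d (Suc n)) \<le> \<rho> * p (d n)" unfolding dS by (rule near[OF p d])
    also have "\<dots> \<le> \<rho> * (\<rho> ^ n * p r)" using Suc \<rho> by (intro mult_left_mono)
    finally show ?case by simp
  qed
  have step: "s (Suc n) \<ominus> s n = d n" for n
    unfolding sS d_def using s[of n] fs[of n] r by algebra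
  obtain l where l: "l \<in> carrier A" and lim: "\<forall>p\<in>S. (\<lambda>n. p (s n \<ominus> l)) \<longlonglongrightarrow> 0"
  proof -
    have "\<exists>t. summable t \<and> (\<forall>n. p (s (Suc n) \<ominus> s n) \<le> t n)" if p: "p \<in> S" for p
      unfolding step using pd[OF p] \<rho>
      by (intro exI[of _ "\<lambda>n. \<rho> ^ n * p r"] conjI allI summable_mult2 summable_geometric) auto
    from summable_limit[of s, OF s this] that show ?thesis by blast
  qed
  have fl: "f l \<in> carrier A" using cl l by blast
  have "r \<ominus> f l = \<zero>"
  proof (rule separating)
    fix p assume p: "p \<in> S"
    interpret cstar_seminorm_on A p using p by (rule cstar_on)
    have le: "p (r \<ominus> f l) \<le> \<rho> ^ n * p r + 2 * p (s n \<ominus> l)" for n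
    proof -
      define z where "z = s n \<ominus> l"
      have z: "z \<in> carrier A" using s l by (simp add: z_def)
      have fz: "f z \<in> carrier A" using z cl by blast
      have "s n = z \<oplus> l" unfolding z_def using s[of n] l by algebra
      then have "f (s n) = f z \<oplus> f l" using add z l by simp
      then have "r \<ominus> f l = d n \<oplus> f z"
        unfolding d_def using r fz fl by simp algebra
      \<comment> \<open>Closeness to the identity also makes \<open>f\<close> continuous, so the
        limit may be taken inside.\<close>
      moreover have "p (f z) \<le> 2 * p z"
      proof -
        have "f z = z \<ominus> (z \<ominus> f z)" using z fz by algebra
        then have "p (f z) \<le> p z + p (z \<ominus> f z)"
          using triangle_diff[of z "z \<ominus> f z"] z fz by simp
        also have "p (z \<ominus> f z) \<le> \<rho> * p z" using near[OF p z] .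
        also have "\<dots> \<le> 1 * p z" using \<rho> nonneg[OF z] by (intro mult_right_mono) auto
        finally show ?thesis by simp
      qed
      ultimately show ?thesis
        using triangle[OF d[of n] fz] pd[OF p, of n] by (simp add: z_def)
    qed
    have lim': "(\<lambda>n. \<rho> ^ n * p r + 2 * p (s n \<ominus> l)) \<longlonglongrightarrow> 0 * p r + 2 * 0"
      using \<rho> lim p by (intro tendsto_intros LIMSEQ_power_zero) auto
    have "p (r \<ominus> f l) \<le> 0 * p r + 2 * 0"
      by (rule LIMSEQ_le_const[OF lim']) (intro exI allI impI le)
    then show "p (r \<ominus> f l) = 0" using r fl by (intro antisym nonneg) auto
  qed (use r fl in auto)
  then have "f l = r" using diff_eq_zero_iff[OF r fl] by simp
  with l show ?thesis by blast
qed

primrec dyadic_sum :: "(nat \<Rightarrow> 'b) \<Rightarrow> nat \<Rightarrow> 'b" where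
  "dyadic_sum e 0 = \<zero>"
| "dyadic_sum e (Suc n) = dyadic_sum e n \<oplus> (1 / 2 ^ Suc n) \<odot> e n"

text \<open>Right multiplication by $g_n = 2^{-n} + \sum_{j<n} 2^{-(j+1)} e_j$, which is $1$ minus an operator of
  norm at most $1 - 2^{-n}$ and hence invertible.\<close>

definition dyadic_right :: "(nat \<Rightarrow> 'b) \<Rightarrow> nat \<Rightarrow> 'b \<Rightarrow> 'b" where
  "dyadic_right e n y = (1 / 2 ^ n) \<odot> y \<oplus> y \<otimes> dyadic_sum e n"

lemma dyadic_sum_closed: "(\<And>j. j < n \<Longrightarrow> e j \<in> carrier A) \<Longrightarrow> dyadic_sum e n \<in> carrier A"
  by (induction n) auto

lemma dyadic_right_closed:
  "\<lbrakk>\<And>j. j < n \<Longrightarrow> e j \<in> carrier A; y \<in> carrier A\<rbrakk> \<Longrightarrow> dyadic_right e n y \<in> carrier A"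
  by (simp add: dyadic_right_def dyadic_sum_closed)

text \<open>\<open>2^-n\<close> is two copies of \<open>2^-(n+1)\<close>: one stays as the scalar
  part of \<open>g_{n+1}\<close>, the other minus the new summand is
  \<open>2^-(n+1) (1 - e_n)\<close>.\<close>

lemma dyadic_right_diff:
  assumes "e n \<in> carrier A" "\<And>j. j < n \<Longrightarrow> e j \<in> carrier A" "y \<in> carrier A"
  shows "dyadic_right e n y = dyadic_right e (Suc n) y \<oplus> (1 / 2 ^ Suc n) \<odot> (y \<ominus> y \<otimes> e n)"
proof -
  have ds: "dyadic_sum e n \<in> carrier A" using assms by (simp add: dyadic_sum_closed)
  have "(1 / 2 ^ n) \<odot> y = (1 / 2 ^ Suc n) \<odot> y \<oplus> (1 / 2 ^ Suc n) \<odot> y"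
    using assms(3) by (simp add: smult_add_left[symmetric])
  then show ?thesis
    unfolding dyadic_right_def dyadic_sum.simps using assms(1,3) ds by simp algebra
qed

text \<open>Passing from \<open>n\<close> to \<open>n + 1\<close> adds
  \<open>2^-(n+1) (1 - e_n)\<close> to the defect \<open>1 - g_n\<close>, and \<open>1 - e_n\<close>
  is a contraction.\<close>

lemma dyadic_right_near:
  assumes e: "\<And>j. j < n \<Longrightarrow> damping (e j)" and p: "p \<in> S" and y: "y \<in> carrier A"
  shows "p (y \<ominus> dyadic_right e n y) \<le> (1 - 1 / 2 ^ n) * p y"
  using e
proof (induction n)
  case 0
  interpret cstar_seminorm_on A p using p by (rule cstar_on)
  show ?case using y by (simp add: dyadic_right_def a_minus_def M.r_neg)
next
  case (Suc n)
  interpret cstar_seminorm_on A p using p by (rule cstar_on)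
  have eA: "e n \<in> carrier A" "\<And>j. j < n \<Longrightarrow> e j \<in> carrier A" using Suc.prems by auto
  define z where "z = (1 / 2 ^ Suc n) \<odot> (y \<ominus> y \<otimes> e n)"
  have z: "z \<in> carrier A" using y eA by (simp add: z_def)
  have r: "dyadic_right e (Suc n) y \<in> carrier A" "dyadic_right e n y \<in> carrier A"
    using Suc.prems y by (auto intro!: dyadic_right_closed)
  have "p z = 1 / 2 ^ Suc n * p (y \<ominus> y \<otimes> e n)"
    using y eA by (simp add: z_def homogeneous norm_divide norm_mult norm_power)
  also have "\<dots> \<le> 1 / 2 ^ Suc n * p y"
    using damping_right[OF _ p y, of "e n"] Suc.prems by (intro mult_left_mono) auto
  finally have pz: "p z \<le> 1 / 2 ^ Suc n * p y" .
  have "dyadic_right e n y = dyadic_right e (Suc n) y \<oplus> z"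
    unfolding z_def by (rule dyadic_right_diff[of e n y, OF eA y])
  moreover have "y \<ominus> u = (y \<ominus> (u \<oplus> z)) \<oplus> z" if "u \<in> carrier A" for u
    using y z that by algebra
  ultimately have "y \<ominus> dyadic_right e (Suc n) y = (y \<ominus> dyadic_right e n y) \<oplus> z"
    using r by simp
  then have "p (y \<ominus> dyadic_right e (Suc n) y) \<le> p (y \<ominus> dyadic_right e n y) + p z"
    using triangle[of "y \<ominus> dyadic_right e n y" z] r z y by simp
  also have "\<dots> \<le> (1 - 1 / 2 ^ n) * p y + 1 / 2 ^ Suc n * p y"
    using Suc pz by (intro add_mono) auto
  also have "\<dots> = (1 - 1 / 2 ^ Suc n) * p y" by (simp add: field_simps)
  finally show ?case .
qed

text \<open>The bound \<open>2^n\<close> for the inverse of \<open>g_n\<close> blows up. The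
  quotients below stay bounded only because consecutive ones are compared.\<close>

lemma dyadic_right_lower:
  assumes e: "\<And>j. j < n \<Longrightarrow> damping (e j)" and p: "p \<in> S" and y: "y \<in> carrier A"
  shows "p y \<le> 2 ^ n * p (dyadic_right e n y)"
proof -
  interpret cstar_seminorm_on A p using p by (rule cstar_on)
  have r: "dyadic_right e n y \<in> carrier A"
    using e y by (intro dyadic_right_closed) auto
  have "p y \<le> p (dyadic_right e n y) + (1 - 1 / 2 ^ n) * p y"
    using le_add_diff[OF y r] dyadic_right_near[of n e, OF e p y] by linarith
  then have "1 / 2 ^ n * p y \<le> p (dyadic_right e n y)" by (simp add: algebra_simps)
  then show ?thesis by (simp add: field_simps)
qed

text \<open>\<open>g_n\<close> lies in the unitization, but \<open>e_k\<close> times its inverse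
  lies in \<open>A\<close>. For \<open>k < n\<close> only \<open>e_0, ..., e_{n-1}\<close> enter, so
  these quotients are available when \<open>e_n\<close> is chosen.\<close>

definition dyadic_quotient :: "(nat \<Rightarrow> 'b) \<Rightarrow> nat \<Rightarrow> nat \<Rightarrow> 'b" where
  "dyadic_quotient e n k = (SOME y. y \<in> carrier A \<and> dyadic_right e n y = e k)"

lemma dyadic_quotient:
  assumes e: "\<And>j. j < n \<Longrightarrow> damping (e j)" and k: "k < n"
  shows "dyadic_quotient e n k \<in> carrier A" "dyadic_right e n (dyadic_quotient e n k) = e k"
proof -
  have eA: "e j \<in> carrier A" if "j < n" for j using e that by auto
  have ds: "dyadic_sum e n \<in> carrier A" by (rule dyadic_sum_closed[OF eA])
  have "\<exists>y\<in>carrier A. dyadic_right e n y = e k"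
  proof (rule near_identity_surj[where \<rho> = "1 - 1 / 2 ^ n"])
    fix x y assume "x \<in> carrier A" "y \<in> carrier A"
    then show "dyadic_right e n (x \<oplus> y) = dyadic_right e n x \<oplus> dyadic_right e n y"
      unfolding dyadic_right_def using ds by algebra
  qed (use e eA k in \<open>auto intro: dyadic_right_closed dyadic_right_near\<close>)
  then have "\<exists>y. y \<in> carrier A \<and> dyadic_right e n y = e k" by blast
  from someI_ex[OF this]
  show "dyadic_quotient e n k \<in> carrier A" "dyadic_right e n (dyadic_quotient e n k) = e k"
    unfolding dyadic_quotient_def by blast+
qed

text \<open>At \<open>n = k + 1\<close> the crude bound \<open>2^(k+1) * p (e k)\<close> applies.
  Afterwards the step from \<open>n\<close> to \<open>n + 1\<close> changes the quotient by at most
  \<open>2^-n\<close>, and \<open>2 - 2 / 2^n\<close> majorizes the sum of the changes.\<close>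

lemma dyadic_quotient_bound:
  assumes e: "\<And>j. damping (e j)" and p: "p \<in> S"
    and small: "\<And>n k. k < n \<Longrightarrow> p (dyadic_quotient e n k \<ominus> dyadic_quotient e n k \<otimes> e n) \<le> 1 / 2 ^ n"
    and kn: "Suc k \<le> n"
  shows "p (dyadic_quotient e n k) \<le> 2 ^ (k + 2) + 2 - 2 / 2 ^ n"
  using kn
proof (induction n rule: dec_induct)
  case base
  have k1: "(1::real) \<le> 2 ^ Suc k" by (rule one_le_power) simp
  have "p (dyadic_quotient e (Suc k) k) \<le> 2 ^ Suc k * p (e k)"
    using dyadic_right_lower[of "Suc k" e p "dyadic_quotient e (Suc k) k"] dyadic_quotient[of "Suc k" e k] e p
    by simp
  also have "\<dots> \<le> 2 ^ Suc k * 2" using damping_seminorm_le[OF e p] by (intro mult_left_mono) auto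
  also have "\<dots> \<le> 2 ^ (k + 2) + 2 - 2 / 2 ^ Suc k"
    using k1 by (simp add: field_simps)
  finally show ?case .
next
  case (step n)
  interpret cstar_seminorm_on A p using p by (rule cstar_on)
  define b where "b = dyadic_quotient e n k"
  define b' where "b' = dyadic_quotient e (Suc n) k"
  have b: "b \<in> carrier A" "dyadic_right e n b = e k"
    using dyadic_quotient[of n e k] e step by (auto simp: b_def)
  have b': "b' \<in> carrier A" "dyadic_right e (Suc n) b' = e k"
    using dyadic_quotient[of "Suc n" e k] e step by (auto simp: b'_def)
  have eA: "e j \<in> carrier A" for j using e by auto
  have ds: "dyadic_sum e (Suc n) \<in> carrier A" by (rule dyadic_sum_closed[OF eA])
  have lin: "dyadic_right e (Suc n) (b' \<ominus> b) = dyadic_right e (Suc n) b' \<ominus> dyadic_right e (Suc n) b"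
    unfolding dyadic_right_def using ds b(1) b'(1) by algebra
  define c where "c = (1 / 2 ^ Suc n) \<odot> (b \<ominus> b \<otimes> e n)"
  have c: "c \<in> carrier A" using b eA by (simp add: c_def)
  have "e k = dyadic_right e (Suc n) b \<oplus> c"
    unfolding c_def b(2)[symmetric] by (rule dyadic_right_diff[OF eA eA b(1)])
  moreover have "u = (u \<oplus> c) \<ominus> c" if "u \<in> carrier A" for u using that c by algebra
  moreover have "e k \<ominus> (e k \<ominus> c) = c" using eA[of k] c by algebra
  ultimately have "dyadic_right e (Suc n) (b' \<ominus> b) = c"
    unfolding lin b'(2) using dyadic_right_closed[of "Suc n" e, OF eA b(1)] eA by metis
  \<comment> \<open>The loss \<open>2^(n+1)\<close> of inverting \<open>g_{n+1}\<close> is cancelled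
    exactly by the factor in \<open>c\<close>; what remains is controlled by
    \<open>small\<close>.\<close>
  then have "p (b' \<ominus> b) \<le> 2 ^ Suc n * p c"
    using dyadic_right_lower[of "Suc n" e p "b' \<ominus> b"] e p b b' by simp
  also have "\<dots> = p (b \<ominus> b \<otimes> e n)"
    using b eA by (simp add: c_def homogeneous norm_divide norm_mult norm_power)
  also have "\<dots> \<le> 1 / 2 ^ n" using small[of k n] step by (simp add: b_def)
  finally have "p b' \<le> p b + 1 / 2 ^ n" using le_add_diff[OF b'(1) b(1)] by simp
  then show ?case using step by (simp add: b_def b'_def field_simps)
qed

text \<open>The quotients \<open>dyadic_quotient e n k\<close>, which stand for $e_k g_n^{-1}$, stay bounded as $n \to \infty$
  because $g_n - g_{n+1}$ is $2^{-(n+1)} (1 - e_n)$, which almost annihilates them from the right; and $g_n$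
  tends to $a$.\<close>

lemma dyadic_domination:
  assumes e: "\<And>j. damping (e j)" and p: "p \<in> S"
    and small: "\<And>n k. k < n \<Longrightarrow> p (dyadic_quotient e n k \<ominus> dyadic_quotient e n k \<otimes> e n) \<le> 1 / 2 ^ n"
  obtains a where "a \<in> carrier A" "\<And>k x. x \<in> carrier A \<Longrightarrow> p (e k \<otimes> x) \<le> 2 ^ (k + 3) * p (a \<otimes> x)"
proof -
  interpret cstar_seminorm_on A p using p by (rule cstar_on)
  have eA: "e j \<in> carrier A" for j using e by auto
  have s: "dyadic_sum e n \<in> carrier A" for n by (rule dyadic_sum_closed[OF eA])
  obtain a where a: "a \<in> carrier A" and lim: "\<forall>q\<in>S. (\<lambda>n. q (dyadic_sum e n \<ominus> a)) \<longlonglongrightarrow> 0"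
  proof -
    have "\<exists>t. summable t \<and> (\<forall>n. q (dyadic_sum e (Suc n) \<ominus> dyadic_sum e n) \<le> t n)" if q: "q \<in> S" for q
    proof (intro exI conjI allI)
      show "summable (\<lambda>n. (1 / 2) ^ n :: real)" by (intro summable_geometric) simp
      fix n
      interpret Q: cstar_seminorm_on A q using q by (rule cstar_on)
      have "dyadic_sum e (Suc n) \<ominus> dyadic_sum e n = (1 / 2 ^ Suc n) \<odot> e n"
        unfolding dyadic_sum.simps using s[of n] eA[of n] by algebra
      then show "q (dyadic_sum e (Suc n) \<ominus> dyadic_sum e n) \<le> (1 / 2) ^ n"
        using damping_seminorm_le[OF e q, of n] eA[of n]
        by (simp add: Q.homogeneous norm_divide norm_mult norm_power power_divide field_simps)
    qed
    from summable_limit[of "dyadic_sum e", OF s this] that show ?thesis by blast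
  qed
  have "p (e k \<otimes> x) \<le> 2 ^ (k + 3) * p (a \<otimes> x)" if x: "x \<in> carrier A" for k x
  proof -
    have le: "p (e k \<otimes> x) \<le> 2 ^ (k + 3) * (p (a \<otimes> x) + (1 / 2) ^ n * p x + p (dyadic_sum e n \<ominus> a) * p x)"
      if n: "Suc k \<le> n" for n
    proof -
      define b where "b = dyadic_quotient e n k"
      have b: "b \<in> carrier A" "dyadic_right e n b = e k"
        using dyadic_quotient[of n e k] e n by (auto simp: b_def)
      have "p b \<le> 2 ^ (k + 2) + 2 - 2 / 2 ^ n"
        unfolding b_def by (rule dyadic_quotient_bound[OF e p small n])
      also have "\<dots> \<le> 2 ^ (k + 2) + 2 ^ (k + 2)"
      proof -
        have "(2::real) \<le> 2 ^ (k + 2)" using self_le_power[of "2::real" "k + 2"] by simp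
        moreover have "0 \<le> (2::real) / 2 ^ n" by simp
        ultimately show ?thesis by linarith
      qed
      also have "\<dots> = 2 ^ (k + 3)" by (simp add: power_add)
      finally have pb: "p b \<le> 2 ^ (k + 3)" .
      \<comment> \<open>\<open>c\<close> is \<open>g_n x\<close>, so \<open>e_k x = b c\<close>. As
        \<open>n\<close> grows, \<open>c\<close> tends to \<open>a x\<close> for \<open>p\<close>,
        while \<open>b\<close> stays bounded.\<close>
      define c where "c = (1 / 2 ^ n) \<odot> x \<oplus> dyadic_sum e n \<otimes> x"
      have c: "c \<in> carrier A" using x s by (simp add: c_def)
      have ceq: "c = (a \<otimes> x \<oplus> (1 / 2 ^ n) \<odot> x) \<oplus> (dyadic_sum e n \<ominus> a) \<otimes> x"
        unfolding c_def using x s[of n] a by algebra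
      have pc: "p c \<le> p (a \<otimes> x) + (1 / 2) ^ n * p x + p (dyadic_sum e n \<ominus> a) * p x"
        unfolding ceq
        using triangle[of "a \<otimes> x \<oplus> (1 / 2 ^ n) \<odot> x" "(dyadic_sum e n \<ominus> a) \<otimes> x"]
          triangle[of "a \<otimes> x" "(1 / 2 ^ n) \<odot> x"] submultiplicative[of "dyadic_sum e n \<ominus> a" x] x s[of n] a
        by (simp add: homogeneous norm_divide norm_power power_divide)
      have "e k \<otimes> x = b \<otimes> c"
        unfolding b(2)[symmetric] dyadic_right_def c_def using x s[of n] b(1) by algebra
      then have "p (e k \<otimes> x) \<le> p b * p c" using submultiplicative[OF b(1) c] by simp
      also have "\<dots> \<le> 2 ^ (k + 3) * p c" using pb nonneg[OF c] by (intro mult_right_mono)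
      also have "\<dots> \<le> 2 ^ (k + 3) * (p (a \<otimes> x) + (1 / 2) ^ n * p x + p (dyadic_sum e n \<ominus> a) * p x)"
        using pc by (intro mult_left_mono) auto
      finally show ?thesis .
    qed
    have lim': "(\<lambda>n. 2 ^ (k + 3) * (p (a \<otimes> x) + (1 / 2) ^ n * p x + p (dyadic_sum e n \<ominus> a) * p x))
        \<longlonglongrightarrow> 2 ^ (k + 3) * (p (a \<otimes> x) + 0 * p x + 0 * p x)"
      using lim p by (intro tendsto_intros LIMSEQ_power_zero) auto
    have "p (e k \<otimes> x) \<le> 2 ^ (k + 3) * (p (a \<otimes> x) + 0 * p x + 0 * p x)"
      by (rule LIMSEQ_le_const[OF lim']) (use le in blast)
    then show ?thesis by simp
  qed
  with a show ?thesis by (rule that)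
qed

end


section \<open>Strict neighbourhoods in the algebra\<close>

lemma (in complex_module) absolutely_convex_combine:
  assumes W: "absolutely_convex V W" and uv: "u \<in> W" "v \<in> W" and le: "cmod a + cmod b \<le> r" and r: "0 < r"
  obtains w where "w \<in> W" "a \<odot> u \<oplus> b \<odot> v = of_real r \<odot> w"
proof -
  have cl: "u \<in> carrier V" "v \<in> carrier V" using W uv by (auto simp: absolutely_convex_def)
  let ?w = "(a / of_real r) \<odot> u \<oplus> (b / of_real r) \<odot> v"
  have "cmod (a / of_real r) + cmod (b / of_real r) = (cmod a + cmod b) / r"
    using r by (simp add: norm_divide add_divide_distrib)
  also have "\<dots> \<le> 1" using le r by simp
  finally have "?w \<in> W" using W uv unfolding absolutely_convex_def by blast
  moreover have "a \<odot> u \<oplus> b \<odot> v = of_real r \<odot> ?w"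
    using cl r by (simp add: smult_add_right)
  ultimately show ?thesis by (rule that)
qed

context cstar_family
begin

definition compress :: "'b \<Rightarrow> 'b \<Rightarrow> 'b" where
  "compress e y = (y \<ominus> e \<otimes> y) \<ominus> (y \<ominus> e \<otimes> y) \<otimes> e"

lemma compress_closed [simp]: "\<lbrakk>e \<in> carrier A; y \<in> carrier A\<rbrakk> \<Longrightarrow> compress e y \<in> carrier A"
  by (simp add: compress_def)

lemma compress_add:
  "\<lbrakk>e \<in> carrier A; x \<in> carrier A; y \<in> carrier A\<rbrakk> \<Longrightarrow> compress e (x \<oplus> y) = compress e x \<oplus> compress e y"
  unfolding compress_def by algebra

lemma compress_smult:
  "\<lbrakk>e \<in> carrier A; y \<in> carrier A\<rbrakk> \<Longrightarrow> compress e (c \<odot> y) = c \<odot> compress e y"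
  unfolding compress_def by algebra

lemma compress_le:
  assumes e: "damping e" and p: "p \<in> S" and y: "y \<in> carrier A"
  shows "p (compress e y) \<le> p y"
  unfolding compress_def
  by (rule order_trans[OF damping_right[OF e p] damping_left[OF e p y]]) (use e y in auto)

text \<open>The strict neighbourhood given by \<open>F\<close>, \<open>q\<close> and
  \<open>\<epsilon>\<close>, cut down to elements for which one constant bounds every seminorm, as
  it does for the lifts from \<open>approx_lift\<close>.\<close>

definition strict_small :: "real \<Rightarrow> 'b set \<Rightarrow> ('b \<Rightarrow> real) \<Rightarrow> real \<Rightarrow> 'b \<Rightarrow> bool" where
  "strict_small C F q \<epsilon> y \<longleftrightarrow> y \<in> carrier A \<and> (\<forall>r\<in>S. r y \<le> C) \<and>
    (\<forall>a\<in>F. q (y \<otimes> a) < \<epsilon> \<and> q (a \<otimes> y) < \<epsilon>)"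

lemma strict_smallI:
  assumes "y \<in> carrier A" "\<And>r. r \<in> S \<Longrightarrow> r y \<le> C" "\<And>a. a \<in> F \<Longrightarrow> q (y \<otimes> a) < \<epsilon> \<and> q (a \<otimes> y) < \<epsilon>"
  shows "strict_small C F q \<epsilon> y"
  unfolding strict_small_def by (intro conjI ballI assms assms(3)[THEN conjunct1] assms(3)[THEN conjunct2])

text \<open>What an agreeing neighbourhood leaves behind in a bornological \<open>A\<close>: a ball
  of \<open>p\<close>, and a strict neighbourhood inside each uniformly bounded set. In this form
  the property passes to preimages under compressions.\<close>

definition strict_zero_nbhd :: "('b \<Rightarrow> real) \<Rightarrow> 'b set \<Rightarrow> bool" where
  "strict_zero_nbhd p W \<longleftrightarrow> absolutely_convex A W \<and>
    (\<exists>\<delta>>0. \<forall>y\<in>carrier A. p y \<le> \<delta> \<longrightarrow> y \<in> W) \<and>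
    (\<forall>C. \<exists>F q \<epsilon>. finite F \<and> F \<subseteq> carrier A \<and> q \<in> S \<and> 0 < \<epsilon> \<and> Collect (strict_small C F q \<epsilon>) \<subseteq> W)"

lemma strict_zero_nbhd_bounded:
  assumes "strict_zero_nbhd p W"
  obtains F q \<epsilon> where "finite F" "F \<subseteq> carrier A" "q \<in> S" "0 < \<epsilon>" "Collect (strict_small C F q \<epsilon>) \<subseteq> W"
proof -
  have "\<exists>F q \<epsilon>. finite F \<and> F \<subseteq> carrier A \<and> q \<in> S \<and> 0 < \<epsilon> \<and> Collect (strict_small C F q \<epsilon>) \<subseteq> W"
    using assms unfolding strict_zero_nbhd_def by (elim conjE) (erule spec)
  then show ?thesis by (elim exE conjE) (rule that)
qed

text \<open>\<open>1 - e\<close> contracts every seminorm, so balls and bounds survive. Since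
  \<open>(T_e y) a = (1 - e) y (a - e a)\<close>, and likewise on the other side, the strict
  conditions hold once \<open>F\<close> is replaced by its images under
  \<open>1 - e\<close>.\<close>

lemma strict_zero_nbhd_compress:
  assumes W: "strict_zero_nbhd p W" and e: "damping e" and p: "p \<in> S"
  shows "strict_zero_nbhd p {y \<in> carrier A. compress e y \<in> W}"
  unfolding strict_zero_nbhd_def
proof (intro conjI allI)
  have eA: "e \<in> carrier A" using e by auto
  have Wac: "absolutely_convex A W" using W by (simp add: strict_zero_nbhd_def)
  show "absolutely_convex A {y \<in> carrier A. compress e y \<in> W}"
    unfolding absolutely_convex_def
  proof (intro conjI ballI allI impI)
    fix x y a b assume xy: "x \<in> {y \<in> carrier A. compress e y \<in> W}" "y \<in> {y \<in> carrier A. compress e y \<in> W}"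
      and ab: "cmod a + cmod b \<le> 1"
    have "compress e (a \<odot> x \<oplus> b \<odot> y) = a \<odot> compress e x \<oplus> b \<odot> compress e y"
      using xy eA by (simp add: compress_add compress_smult)
    moreover have "a \<odot> compress e x \<oplus> b \<odot> compress e y \<in> W"
      using Wac xy ab unfolding absolutely_convex_def by blast
    ultimately show "a \<odot> x \<oplus> b \<odot> y \<in> {y \<in> carrier A. compress e y \<in> W}" using xy by simp
  qed auto
  obtain \<delta> where \<delta>: "0 < \<delta>" "\<forall>y\<in>carrier A. p y \<le> \<delta> \<longrightarrow> y \<in> W"
    using W unfolding strict_zero_nbhd_def by blast
  show "\<exists>\<delta>>0. \<forall>y\<in>carrier A. p y \<le> \<delta> \<longrightarrow> y \<in> {y \<in> carrier A. compress e y \<in> W}"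
  proof (intro exI[of _ \<delta>] conjI ballI impI \<delta>(1))
    fix y assume y: "y \<in> carrier A" "p y \<le> \<delta>"
    then have "p (compress e y) \<le> \<delta>" using compress_le[OF e p y(1)] by linarith
    then show "y \<in> {y \<in> carrier A. compress e y \<in> W}" using \<delta>(2) y eA by simp
  qed
  fix C
  obtain F q \<epsilon> where F: "finite F" "F \<subseteq> carrier A" "q \<in> S" "0 < \<epsilon>"
    and FW: "Collect (strict_small C F q \<epsilon>) \<subseteq> W"
    by (rule strict_zero_nbhd_bounded[OF W])
  interpret Q: cstar_seminorm_on A q using F(3) by (rule cstar_on)
  let ?F = "(\<lambda>a. a \<ominus> e \<otimes> a) ` F \<union> (\<lambda>a. a \<ominus> a \<otimes> e) ` F"
  have "y \<in> {y \<in> carrier A. compress e y \<in> W}" if "strict_small C ?F q \<epsilon> y" for y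
  proof -
    have y: "y \<in> carrier A" "\<forall>r\<in>S. r y \<le> C" and *: "\<forall>a\<in>?F. q (y \<otimes> a) < \<epsilon> \<and> q (a \<otimes> y) < \<epsilon>"
      using that unfolding strict_small_def by simp_all
    have "q (compress e y \<otimes> a) < \<epsilon> \<and> q (a \<otimes> compress e y) < \<epsilon>" if a: "a \<in> F" for a
    proof -
      have aA: "a \<in> carrier A" using a F by auto
      have y1: "y \<otimes> (a \<ominus> e \<otimes> a) \<in> carrier A" and y2: "(a \<ominus> a \<otimes> e) \<otimes> y \<in> carrier A"
        using y aA eA by auto
      have "compress e y \<otimes> a = y \<otimes> (a \<ominus> e \<otimes> a) \<ominus> e \<otimes> (y \<otimes> (a \<ominus> e \<otimes> a))"
        unfolding compress_def using y(1) aA eA by algebra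
      then have "q (compress e y \<otimes> a) \<le> q (y \<otimes> (a \<ominus> e \<otimes> a))"
        using damping_left[OF e F(3) y1] by simp
      moreover have "a \<otimes> compress e y = (a \<ominus> a \<otimes> e) \<otimes> y \<ominus> ((a \<ominus> a \<otimes> e) \<otimes> y) \<otimes> e"
        unfolding compress_def using y(1) aA eA by algebra
      then have "q (a \<otimes> compress e y) \<le> q ((a \<ominus> a \<otimes> e) \<otimes> y)"
        using damping_right[OF e F(3) y2] by simp
      moreover have "q (y \<otimes> (a \<ominus> e \<otimes> a)) < \<epsilon>" "q ((a \<ominus> a \<otimes> e) \<otimes> y) < \<epsilon>" using * a by auto
      ultimately show ?thesis by linarith
    qed
    moreover have "r (compress e y) \<le> C" if r: "r \<in> S" for r
      by (rule order_trans[OF compress_le[OF e r y(1)] bspec[OF y(2) r]])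
    ultimately have "strict_small C F q \<epsilon> (compress e y)"
      using compress_closed[OF eA y(1)] by (intro strict_smallI) blast+
    then show ?thesis using y FW by (simp add: subset_iff)
  qed
  then have "Collect (strict_small C ?F q \<epsilon>) \<subseteq> {y \<in> carrier A. compress e y \<in> W}" by (intro subsetI) simp
  moreover have "?F \<subseteq> carrier A" using F eA by auto
  ultimately show "\<exists>F q \<epsilon>. finite F \<and> F \<subseteq> carrier A \<and> q \<in> S \<and> 0 < \<epsilon> \<and>
      Collect (strict_small C F q \<epsilon>) \<subseteq> {y \<in> carrier A. compress e y \<in> W}"
    using F by (intro exI[of _ ?F] exI[of _ q] exI[of _ \<epsilon>] conjI) simp_all
qed

text \<open>Up to an error that is small for \<open>p\<close>, the \<open>p\<close>-ball lifts to a set on which all seminorms are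
  bounded by one constant; there compressing makes elements small in the strict topology.\<close>

lemma compress_into:
  assumes W: "strict_zero_nbhd p W" and p: "p \<in> S" and R: "0 < R"
    and G: "finite G" "G \<subseteq> carrier A" and \<eta>: "0 < \<eta>"
  obtains e where "damping e" "\<And>y. \<lbrakk>y \<in> carrier A; p y \<le> R\<rbrakk> \<Longrightarrow> compress e y \<in> W"
    "\<And>g. g \<in> G \<Longrightarrow> p (g \<ominus> g \<otimes> e) \<le> \<eta>"
proof -
  have Wac: "absolutely_convex A W" using W by (simp add: strict_zero_nbhd_def)
  interpret P: cstar_seminorm_on A p using p by (rule cstar_on)
  obtain \<delta> where \<delta>: "0 < \<delta>" "\<forall>y\<in>carrier A. p y \<le> \<delta> \<longrightarrow> y \<in> W"
    using W unfolding strict_zero_nbhd_def by blast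
  \<comment> \<open>The bound \<open>16 * R\<close> of the lift, doubled because the lift enters
    with weight 1/2.\<close>
  define C where "C = 32 * R"
  have C: "0 < C" using R by (simp add: C_def)
  obtain F q \<epsilon> where F: "finite F" "F \<subseteq> carrier A" "q \<in> S" "0 < \<epsilon>"
    and FW: "Collect (strict_small C F q \<epsilon>) \<subseteq> W"
    by (rule strict_zero_nbhd_bounded[OF W])
  interpret Q: cstar_seminorm_on A q using F(3) by (rule cstar_on)
  obtain s where s: "s \<in> S" "\<forall>x\<in>carrier A. p x \<le> s x \<and> q x \<le> s x"
    using directed[OF p F(3)] by blast
  \<comment> \<open>The products of the compressed lift with \<open>a\<close> are at most
    \<open>C\<close> times the defects of \<open>e\<close> at \<open>a\<close>, so
    \<open>C * \<zeta> < \<epsilon>\<close> is wanted.\<close>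
  define \<zeta> where "\<zeta> = min \<eta> (\<epsilon> / (2 * C))"
  have \<zeta>: "0 < \<zeta>" "\<zeta> \<le> \<eta>" "C * \<zeta> < \<epsilon>"
  proof -
    show "0 < \<zeta>" "\<zeta> \<le> \<eta>" using \<eta> F C by (auto simp: \<zeta>_def)
    have "C * \<zeta> \<le> C * (\<epsilon> / (2 * C))" using C by (intro mult_left_mono) (auto simp: \<zeta>_def)
    also have "\<dots> < \<epsilon>" using C F by simp
    finally show "C * \<zeta> < \<epsilon>" .
  qed
  obtain e where e: "damping e" and e1: "\<And>a. a \<in> F \<union> G \<Longrightarrow> s (a \<ominus> e \<otimes> a) \<le> \<zeta>"
    and e2: "\<And>a. a \<in> F \<union> G \<Longrightarrow> s (a \<ominus> a \<otimes> e) \<le> \<zeta>"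
    using damping_finite[OF s(1), of "F \<union> G" \<zeta>] F G \<zeta> by (metis finite_Un Un_subset_iff)
  have eA: "e \<in> carrier A" using e by auto
  have "compress e y \<in> W" if y: "y \<in> carrier A" "p y \<le> R" for y
  proof -
    obtain z where z: "z \<in> carrier A" "p (y \<ominus> z) \<le> \<delta> / 2" and zC: "\<And>q. q \<in> S \<Longrightarrow> q z \<le> 16 * R"
      using approx_lift[OF p y R, of "\<delta> / 2"] \<delta> by auto
    \<comment> \<open>\<open>T_e y = u / 2 + v / 2\<close>, with \<open>u\<close> in the
      \<open>p\<close>-ball inside \<open>W\<close> and \<open>v\<close> strictly small.\<close>
    define u where "u = 2 \<odot> compress e (y \<ominus> z)"
    define v where "v = 2 \<odot> compress e z"
    have uv: "u \<in> carrier A" "v \<in> carrier A" using y z eA by (auto simp: u_def v_def)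
    have "p u = 2 * p (compress e (y \<ominus> z))" using y z eA by (simp add: u_def P.homogeneous)
    also have "\<dots> \<le> \<delta>" using compress_le[OF e p, of "y \<ominus> z"] y z by simp
    finally have "u \<in> W" using \<delta> uv by blast
    moreover have "v \<in> W"
    proof -
      have "r v \<le> C" if r: "r \<in> S" for r
      proof -
        interpret r: cstar_seminorm_on A r using r by (rule cstar_on)
        show ?thesis
          using compress_le[OF e r z(1)] zC[OF r] z(1) eA by (simp add: v_def C_def r.homogeneous)
      qed
      moreover have "q (v \<otimes> a) < \<epsilon> \<and> q (a \<otimes> v) < \<epsilon>" if a: "a \<in> F" for a
      proof -
        have aA: "a \<in> carrier A" using a F by auto
        define z' where "z' = 2 \<odot> z"
        have z': "z' \<in> carrier A" using z(1) by (simp add: z'_def)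
        have qz': "q z' \<le> C" using zC[OF F(3)] z by (simp add: z'_def C_def Q.homogeneous)
        have v: "v = compress e z'" using z eA by (simp add: v_def z'_def compress_smult)
        define a1 where "a1 = a \<ominus> e \<otimes> a"
        define a2 where "a2 = a \<ominus> a \<otimes> e"
        have a12: "a1 \<in> carrier A" "a2 \<in> carrier A" using aA eA by (auto simp: a1_def a2_def)
        have qa: "q a1 \<le> \<zeta>" "q a2 \<le> \<zeta>"
          using e1[of a] e2[of a] bspec[OF s(2) a12(1)] bspec[OF s(2) a12(2)] a by (auto simp: a1_def a2_def)
        have "v \<otimes> a = z' \<otimes> a1 \<ominus> e \<otimes> (z' \<otimes> a1)"
          unfolding v compress_def a1_def using z' aA eA by algebra
        then have "q (v \<otimes> a) \<le> q (z' \<otimes> a1)" using damping_left[OF e F(3), of "z' \<otimes> a1"] z' a12 by simp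
        also have "\<dots> \<le> q z' * q a1" by (rule Q.submultiplicative[OF z' a12(1)])
        also have "\<dots> \<le> C * \<zeta>" using qz' qa C a12 by (intro mult_mono Q.nonneg) auto
        finally have 1: "q (v \<otimes> a) < \<epsilon>" using \<zeta> by simp
        have "a \<otimes> v = a2 \<otimes> z' \<ominus> (a2 \<otimes> z') \<otimes> e"
          unfolding v compress_def a2_def using z' aA eA by algebra
        then have "q (a \<otimes> v) \<le> q (a2 \<otimes> z')" using damping_right[OF e F(3), of "a2 \<otimes> z'"] z' a12 by simp
        also have "\<dots> \<le> q a2 * q z'" by (rule Q.submultiplicative[OF a12(2) z'])
        also have "\<dots> \<le> \<zeta> * C" using qz' qa C \<zeta>(1) z' by (intro mult_mono Q.nonneg) auto
        finally have "q (a \<otimes> v) < \<epsilon>" using \<zeta> by (simp add: mult.commute)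
        with 1 show ?thesis by simp
      qed
      ultimately have "strict_small C F q \<epsilon> v" using uv(2) by (intro strict_smallI) blast+
      then show ?thesis using FW by (simp add: subset_iff)
    qed
    ultimately have "(1 / 2) \<odot> u \<oplus> (1 / 2) \<odot> v \<in> W"
      using Wac unfolding absolutely_convex_def by (auto simp: norm_divide)
    moreover have "(1 / 2) \<odot> u \<oplus> (1 / 2) \<odot> v = compress e y"
    proof -
      have "compress e (y \<ominus> z) \<oplus> compress e z = compress e ((y \<ominus> z) \<oplus> z)"
        using y z eA by (simp add: compress_add)
      also have "(y \<ominus> z) \<oplus> z = y" using y(1) z(1) by algebra
      finally show ?thesis using y z eA by (simp add: u_def v_def)
    qed
    ultimately show ?thesis by simp
  qed
  moreover have "p (g \<ominus> g \<otimes> e) \<le> \<eta>" if g: "g \<in> G" for g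
  proof -
    have "g \<ominus> g \<otimes> e \<in> carrier A" using g G eA by auto
    then show ?thesis using e2[of g] g s \<zeta> by fastforce
  qed
  ultimately show ?thesis using e by (intro that[of e])
qed

text \<open>The newest compression acts first. The earlier ones can thus be absorbed into the set:
  \<open>e n\<close> is chosen for the preimage of \<open>W\<close> under
  \<open>compress_seq e n\<close>.\<close>

primrec compress_seq :: "(nat \<Rightarrow> 'b) \<Rightarrow> nat \<Rightarrow> 'b \<Rightarrow> 'b" where
  "compress_seq e 0 y = y"
| "compress_seq e (Suc n) y = compress_seq e n (compress (e n) y)"

lemma compress_seq_closed:
  "\<lbrakk>\<And>j. j < n \<Longrightarrow> damping (e j); y \<in> carrier A\<rbrakk> \<Longrightarrow> compress_seq e n y \<in> carrier A"
  by (induction n arbitrary: y) auto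

lemma compress_seq_add:
  "\<lbrakk>\<And>j. j < n \<Longrightarrow> damping (e j); x \<in> carrier A; y \<in> carrier A\<rbrakk>
    \<Longrightarrow> compress_seq e n (x \<oplus> y) = compress_seq e n x \<oplus> compress_seq e n y"
  by (induction n arbitrary: x y) (auto simp: compress_add damping_closed)

lemma compress_seq_smult:
  "\<lbrakk>\<And>j. j < n \<Longrightarrow> damping (e j); y \<in> carrier A\<rbrakk>
    \<Longrightarrow> compress_seq e n (c \<odot> y) = c \<odot> compress_seq e n y"
  by (induction n arbitrary: y) (auto simp: compress_smult damping_closed)

lemma strict_zero_nbhd_compress_seq:
  assumes W: "strict_zero_nbhd p W" and p: "p \<in> S" and e: "\<And>j. j < n \<Longrightarrow> damping (e j)"
  shows "strict_zero_nbhd p {y \<in> carrier A. compress_seq e n y \<in> W}"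
  using e
proof (induction n)
  case 0
  have "W \<subseteq> carrier A" using W by (simp add: strict_zero_nbhd_def absolutely_convex_def)
  then have "{y \<in> carrier A. compress_seq e 0 y \<in> W} = W" by auto
  then show ?case using W by simp
next
  case (Suc n)
  have en: "damping (e n)" using Suc.prems by simp
  have "{y \<in> carrier A. compress_seq e (Suc n) y \<in> W} =
      {y \<in> carrier A. compress (e n) y \<in> {y \<in> carrier A. compress_seq e n y \<in> W}}"
    using damping_closed[OF en] by auto
  then show ?case
    using strict_zero_nbhd_compress[OF Suc.IH en p] Suc.prems by simp
qed

text \<open>Dependent choice: the demands on \<open>e n\<close> involve only earlier elements, and
  \<open>compress_into\<close> meets them, with the quotients as its finite set
  \<open>G\<close>.\<close>

lemma damping_sequence:
  assumes W: "strict_zero_nbhd p W" and p: "p \<in> S" and d: "0 < d"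
  obtains e where "\<And>n. damping (e n)"
    "\<And>n y. \<lbrakk>y \<in> carrier A; p y \<le> 4 ^ Suc n * d\<rbrakk> \<Longrightarrow> compress_seq e (Suc n) y \<in> W"
    "\<And>n k. k < n \<Longrightarrow> p (dyadic_quotient e n k \<ominus> dyadic_quotient e n k \<otimes> e n) \<le> 1 / 2 ^ n"
proof -
  define P where "P e n r \<longleftrightarrow> damping r \<and>
      (\<forall>y\<in>carrier A. p y \<le> 4 ^ Suc n * d \<longrightarrow> compress_seq e n (compress r y) \<in> W) \<and>
      (\<forall>k<n. p (dyadic_quotient e n k \<ominus> dyadic_quotient e n k \<otimes> r) \<le> 1 / 2 ^ n)"
    for e :: "nat \<Rightarrow> 'b" and n r
  have "\<exists>e. \<forall>n. P e n (e n)"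
  proof (rule dependent_wellorder_choice)
    fix r and f g :: "nat \<Rightarrow> 'b" and n assume fg: "\<And>j. j < n \<Longrightarrow> f j = g j"
    \<comment> \<open>The demands at stage \<open>n\<close> do not change when the sequence is
      altered from \<open>n\<close> on.\<close>
    have "dyadic_sum f m = dyadic_sum g m \<and> (\<forall>y. compress_seq f m y = compress_seq g m y)" if "m \<le> n" for m
      using that by (induction m) (auto simp: fg)
    then have 1: "dyadic_sum f n = dyadic_sum g n" "compress_seq f n y = compress_seq g n y" for y by auto
    have 2: "dyadic_quotient f n k = dyadic_quotient g n k" if "k < n" for k
      unfolding dyadic_quotient_def dyadic_right_def 1 fg[OF that] ..
    show "P f n r = P g n r" unfolding P_def using 1 2 by simp
  next
    fix n and f :: "nat \<Rightarrow> 'b" assume "\<And>j. j < n \<Longrightarrow> P f j (f j)"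
    then have f: "\<And>j. j < n \<Longrightarrow> damping (f j)" by (simp add: P_def)
    obtain r where r: "damping r"
      "\<And>y. \<lbrakk>y \<in> carrier A; p y \<le> 4 ^ Suc n * d\<rbrakk> \<Longrightarrow> compress r y \<in> {y \<in> carrier A. compress_seq f n y \<in> W}"
      "\<And>g. g \<in> dyadic_quotient f n ` {..<n} \<Longrightarrow> p (g \<ominus> g \<otimes> r) \<le> 1 / 2 ^ n"
    proof (rule compress_into[OF strict_zero_nbhd_compress_seq[OF W p f] p,
          where R = "4 ^ Suc n * d" and \<eta> = "1 / 2 ^ n" and G = "dyadic_quotient f n ` {..<n}"])
      show "dyadic_quotient f n ` {..<n} \<subseteq> carrier A" using dyadic_quotient(1)[of n f, OF f] by auto
    qed (use d in auto)
    then have "P f n r" by (auto simp: P_def)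
    then show "\<exists>r. P f n r" ..
  qed
  then obtain e where e: "\<And>n. P e n (e n)" by blast
  show ?thesis
    by (rule that[of e]) (use e in \<open>auto simp: P_def\<close>)
qed

text \<open>One \<open>a\<close> and one seminorm suffice. The conditions on \<open>a x\<close> and
  \<open>x star(a)\<close> also make sense for multipliers, which permits the passage from
  \<open>A\<close> to \<open>M(A)\<close>.\<close>

theorem strict_zero_nbhd_contains:
  assumes W: "strict_zero_nbhd p W" and p: "p \<in> S"
  shows "\<exists>a\<in>carrier A. \<exists>c>0. \<forall>x\<in>carrier A. p (a \<otimes> x) \<le> c \<and> p (x \<otimes> star A a) \<le> c \<longrightarrow> x \<in> W"
proof -
  interpret cstar_seminorm_on A p using p by (rule cstar_on)
  have Wac: "absolutely_convex A W" using W by (simp add: strict_zero_nbhd_def)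
  obtain d where d: "0 < d" "\<forall>y\<in>carrier A. p y \<le> d \<longrightarrow> y \<in> W"
    using W unfolding strict_zero_nbhd_def by blast
  obtain e where e: "\<And>n. damping (e n)"
    and eW: "\<And>n y. \<lbrakk>y \<in> carrier A; p y \<le> 4 ^ Suc n * d\<rbrakk> \<Longrightarrow> compress_seq e (Suc n) y \<in> W"
    and small: "\<And>n k. k < n \<Longrightarrow> p (dyadic_quotient e n k \<ominus> dyadic_quotient e n k \<otimes> e n) \<le> 1 / 2 ^ n"
    using damping_sequence[OF W p d(1)] by metis
  have eA: "e n \<in> carrier A" for n using e by auto
  \<comment> \<open>Index shift: after \<open>n\<close> compressions the radius is
    \<open>4 ^ n * d\<close>, and for \<open>n = 0\<close> this is the original ball in
    \<open>W\<close>.\<close>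
  have inW: "compress_seq e n y \<in> W" if "y \<in> carrier A" "p y \<le> 4 ^ n * d" for n y
    using eW d that by (cases n) auto
  obtain a where a: "a \<in> carrier A" "\<And>k x. x \<in> carrier A \<Longrightarrow> p (e k \<otimes> x) \<le> 2 ^ (k + 3) * p (a \<otimes> x)"
    using dyadic_domination[OF e p small] by metis
  \<comment> \<open>Chosen such that \<open>2 ^ (n + 2)\<close> times the bound
    \<open>2 * 2 ^ (n + 3) * c\<close> of the \<open>n\<close>-th difference is exactly
    \<open>4 ^ n * d\<close>.\<close>
  define c where "c = d / 64"
  have c: "0 < c" using d by (simp add: c_def)
  have "x \<in> W" if x: "x \<in> carrier A" "p (a \<otimes> x) \<le> c" "p (x \<otimes> star A a) \<le> c" for x
  proof -
    have ex: "p (e k \<otimes> x) \<le> 2 ^ (k + 3) * c" for k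
      by (rule order_trans[OF a(2)[OF x(1)] mult_left_mono[OF x(2)]]) simp
    \<comment> \<open>The domination by \<open>a\<close> is one-sided; for products from the right
      it is applied to \<open>star A x\<close>, which produces \<open>star A a\<close>.\<close>
    have xe: "p (x \<otimes> e k) \<le> 2 ^ (k + 3) * c" for k
    proof -
      have "p (x \<otimes> e k) = p (e k \<otimes> star A x)"
        using at_star[of "x \<otimes> e k"] x(1) eA e by (simp add: star_mult)
      also have "\<dots> \<le> 2 ^ (k + 3) * p (a \<otimes> star A x)" using a(2) x(1) by simp
      also have "p (a \<otimes> star A x) = p (x \<otimes> star A a)"
        using at_star[of "x \<otimes> star A a"] x(1) a(1) by (simp add: star_mult)
      also have "2 ^ (k + 3) * p (x \<otimes> star A a) \<le> 2 ^ (k + 3) * c" using x(3) by (intro mult_left_mono) auto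
      finally show ?thesis .
    qed
    have cs: "compress_seq e n y \<in> carrier A" if "y \<in> carrier A" for n y
      by (rule compress_seq_closed[of n e, OF e that])
    \<comment> \<open>The sum of the weights \<open>1 / 2 ^ (j + 2)\<close> over
      \<open>j < n\<close>. It stays below 1/2, which leaves weight 1/2 for the remainder
      \<open>compress_seq e n x\<close>.\<close>
    define t :: "nat \<Rightarrow> real" where "t n = (1 - 1 / 2 ^ n) / 2" for n
    have t: "0 \<le> t n" "t n \<le> 1 / 2" "t (Suc n) = t n + 1 / 2 ^ (n + 2)" for n
      by (auto simp: t_def field_simps)
    have sum: "\<exists>u\<in>W. x = compress_seq e n x \<oplus> of_real (t n) \<odot> u" for n
    proof (induction n)
      case 0
      have "\<zero> \<in> W" using d by (auto simp: less_imp_le)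
      then show ?case using x(1) by (intro bexI[of _ \<zero>]) (auto simp: t_def)
    next
      case (Suc n)
      then obtain u where u: "u \<in> W" "x = compress_seq e n x \<oplus> of_real (t n) \<odot> u" by blast
      define z where "z = x \<ominus> compress (e n) x"
      have z: "z \<in> carrier A" using x(1) eA by (simp add: z_def)
      define xe where "xe = x \<otimes> e n"
      have xe': "xe \<in> carrier A" using x(1) eA by (simp add: xe_def)
      \<comment> \<open>\<open>x - (1 - e) x (1 - e) = e x + (1 - e) x e\<close>, so only
        \<open>e x\<close> and \<open>x e\<close> have to be estimated.\<close>
      have "z = e n \<otimes> x \<oplus> (xe \<ominus> e n \<otimes> xe)"
        unfolding z_def xe_def compress_def using x(1) eA[of n] by algebra
      then have "p z \<le> p (e n \<otimes> x) + p (xe \<ominus> e n \<otimes> xe)"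
        using triangle[of "e n \<otimes> x" "xe \<ominus> e n \<otimes> xe"] x(1) xe' eA by simp
      also have "\<dots> \<le> 2 ^ (n + 3) * c + 2 ^ (n + 3) * c"
        using ex[of n] xe[of n, folded xe_def] damping_left[OF e p xe', of n] by linarith
      finally have "p (of_real (2 ^ (n + 2)) \<odot> z) \<le> 2 ^ (n + 2) * (2 ^ (n + 3) * c + 2 ^ (n + 3) * c)"
        using z by (simp add: homogeneous norm_mult norm_power)
      also have "\<dots> = 4 ^ n * d"
      proof -
        have "(4::real) ^ n = 2 ^ n * 2 ^ n" by (simp flip: power_mult_distrib)
        then show ?thesis by (simp add: c_def power_add)
      qed
      finally have v: "compress_seq e n (of_real (2 ^ (n + 2)) \<odot> z) \<in> W"
        using z by (intro inW) auto
      define v where "v = compress_seq e n (of_real (2 ^ (n + 2)) \<odot> z)"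
      have vz: "of_real (1 / 2 ^ (n + 2)) \<odot> v = compress_seq e n z"
        unfolding v_def using compress_seq_smult[of n e, OF e z] cs[OF z] by simp
      obtain w where w: "w \<in> W" "of_real (t n) \<odot> u \<oplus> of_real (1 / 2 ^ (n + 2)) \<odot> v = of_real (t (Suc n)) \<odot> w"
      proof (rule absolutely_convex_combine[OF Wac u(1) v[folded v_def]])
        show "cmod (of_real (t n)) + cmod (of_real (1 / 2 ^ (n + 2))) \<le> t (Suc n)"
          unfolding norm_of_real t(3) using t(1)[of n] by simp
        show "0 < t (Suc n)" unfolding t(3) using t(1)[of n] by (intro add_nonneg_pos) auto
      qed
      have uA: "u \<in> carrier A" using u Wac by (auto simp: absolutely_convex_def)
      have "x = compress (e n) x \<oplus> z"
        unfolding z_def using x(1) compress_closed[OF eA[of n] x(1)] by algebra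
      then have "compress_seq e n x = compress_seq e (Suc n) x \<oplus> compress_seq e n z"
        using compress_seq_add[of n e, OF e compress_closed[OF eA[of n] x(1)] z] by (simp only: compress_seq.simps)
      then have "x = compress_seq e (Suc n) x \<oplus> (of_real (t n) \<odot> u \<oplus> compress_seq e n z)"
        using u(2) uA cs[OF z] cs[OF x(1), of "Suc n"] by (metis M.a_assoc M.a_comm smult_closed')
      then show ?case using w unfolding vz by auto
    qed
    \<comment> \<open>The telescoping stops once \<open>2 x\<close> is inside the ball that
      \<open>compress_seq e n\<close> maps into \<open>W\<close>.\<close>
    obtain n where n: "2 * p x \<le> 4 ^ n * d"
    proof -
      obtain n where "2 * p x / d < 4 ^ n" using real_arch_pow[of 4] by auto
      then have "2 * p x \<le> 4 ^ n * d" using d by (simp add: field_simps)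
      then show ?thesis by (rule that)
    qed
    obtain u where u: "u \<in> W" "x = compress_seq e n x \<oplus> of_real (t n) \<odot> u" using sum by blast
    define v where "v = compress_seq e n (2 \<odot> x)"
    have v: "v \<in> W" unfolding v_def using x n by (intro inW) (auto simp: homogeneous)
    have "x = (1 / 2) \<odot> v \<oplus> of_real (t n) \<odot> u"
      using u(2) compress_seq_smult[of n e x 2, OF e x(1)] cs[OF x(1)] by (simp add: v_def)
    moreover have "(1 / 2) \<odot> v \<oplus> of_real (t n) \<odot> u \<in> W"
      using Wac u v t(1,2)[of n] unfolding absolutely_convex_def by (auto simp: norm_divide)
    ultimately show ?thesis by simp
  qed
  then have "\<forall>x\<in>carrier A. p (a \<otimes> x) \<le> c \<and> p (x \<otimes> star A a) \<le> c \<longrightarrow> x \<in> W" by blast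
  then show ?thesis using a(1) c by blast
qed

end


section \<open>Pro-$C^*$-algebras and completeness\<close>

locale pro_cstar =
  fixes A :: "('b, 'm) top_star_algebra_scheme" (structure)
  assumes pro: "pro_cstar_algebra A"
begin

abbreviation "S \<equiv> cont_seminorms A"

sublocale star_algebra A
  using pro by (simp add: pro_cstar_algebra_def topological_star_algebra_def)

lemma cont_seminorms_cstar: "p \<in> S \<Longrightarrow> cstar_seminorm_on A p"
  by unfold_locales (simp add: cont_seminorms_def)

lemma topspace_topo: "topspace (topo A) = carrier A"
  using pro unfolding pro_cstar_algebra_def topological_star_algebra_def linear_topology_def by blast

lemma topo_eq: "topo A = seminorm_topology A S"
  using pro by (simp add: pro_cstar_algebra_def)

text \<open>Squaring commutes with \<open>max\<close> on nonnegative numbers, so the C*-identity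
  survives. This makes \<open>S\<close> directed; the restriction to the carrier keeps the result
  extensional.\<close>

lemma cont_seminorms_max:
  assumes p: "p \<in> S" and q: "q \<in> S"
  shows "(\<lambda>x\<in>carrier A. max (p x) (q x)) \<in> S"
proof -
  interpret p: cstar_seminorm_on A p using p by (rule cont_seminorms_cstar)
  interpret q: cstar_seminorm_on A q using q by (rule cont_seminorms_cstar)
  let ?m = "\<lambda>x\<in>carrier A. max (p x) (q x)"
  have mult: "max (p (x \<otimes> y)) (q (x \<otimes> y)) \<le> max (p x) (q x) * max (p y) (q y)"
    if "x \<in> carrier A" "y \<in> carrier A" for x y
  proof (rule max.boundedI)
    show "p (x \<otimes> y) \<le> max (p x) (q x) * max (p y) (q y)"
      by (rule order_trans[OF p.submultiplicative[OF that]]) (use that in \<open>auto intro!: mult_mono simp: le_max_iff_disj\<close>)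
    show "q (x \<otimes> y) \<le> max (p x) (q x) * max (p y) (q y)"
      by (rule order_trans[OF q.submultiplicative[OF that]]) (use that in \<open>auto intro!: mult_mono simp: le_max_iff_disj\<close>)
  qed
  have add: "max (p (x \<oplus> y)) (q (x \<oplus> y)) \<le> max (p x) (q x) + max (p y) (q y)"
    if "x \<in> carrier A" "y \<in> carrier A" for x y
    using p.triangle[OF that] q.triangle[OF that] by linarith
  have sq: "max ((p x)\<^sup>2) ((q x)\<^sup>2) = (max (p x) (q x))\<^sup>2" if "x \<in> carrier A" for x
  proof (cases "p x \<le> q x")
    case True
    then have "(p x)\<^sup>2 \<le> (q x)\<^sup>2" by (rule power_mono[OF _ p.nonneg[OF that]])
    then show ?thesis using True by (simp add: max_def)
  next
    case False
    then have "(q x)\<^sup>2 \<le> (p x)\<^sup>2" by (intro power_mono q.nonneg[OF that]) simp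
    then show ?thesis using False by (simp add: max_def)
  qed
  have "cstar_seminorm A ?m"
    unfolding cstar_seminorm_def
    using mult add sq
    by (simp add: p.homogeneous q.homogeneous p.cstar_identity q.cstar_identity
        max_mult_distrib_left le_max_iff_disj)
  moreover have "continuous_map (topo A) euclideanreal ?m"
  proof (rule continuous_map_eq)
    show "continuous_map (topo A) euclideanreal (\<lambda>x. max (p x) (q x))"
      using p q by (intro continuous_map_real_max) (auto simp: cont_seminorms_def)
  qed (simp add: topspace_topo)
  ultimately show ?thesis by (simp add: cont_seminorms_def)
qed

lemma zero_in_cont_seminorms: "(\<lambda>x\<in>carrier A. 0) \<in> S"
proof -
  have "continuous_map (topo A) euclideanreal (\<lambda>x\<in>carrier A. 0)"
    by (rule continuous_map_eq[of _ _ "\<lambda>_. 0"]) (simp_all add: topspace_topo)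
  then show ?thesis by (simp add: cont_seminorms_def cstar_seminorm_def)
qed

sublocale seminorm_family A S
proof (intro seminorm_family.intro seminorm_family_axioms.intro)
  show "complex_module A" ..
  show "S \<noteq> {}" using zero_in_cont_seminorms by blast
  fix p assume "p \<in> S"
  then interpret cstar_seminorm_on A p by (rule cont_seminorms_cstar)
  show "cseminorm A p" ..
qed

lemma cont_seminorms_directed:
  assumes "p \<in> S" "q \<in> S"
  shows "\<exists>r\<in>S. \<forall>x\<in>carrier A. p x \<le> r x \<and> q x \<le> r x"
  by (rule bexI[OF _ cont_seminorms_max[OF assms]]) simp

lemma cont_seminorms_directed_finite:
  assumes "finite F" "F \<subseteq> S"
  shows "\<exists>r\<in>S. \<forall>p\<in>F. \<forall>x\<in>carrier A. p x \<le> r x"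
  using assms
proof (induction F rule: finite_induct)
  case empty
  then show ?case using nonempty by blast
next
  case (insert q F)
  then obtain r where r: "r \<in> S" "\<forall>p\<in>F. \<forall>x\<in>carrier A. p x \<le> r x" by auto
  obtain s where s: "s \<in> S" "\<forall>x\<in>carrier A. q x \<le> s x \<and> r x \<le> s x"
    using cont_seminorms_directed[of q r] insert r by auto
  have "\<forall>p\<in>insert q F. \<forall>x\<in>carrier A. p x \<le> s x"
    using r(2) s(2) by (metis insert_iff order_trans)
  with s(1) show ?case by blast
qed

text \<open>Directedness replaces the finitely many seminorms of a basic neighbourhood by
  one.\<close>

lemma zero_nbhd_topo_iff:
  "zero_nbhd A (topo A) U \<longleftrightarrow>
    U \<subseteq> carrier A \<and> (\<exists>p\<in>S. \<exists>e>0. {y \<in> carrier A. p y < e} \<subseteq> U)"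
proof -
  have "(\<exists>F e. finite F \<and> F \<subseteq> S \<and> 0 < e \<and> {y \<in> carrier A. \<forall>p\<in>F. p y < e} \<subseteq> U) \<longleftrightarrow>
      (\<exists>p\<in>S. \<exists>e>0. {y \<in> carrier A. p y < e} \<subseteq> U)"
  proof
    assume "\<exists>F e. finite F \<and> F \<subseteq> S \<and> 0 < e \<and> {y \<in> carrier A. \<forall>p\<in>F. p y < e} \<subseteq> U"
    then obtain F e where F: "finite F" "F \<subseteq> S" "0 < e" "{y \<in> carrier A. \<forall>p\<in>F. p y < e} \<subseteq> U"
      by blast
    obtain r where r: "r \<in> S" "\<forall>p\<in>F. \<forall>x\<in>carrier A. p x \<le> r x"
      using cont_seminorms_directed_finite[OF F(1,2)] by blast
    have "{y \<in> carrier A. r y < e} \<subseteq> {y \<in> carrier A. \<forall>p\<in>F. p y < e}"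
    proof (intro subsetI CollectI conjI ballI)
      fix y p assume y: "y \<in> {y \<in> carrier A. r y < e}" and p: "p \<in> F"
      have "p y \<le> r y" using r(2) y p by blast
      then show "p y < e" using y by simp
    qed simp
    then have "{y \<in> carrier A. r y < e} \<subseteq> U" using F(4) by (rule subset_trans)
    then show "\<exists>p\<in>S. \<exists>e>0. {y \<in> carrier A. p y < e} \<subseteq> U" using r(1) F(3) by blast
  next
    assume "\<exists>p\<in>S. \<exists>e>0. {y \<in> carrier A. p y < e} \<subseteq> U"
    then obtain p e where "p \<in> S" "0 < e" "{y \<in> carrier A. p y < e} \<subseteq> U" by blast
    then show "\<exists>F e. finite F \<and> F \<subseteq> S \<and> 0 < e \<and> {y \<in> carrier A. \<forall>p\<in>F. p y < e} \<subseteq> U"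
      by (intro exI[of _ "{p}"] exI[of _ e]) simp
  qed
  then show ?thesis unfolding topo_eq zero_nbhd_iff by simp
qed

lemma separating_seminorms:
  assumes x: "x \<in> carrier A" and zero: "\<And>p. p \<in> S \<Longrightarrow> p x = 0"
  shows "x = \<zero>"
proof (rule ccontr)
  assume "x \<noteq> \<zero>"
  moreover have "Hausdorff_space (topo A)" using pro unfolding pro_cstar_algebra_def by blast
  ultimately obtain U V where UV: "openin (topo A) U" "openin (topo A) V" "\<zero> \<in> U" "x \<in> V" "disjnt U V"
    unfolding Hausdorff_space_def topspace_topo using x M.zero_closed by metis
  have "zero_nbhd A (topo A) U"
    using UV openin_subset[OF UV(1)] by (simp add: zero_nbhd_def interior_of_openin topspace_topo)
  then obtain p e where p: "p \<in> S" "0 < e" "{y \<in> carrier A. p y < e} \<subseteq> U"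
    unfolding zero_nbhd_topo_iff by blast
  have "p x = 0" by (rule zero[OF p(1)])
  then have "x \<in> {y \<in> carrier A. p y < e}" using x p(2) by simp
  then have "x \<in> U" by (rule subsetD[OF p(3)])
  then show False using UV(4,5) by (meson disjnt_iff)
qed

text \<open>Completeness is kept in filter form because \<open>compatible_family_lift\<close>
  applies it to a filter base indexed by \<open>S\<close>, not only to sequences.\<close>

lemma complete_filter:
  assumes "F \<noteq> bot" "\<forall>\<^sub>F x in F. x \<in> carrier A"
    and "\<And>p e. \<lbrakk>p \<in> S; 0 < e\<rbrakk> \<Longrightarrow> \<forall>\<^sub>F (x, y) in F \<times>\<^sub>F F. x \<in> carrier A \<and> y \<in> carrier A \<and> p (x \<ominus> y) < e"
  shows "\<exists>l\<in>carrier A. \<forall>p\<in>S. \<forall>e>0. \<forall>\<^sub>F x in F. p (x \<ominus> l) < e"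
proof -
  have "\<forall>\<^sub>F (x, y) in F \<times>\<^sub>F F. x \<ominus> y \<in> U" if U: "zero_nbhd A (topo A) U" for U
  proof -
    obtain p e where p: "p \<in> S" "0 < e" "{y \<in> carrier A. p y < e} \<subseteq> U"
      using U unfolding zero_nbhd_topo_iff by blast
    show ?thesis
      by (rule eventually_mono[OF assms(3)[OF p(1,2)]]) (use p(3) in auto)
  qed
  moreover have "complete_in A (topo A)" using pro unfolding pro_cstar_algebra_def by blast
  ultimately obtain l where l: "limitin (topo A) (\<lambda>x. x) l F"
    using assms(1,2) unfolding complete_in_def by blast
  then have lA: "l \<in> carrier A" by (simp add: limitin_def topspace_topo)
  have "\<forall>\<^sub>F x in F. p (x \<ominus> l) < e" if p: "p \<in> S" and e: "0 < e" for p e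
  proof -
    interpret cstar_seminorm_on A p using p by (rule cont_seminorms_cstar)
    have "openin (topo A) {y \<in> carrier A. p (y \<ominus> l) < e}"
      unfolding topo_eq using p lA by (rule openin_subbasic)
    moreover have "l \<in> {y \<in> carrier A. p (y \<ominus> l) < e}" using lA e by (simp add: a_minus_def M.r_neg)
    ultimately have "\<forall>\<^sub>F x in F. x \<in> {y \<in> carrier A. p (y \<ominus> l) < e}"
      using l unfolding limitin_def by blast
    then show ?thesis by (rule eventually_mono) simp
  qed
  then show ?thesis using lA by (intro bexI[of _ l] ballI allI impI)
qed

lemma summable_limit_exists:
  assumes s: "\<And>n. s n \<in> carrier A"
    and t: "\<And>p. p \<in> S \<Longrightarrow> \<exists>t. summable t \<and> (\<forall>n. p (s (Suc n) \<ominus> s n) \<le> t n)"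
  shows "\<exists>l\<in>carrier A. \<forall>p\<in>S. (\<lambda>n. p (s n \<ominus> l)) \<longlonglongrightarrow> 0"
proof -
  let ?F = "filtermap s sequentially"
  have cauchy: "\<exists>N. \<forall>m\<ge>N. \<forall>n\<ge>N. p (s m \<ominus> s n) < e" if p: "p \<in> S" and e: "0 < e" for p e
  proof -
    interpret cstar_seminorm_on A p using p by (rule cont_seminorms_cstar)
    obtain t where t: "summable t" "\<forall>n. p (s (Suc n) \<ominus> s n) \<le> t n" using t[OF p] by blast
    have le: "p (s n \<ominus> s m) \<le> sum t {m..<n}" if "m \<le> n" for m n
      using that
    proof (induction n rule: dec_induct)
      case base
      show ?case using s[of m] by (simp add: a_minus_def M.r_neg)
    next
      case (step n)
      have "p (s (Suc n) \<ominus> s m) \<le> p (s (Suc n) \<ominus> s n) + p (s n \<ominus> s m)"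
        by (intro triangle_via s)
      also have "\<dots> \<le> t n + sum t {m..<n}" using t(2) step by (intro add_mono) auto
      finally show ?case using step by simp
    qed
    obtain N where N: "\<forall>m\<ge>N. \<forall>n. norm (sum t {m..<n}) < e"
      using t(1) e unfolding summable_Cauchy by blast
    have "p (s n \<ominus> s m) < e" if "N \<le> m" "m \<le> n" for m n
      using le[OF that(2)] N that by (metis abs_le_D1 le_less_trans real_norm_def order_refl)
    then show ?thesis
      using diff_commute[OF s s] by (metis linear)
  qed
  have F1: "\<forall>\<^sub>F (x, y) in ?F \<times>\<^sub>F ?F. x \<in> carrier A \<and> y \<in> carrier A \<and> p (x \<ominus> y) < e"
    if p: "p \<in> S" and e: "0 < e" for p e
  proof -
    obtain N where N: "\<forall>m\<ge>N. \<forall>n\<ge>N. p (s m \<ominus> s n) < e" using cauchy[OF p e] by blast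
    have ev: "\<forall>\<^sub>F x in ?F. x \<in> s ` {N..}"
      unfolding eventually_filtermap by (rule eventually_sequentiallyI[of N]) simp
    show ?thesis
      unfolding eventually_prod_filter
      by (rule exI[of _ "\<lambda>x. x \<in> s ` {N..}"], rule exI[of _ "\<lambda>x. x \<in> s ` {N..}"])
        (use ev N s in auto)
  qed
  have F2: "?F \<noteq> bot" by (simp add: filtermap_bot_iff)
  have F3: "\<forall>\<^sub>F x in ?F. x \<in> carrier A" unfolding eventually_filtermap using s by simp
  have ex: "\<exists>l\<in>carrier A. \<forall>p\<in>S. \<forall>e>0. \<forall>\<^sub>F x in ?F. p (x \<ominus> l) < e"
    by (rule complete_filter[OF F2 F3]) (rule F1)
  obtain l where l: "l \<in> carrier A" "\<forall>p\<in>S. \<forall>e>0. \<forall>\<^sub>F x in ?F. p (x \<ominus> l) < e"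
    using ex by (elim bexE)
  have "(\<lambda>n. p (s n \<ominus> l)) \<longlonglongrightarrow> 0" if p: "p \<in> S" for p
  proof (rule tendstoI)
    fix e :: real assume e: "0 < e"
    interpret cstar_seminorm_on A p using p by (rule cont_seminorms_cstar)
    have "\<forall>\<^sub>F n in sequentially. p (s n \<ominus> l) < e"
      using l(2)[rule_format, OF p e] by (simp add: eventually_filtermap)
    then show "\<forall>\<^sub>F n in sequentially. dist (p (s n \<ominus> l)) 0 < e"
      by (rule eventually_mono) (use s l(1) in simp)
  qed
  with l(1) show ?thesis by blast
qed

sublocale cstar_family A S
proof unfold_locales
  fix p assume "p \<in> S" then show "cstar_seminorm A p" by (simp add: cont_seminorms_def)
next
  fix x assume "x \<in> carrier A" "\<And>p. p \<in> S \<Longrightarrow> p x = 0"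
  then show "x = \<zero>" by (rule separating_seminorms)
next
  fix p q assume "p \<in> S" "q \<in> S"
  then show "\<exists>r\<in>S. \<forall>x\<in>carrier A. p x \<le> r x \<and> q x \<le> r x" by (rule cont_seminorms_directed)
next
  fix s assume "\<And>n. s n \<in> carrier A" "\<And>p. p \<in> S \<Longrightarrow> \<exists>t. summable t \<and> (\<forall>n. p (s (Suc n) \<ominus> s n) \<le> t n)"
  then show "\<exists>l\<in>carrier A. \<forall>p\<in>S. (\<lambda>n. p (s n \<ominus> l)) \<longlonglongrightarrow> 0" by (rule summable_limit_exists)
qed

end

text \<open>The argument for metrizable spaces. If \<open>C\<close> is not a neighbourhood, there
  are \<open>x n\<close> outside \<open>C\<close> with \<open>f i (x n)\<close> below
  \<open>1 / (n + 1)\<close> for all \<open>i <= n\<close>. The multiples \<open>(n + 1) x n\<close>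
  form a bounded set, and absorbing it would put some \<open>x n\<close> into
  \<open>C\<close>.\<close>

lemma (in seminorm_family) countable_imp_bornological:
  assumes cnt: "countable P"
  shows "bornological V T"
  unfolding bornological_def
proof (intro conjI allI impI locally_convex)
  fix C assume "absolutely_convex V C \<and> (\<forall>B. bounded_in V T B \<longrightarrow> absorbs V C B)"
  then have C: "absolutely_convex V C" and Cabs: "\<And>B. bounded_in V T B \<Longrightarrow> absorbs V C B" by blast+
  have CV: "C \<subseteq> carrier V" using C by (simp add: absolutely_convex_def)
  obtain f :: "nat \<Rightarrow> 'b \<Rightarrow> real" where f: "range f = P"
    using cnt nonempty by (metis range_from_nat_into)
  have fP: "f i \<in> P" for i using f by blast
  show "zero_nbhd V T C"
  proof (rule ccontr)
    assume not: "\<not> zero_nbhd V T C"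
    have "\<exists>x\<in>carrier V. (\<forall>i\<le>n. f i x < 1 / Suc n) \<and> x \<notin> C" for n
    proof (rule ccontr)
      assume "\<not> ?thesis"
      then have "{y \<in> carrier V. \<forall>p\<in>f ` {..n}. p y < 1 / Suc n} \<subseteq> C" by auto
      then have "zero_nbhd V T C"
        unfolding zero_nbhd_iff using CV fP
        by (intro conjI exI[of _ "f ` {..n}"] exI[of _ "1 / real (Suc n)"]) auto
      with not show False by blast
    qed
    then obtain x where x: "\<And>n. x n \<in> carrier V" "\<And>n i. i \<le> n \<Longrightarrow> f i (x n) < 1 / Suc n" "\<And>n. x n \<notin> C"
      by metis
    define b where "b n = of_nat (Suc n) \<odot> x n" for n
    have b: "b n \<in> carrier V" for n using x(1) by (simp add: b_def)
    have "bounded_in V T (range b)"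
      unfolding bounded_in_iff
    proof (intro conjI ballI)
      show "range b \<subseteq> carrier V" using b by blast
      fix p assume "p \<in> P"
      then obtain i where i: "p = f i" using f by blast
      interpret cseminorm V p using \<open>p \<in> P\<close> by (rule seminorms)
      have fin: "finite (p ` b ` {..<i})" by simp
      have "p (b n) \<le> Max (insert 1 (p ` b ` {..<i}))" for n
      proof (cases "n < i")
        case True
        then show ?thesis using fin by (intro Max_ge) auto
      next
        case False
        then have "p (x n) < 1 / Suc n" using x(2)[of i n] i by simp
        then have "real (Suc n) * p (x n) \<le> 1" by (simp add: field_simps)
        moreover have "p (b n) = real (Suc n) * p (x n)"
          unfolding b_def homogeneous[OF x(1)] norm_of_nat ..
        ultimately have "p (b n) \<le> 1" by simp
        also have "1 \<le> Max (insert 1 (p ` b ` {..<i}))" using fin by (intro Max_ge) auto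
        finally show ?thesis .
      qed
      then show "\<exists>K. \<forall>b\<in>range b. p b \<le> K" by blast
    qed
    then obtain r where r: "0 < r" "\<forall>c. r \<le> cmod c \<longrightarrow> range b \<subseteq> (\<lambda>u. c \<odot> u) ` C"
      using Cabs unfolding absorbs_def by blast
    \<comment> \<open>For an index beyond \<open>r\<close> the factor \<open>n + 1\<close> of
      \<open>b n\<close> is itself an admissible scalar in the absorption, so it cancels.\<close>
    obtain n :: nat where n: "r < n" using reals_Archimedean2 by blast
    have "r \<le> cmod (of_nat (Suc n))" using n unfolding norm_of_nat by simp
    then have sub: "range b \<subseteq> (\<lambda>u. of_nat (Suc n) \<odot> u) ` C" by (rule r(2)[rule_format])
    have "b n \<in> range b" by simp
    from subsetD[OF sub this] obtain u where u: "b n = of_nat (Suc n) \<odot> u" "u \<in> C" by (rule imageE)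
    have nz: "(of_nat (Suc n) :: complex) \<noteq> 0" by (simp only: of_nat_eq_0_iff)
    have "x n = (1 / of_nat (Suc n)) \<odot> b n" unfolding b_def using x(1) nz by (simp del: of_nat_Suc)
    also have "\<dots> = u" unfolding u(1) using u(2) CV nz by (auto simp del: of_nat_Suc)
    finally show False using u(2) x(3)[of n] by simp
  qed
qed

lemma sigma_cstar_imp_bornological:
  assumes A: "sigma_cstar_algebra A"
  shows "bornological A (topo A)"
proof -
  interpret pro_cstar A using A by unfold_locales (simp add: sigma_cstar_algebra_def)
  obtain P where P: "countable P" "P \<subseteq> S" "topo A = seminorm_topology A P"
    using A by (auto simp: sigma_cstar_algebra_def)
  \<comment> \<open>An empty family would generate the topology of the empty space, whereas the
    carrier contains zero.\<close>
  have "P \<noteq> {}"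
  proof
    assume "P = {}"
    then have "topspace (topo A) = {}"
      unfolding P(3) by (simp add: seminorm_topology_def)
    then show False using topspace_topo M.zero_closed by auto
  qed
  then interpret P: seminorm_family A P
    using P(2) seminorms by (intro seminorm_family.intro seminorm_family_axioms.intro complex_module_axioms) auto
  show ?thesis unfolding P(3) by (rule P.countable_imp_bornological[OF P(1)])
qed


section \<open>Quotients and their multipliers\<close>

locale seminormed_star_algebra = star_algebra B + cseminorm B "nrm B"
  for B :: "('b, 'm) normed_star_algebra_scheme" (structure)
begin

abbreviation "M \<equiv> cstar_multiplier_algebra B"

lemma bounded_operatorsI:
  assumes "f \<in> extensional (carrier B)" "\<And>x. x \<in> carrier B \<Longrightarrow> f x \<in> carrier B"
    "\<And>x y. \<lbrakk>x \<in> carrier B; y \<in> carrier B\<rbrakk> \<Longrightarrow> f (x \<oplus> y) = f x \<oplus> f y"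
    "\<And>c x. x \<in> carrier B \<Longrightarrow> f (c \<odot> x) = c \<odot> f x"
    "\<And>x. x \<in> carrier B \<Longrightarrow> nrm B (f x) \<le> k * nrm B x"
  shows "f \<in> bounded_operators B"
  using assms unfolding bounded_operators_def PiE_def by (intro CollectI conjI IntI Pi_I ballI allI exI[of _ k])

lemma bounded_operatorsD:
  assumes "f \<in> bounded_operators B"
  shows "f \<in> extensional (carrier B)" "x \<in> carrier B \<Longrightarrow> f x \<in> carrier B"
    "\<lbrakk>x \<in> carrier B; y \<in> carrier B\<rbrakk> \<Longrightarrow> f (x \<oplus> y) = f x \<oplus> f y"
    "x \<in> carrier B \<Longrightarrow> f (c \<odot> x) = c \<odot> f x"
  using assms by (auto simp: bounded_operators_def PiE_def)

lemma bounded_operators_bound: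
  assumes "f \<in> bounded_operators B"
  shows "\<exists>k\<ge>0. \<forall>x\<in>carrier B. nrm B (f x) \<le> k * nrm B x"
proof -
  obtain k where k: "\<And>x. x \<in> carrier B \<Longrightarrow> nrm B (f x) \<le> k * nrm B x"
    using assms unfolding bounded_operators_def by blast
  have "nrm B (f x) \<le> max k 0 * nrm B x" if "x \<in> carrier B" for x
    by (rule order_trans[OF k[OF that]]) (use that in \<open>intro mult_right_mono; simp\<close>)
  then show ?thesis by (intro exI[of _ "max k 0"] conjI ballI) auto
qed

lemma bounded_operators_add:
  assumes f: "f \<in> bounded_operators B" and g: "g \<in> bounded_operators B"
  shows "(\<lambda>b\<in>carrier B. f b \<oplus> g b) \<in> bounded_operators B"
proof -
  note F = bounded_operatorsD[OF f] and G = bounded_operatorsD[OF g]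
  obtain k where k: "0 \<le> k" "\<forall>x\<in>carrier B. nrm B (f x) \<le> k * nrm B x"
    using bounded_operators_bound[OF f] by blast
  obtain l where l: "0 \<le> l" "\<forall>x\<in>carrier B. nrm B (g x) \<le> l * nrm B x"
    using bounded_operators_bound[OF g] by blast
  show ?thesis
  proof (rule bounded_operatorsI[where k = "k + l"])
    fix x assume x: "x \<in> carrier B"
    have "nrm B (f x \<oplus> g x) \<le> nrm B (f x) + nrm B (g x)" using F(2) G(2) x by (intro triangle)
    also have "\<dots> \<le> (k + l) * nrm B x" using bspec[OF k(2) x] bspec[OF l(2) x] by (simp add: algebra_simps)
    finally show "nrm B ((\<lambda>b\<in>carrier B. f b \<oplus> g b) x) \<le> (k + l) * nrm B x" using x by simp
  qed (use F(2-) G(2-) in \<open>auto simp: smult_add_right M.a_ac\<close>)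
qed

lemma bounded_operators_smult:
  assumes f: "f \<in> bounded_operators B"
  shows "(\<lambda>b\<in>carrier B. c \<odot> f b) \<in> bounded_operators B"
proof -
  note F = bounded_operatorsD[OF f]
  obtain k where k: "0 \<le> k" "\<forall>x\<in>carrier B. nrm B (f x) \<le> k * nrm B x"
    using bounded_operators_bound[OF f] by blast
  show ?thesis
  proof (rule bounded_operatorsI[where k = "cmod c * k"])
    fix x assume x: "x \<in> carrier B"
    have "nrm B (c \<odot> f x) = cmod c * nrm B (f x)" using F(2) x by (intro homogeneous)
    also have "\<dots> \<le> cmod c * (k * nrm B x)" using bspec[OF k(2) x] by (intro mult_left_mono) auto
    finally show "nrm B ((\<lambda>b\<in>carrier B. c \<odot> f b) x) \<le> cmod c * k * nrm B x" using x by simp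
  qed (use F(2-) in \<open>auto simp: smult_add_right mult.commute\<close>)
qed

lemma double_centralizersI:
  assumes "L \<in> bounded_operators B" "R \<in> bounded_operators B"
    "\<And>a b. \<lbrakk>a \<in> carrier B; b \<in> carrier B\<rbrakk> \<Longrightarrow> L (a \<otimes> b) = L a \<otimes> b"
    "\<And>a b. \<lbrakk>a \<in> carrier B; b \<in> carrier B\<rbrakk> \<Longrightarrow> R (a \<otimes> b) = a \<otimes> R b"
    "\<And>a b. \<lbrakk>a \<in> carrier B; b \<in> carrier B\<rbrakk> \<Longrightarrow> R a \<otimes> b = a \<otimes> L b"
  shows "(L, R) \<in> double_centralizers B"
  using assms unfolding double_centralizers_def by blast

lemma double_centralizersD:
  assumes "x \<in> double_centralizers B"
  shows "fst x \<in> bounded_operators B" "snd x \<in> bounded_operators B"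
    "\<lbrakk>a \<in> carrier B; b \<in> carrier B\<rbrakk> \<Longrightarrow> fst x (a \<otimes> b) = fst x a \<otimes> b"
    "\<lbrakk>a \<in> carrier B; b \<in> carrier B\<rbrakk> \<Longrightarrow> snd x (a \<otimes> b) = a \<otimes> snd x b"
    "\<lbrakk>a \<in> carrier B; b \<in> carrier B\<rbrakk> \<Longrightarrow> snd x a \<otimes> b = a \<otimes> fst x b"
  using assms unfolding double_centralizers_def by auto

lemma double_centralizers_closed:
  assumes x: "x \<in> double_centralizers B" and a: "a \<in> carrier B"
  shows "fst x a \<in> carrier B" "snd x a \<in> carrier B"
  using bounded_operatorsD(2)[OF double_centralizersD(1)[OF x] a]
    bounded_operatorsD(2)[OF double_centralizersD(2)[OF x] a] by auto

lemma multiplier_carrier: "carrier M = double_centralizers B"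
  by (simp add: cstar_multiplier_algebra_def)

lemma multiplier_add:
  "x \<oplus>\<^bsub>M\<^esub> y = (\<lambda>b\<in>carrier B. fst x b \<oplus> fst y b, \<lambda>b\<in>carrier B. snd x b \<oplus> snd y b)"
  by (simp add: cstar_multiplier_algebra_def case_prod_beta)

lemma multiplier_smult:
  "c \<odot>\<^bsub>M\<^esub> x = (\<lambda>b\<in>carrier B. c \<odot> fst x b, \<lambda>b\<in>carrier B. c \<odot> snd x b)"
  by (simp add: cstar_multiplier_algebra_def case_prod_beta)

lemma multiplier_zero: "\<zero>\<^bsub>M\<^esub> = (\<lambda>b\<in>carrier B. \<zero>, \<lambda>b\<in>carrier B. \<zero>)"
  by (simp add: cstar_multiplier_algebra_def)

lemma double_centralizers_eqI:
  assumes x: "x \<in> double_centralizers B" and y: "y \<in> double_centralizers B"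
    and eq: "\<And>b. b \<in> carrier B \<Longrightarrow> fst x b = fst y b \<and> snd x b = snd y b"
  shows "x = y"
proof (rule prod_eqI)
  show "fst x = fst y"
    by (rule extensionalityI[OF bounded_operatorsD(1)[OF double_centralizersD(1)[OF x]]
          bounded_operatorsD(1)[OF double_centralizersD(1)[OF y]]]) (simp add: eq)
  show "snd x = snd y"
    by (rule extensionalityI[OF bounded_operatorsD(1)[OF double_centralizersD(2)[OF x]]
          bounded_operatorsD(1)[OF double_centralizersD(2)[OF y]]]) (simp add: eq)
qed

lemma multiplier_add_closed:
  assumes x: "x \<in> double_centralizers B" and y: "y \<in> double_centralizers B"
  shows "x \<oplus>\<^bsub>M\<^esub> y \<in> double_centralizers B"
  unfolding multiplier_add
  by (rule double_centralizersI)
    (use bounded_operators_add[OF double_centralizersD(1)[OF x] double_centralizersD(1)[OF y]]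
      bounded_operators_add[OF double_centralizersD(2)[OF x] double_centralizersD(2)[OF y]]
      double_centralizersD(3-)[OF x] double_centralizersD(3-)[OF y]
      double_centralizers_closed[OF x] double_centralizers_closed[OF y]
      in \<open>auto simp: l_distr r_distr\<close>)

lemma multiplier_smult_closed:
  assumes x: "x \<in> double_centralizers B"
  shows "c \<odot>\<^bsub>M\<^esub> x \<in> double_centralizers B"
  unfolding multiplier_smult
  by (rule double_centralizersI)
    (use bounded_operators_smult[OF double_centralizersD(1)[OF x]]
      bounded_operators_smult[OF double_centralizersD(2)[OF x]]
      double_centralizersD(3-)[OF x] double_centralizers_closed[OF x]
      in \<open>auto simp: smult_mult_left smult_mult_right\<close>)

lemma multiplier_zero_closed: "\<zero>\<^bsub>M\<^esub> \<in> double_centralizers B"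
  unfolding multiplier_zero
  by (intro double_centralizersI bounded_operatorsI[where k = 0]) auto

lemma multiplier_apply [simp]:
  assumes "b \<in> carrier B"
  shows "fst (x \<oplus>\<^bsub>M\<^esub> y) b = fst x b \<oplus> fst y b" "snd (x \<oplus>\<^bsub>M\<^esub> y) b = snd x b \<oplus> snd y b"
    "fst (c \<odot>\<^bsub>M\<^esub> x) b = c \<odot> fst x b" "snd (c \<odot>\<^bsub>M\<^esub> x) b = c \<odot> snd x b"
    "fst \<zero>\<^bsub>M\<^esub> b = \<zero>" "snd \<zero>\<^bsub>M\<^esub> b = \<zero>"
  using assms by (simp_all add: multiplier_add multiplier_smult multiplier_zero)

text \<open>Double centralizers are extensional and hence determined by their values on
  \<open>B\<close>, so the laws are checked pointwise there.\<close>

lemma complex_module_multiplier: "complex_module M"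
proof (rule complex_module.intro, rule moduleI)
  show "cring complex_field" by (rule cring_complex_field)
  note closed = multiplier_add_closed multiplier_smult_closed multiplier_zero_closed
  note eqI = double_centralizers_eqI[OF _ _ conjI]
  show "abelian_group M"
  proof (rule abelian_groupI, unfold multiplier_carrier)
    fix x assume x: "x \<in> double_centralizers B"
    note cl = double_centralizers_closed[OF x]
    have "(- 1) \<odot>\<^bsub>M\<^esub> x \<oplus>\<^bsub>M\<^esub> x = \<zero>\<^bsub>M\<^esub>"
      by (rule eqI; (intro closed x)?) (simp_all add: cl smult_minus_1 M.l_neg)
    then show "\<exists>y\<in>double_centralizers B. y \<oplus>\<^bsub>M\<^esub> x = \<zero>\<^bsub>M\<^esub>"
      by (rule bexI) (rule multiplier_smult_closed[OF x])
    show "\<zero>\<^bsub>M\<^esub> \<oplus>\<^bsub>M\<^esub> x = x"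
      by (rule eqI; (intro closed x)?) (simp_all add: cl)
  next
    fix x y assume x: "x \<in> double_centralizers B" and y: "y \<in> double_centralizers B"
    note cl = double_centralizers_closed[OF x] double_centralizers_closed[OF y]
    show "x \<oplus>\<^bsub>M\<^esub> y = y \<oplus>\<^bsub>M\<^esub> x"
      by (rule eqI; (intro closed x y)?) (simp_all add: cl M.a_comm)
    fix z assume z: "z \<in> double_centralizers B"
    show "x \<oplus>\<^bsub>M\<^esub> y \<oplus>\<^bsub>M\<^esub> z = x \<oplus>\<^bsub>M\<^esub> (y \<oplus>\<^bsub>M\<^esub> z)"
      by (rule eqI; (intro closed x y z)?) (simp_all add: cl double_centralizers_closed[OF z] M.a_assoc)
  qed (rule closed; assumption)+
  fix a b :: complex and x assume "x \<in> carrier M"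
  then have x: "x \<in> double_centralizers B" by (simp add: multiplier_carrier)
  note cl = double_centralizers_closed[OF x]
  show "a \<odot>\<^bsub>M\<^esub> x \<in> carrier M" unfolding multiplier_carrier by (intro closed x)
  show "(a \<oplus>\<^bsub>complex_field\<^esub> b) \<odot>\<^bsub>M\<^esub> x = a \<odot>\<^bsub>M\<^esub> x \<oplus>\<^bsub>M\<^esub> b \<odot>\<^bsub>M\<^esub> x"
    by (rule eqI; (intro closed x)?) (simp_all add: cl smult_add_left)
  show "(a \<otimes>\<^bsub>complex_field\<^esub> b) \<odot>\<^bsub>M\<^esub> x = a \<odot>\<^bsub>M\<^esub> (b \<odot>\<^bsub>M\<^esub> x)"
    by (rule eqI; (intro closed x)?) (simp_all add: cl)
  show "\<one>\<^bsub>complex_field\<^esub> \<odot>\<^bsub>M\<^esub> x = x"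
    by (rule eqI; (intro closed x)?) (simp_all add: cl)
  fix y assume "y \<in> carrier M"
  then have y: "y \<in> double_centralizers B" by (simp add: multiplier_carrier)
  show "a \<odot>\<^bsub>M\<^esub> (x \<oplus>\<^bsub>M\<^esub> y) = a \<odot>\<^bsub>M\<^esub> x \<oplus>\<^bsub>M\<^esub> a \<odot>\<^bsub>M\<^esub> y"
    by (rule eqI; (intro closed x y)?) (simp_all add: cl double_centralizers_closed[OF y] smult_add_right)
qed

definition strict_seminorms :: "(('b \<Rightarrow> 'b) \<times> ('b \<Rightarrow> 'b) \<Rightarrow> real) set" where
  "strict_seminorms = (\<lambda>b x. nrm B (fst x b)) ` carrier B \<union> (\<lambda>b x. nrm B (snd x b)) ` carrier B"

lemma cstar_strict_topology_eq: "cstar_strict_topology B = seminorm_topology M strict_seminorms"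
  by (simp add: cstar_strict_topology_def strict_seminorms_def case_prod_unfold)

lemma strict_seminorm:
  assumes b: "b \<in> carrier B"
  shows "cseminorm M (\<lambda>x. nrm B (fst x b))" "cseminorm M (\<lambda>x. nrm B (snd x b))"
  by (intro cseminorm.intro complex_module_multiplier cseminorm_axioms.intro;
      unfold multiplier_carrier; simp add: b double_centralizers_closed triangle homogeneous)+

lemma strict_seminorms_family: "seminorm_family M strict_seminorms"
proof (intro seminorm_family.intro complex_module_multiplier seminorm_family_axioms.intro)
  show "strict_seminorms \<noteq> {}" unfolding strict_seminorms_def using M.zero_closed by blast
  fix p assume p: "p \<in> strict_seminorms"
  then consider b where "b \<in> carrier B" "p = (\<lambda>x. nrm B (fst x b))"
    | b where "b \<in> carrier B" "p = (\<lambda>x. nrm B (snd x b))"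
    unfolding strict_seminorms_def by blast
  then show "cseminorm M p"
    by cases (simp_all add: strict_seminorm)
qed

end

section \<open>The quotients by kernels of seminorms\<close>

context pro_cstar
begin

text \<open>The coset \<open>a + ker p\<close> as a ball of radius zero; the operations of
  \<open>A_p\<close> are computed on representatives in this form.\<close>

definition coset :: "('b \<Rightarrow> real) \<Rightarrow> 'b \<Rightarrow> 'b set" where
  "coset p a = {x \<in> carrier A. p (x \<ominus> a) = 0}"

abbreviation "Q p \<equiv> seminorm_quotient A p"

lemma r_coset_eq:
  assumes p: "p \<in> S" and a: "a \<in> carrier A"
  shows "seminorm_kernel A p +>\<^bsub>A\<^esub> a = coset p a"
proof
  interpret cstar_seminorm_on A p using p by (rule cont_seminorms_cstar)
  show "seminorm_kernel A p +>\<^bsub>A\<^esub> a \<subseteq> coset p a"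
  proof
    fix x assume "x \<in> seminorm_kernel A p +>\<^bsub>A\<^esub> a"
    then obtain k where k: "k \<in> carrier A" "p k = 0" "x = k \<oplus> a"
      by (auto simp: a_r_coset_def r_coset_def seminorm_kernel_def)
    have "(k \<oplus> a) \<ominus> a = k" using k(1) a by algebra
    then show "x \<in> coset p a" using k a by (simp add: coset_def)
  qed
  show "coset p a \<subseteq> seminorm_kernel A p +>\<^bsub>A\<^esub> a"
  proof
    fix x assume x: "x \<in> coset p a"
    have "x = (x \<ominus> a) \<oplus> a" using x a unfolding coset_def by (elim CollectE conjE) algebra
    then show "x \<in> seminorm_kernel A p +>\<^bsub>A\<^esub> a"
      using x a by (auto simp: coset_def a_r_coset_def r_coset_def seminorm_kernel_def)
  qed
qed

lemma coset_self: "\<lbrakk>p \<in> S; a \<in> carrier A\<rbrakk> \<Longrightarrow> a \<in> coset p a"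
proof -
  assume p: "p \<in> S" and a: "a \<in> carrier A"
  interpret cstar_seminorm_on A p using p by (rule cont_seminorms_cstar)
  show ?thesis using a by (simp add: coset_def a_minus_def M.r_neg)
qed

lemma coset_eq_iff:
  assumes p: "p \<in> S" and a: "a \<in> carrier A" and b: "b \<in> carrier A"
  shows "coset p a = coset p b \<longleftrightarrow> p (a \<ominus> b) = 0"
proof
  interpret cstar_seminorm_on A p using p by (rule cont_seminorms_cstar)
  show "p (a \<ominus> b) = 0" if "coset p a = coset p b"
    using coset_self[OF p a] unfolding that by (simp add: coset_def)
  assume ab: "p (a \<ominus> b) = 0"
  have "p (x \<ominus> b) = 0" if "x \<in> carrier A" "p (x \<ominus> a) = 0" for x
    using triangle_via[OF that(1) a b] ab that nonneg[of "x \<ominus> b"] b by (intro antisym nonneg) auto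
  moreover have "p (x \<ominus> a) = 0" if "x \<in> carrier A" "p (x \<ominus> b) = 0" for x
    using triangle_via[OF that(1) b a] ab that diff_commute[OF a b] a by (intro antisym nonneg) auto
  ultimately show "coset p a = coset p b" by (auto simp: coset_def)
qed

text \<open>Serves the operations of \<open>A_p\<close> that are defined as unions over a coset:
  when \<open>f\<close> respects the kernel, all sets in the union coincide.\<close>

lemma coset_UN:
  assumes p: "p \<in> S" and a: "a \<in> carrier A" and fa: "f a \<in> carrier A"
    and f: "\<And>x. \<lbrakk>x \<in> carrier A; p (x \<ominus> a) = 0\<rbrakk> \<Longrightarrow> f x \<in> carrier A \<and> p (f x \<ominus> f a) = 0"
    and g: "\<And>x. f x \<in> carrier A \<Longrightarrow> g (f x) = coset p (f x)"
  shows "(\<Union>x\<in>coset p a. g (f x)) = coset p (f a)"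
proof -
  have "g (f x) = coset p (f a)" if "x \<in> coset p a" for x
  proof -
    have x: "f x \<in> carrier A" "p (f x \<ominus> f a) = 0" using f that by (auto simp: coset_def)
    then show ?thesis using g[OF x(1)] coset_eq_iff[OF p x(1) fa] by simp
  qed
  then show ?thesis using coset_self[OF p a] by auto
qed

lemma quotient_carrier:
  assumes p: "p \<in> S"
  shows "carrier (Q p) = coset p ` carrier A"
proof -
  have "carrier (Q p) = (\<lambda>a. seminorm_kernel A p +>\<^bsub>A\<^esub> a) ` carrier A"
    by (auto simp: seminorm_quotient_def Let_def FactRing_def A_RCOSETS_def RCOSETS_def a_r_coset_def)
  also have "\<dots> = coset p ` carrier A" using r_coset_eq[OF p] by auto
  finally show ?thesis .
qed

lemma quotient_zero:
  assumes p: "p \<in> S"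
  shows "\<zero>\<^bsub>Q p\<^esub> = coset p \<zero>"
proof -
  have "x \<ominus> \<zero> = x" if "x \<in> carrier A" for x using that by algebra
  then show ?thesis
    by (auto simp: seminorm_quotient_def Let_def FactRing_def coset_def seminorm_kernel_def)
qed

lemma quotient_add:
  assumes p: "p \<in> S" and a: "a \<in> carrier A" and b: "b \<in> carrier A"
  shows "coset p a \<oplus>\<^bsub>Q p\<^esub> coset p b = coset p (a \<oplus> b)"
proof -
  interpret cstar_seminorm_on A p using p by (rule cont_seminorms_cstar)
  have "coset p a \<oplus>\<^bsub>Q p\<^esub> coset p b = {x \<oplus> y | x y. x \<in> coset p a \<and> y \<in> coset p b}"
    by (auto simp: seminorm_quotient_def Let_def FactRing_def set_add_def set_mult_def)
  also have "\<dots> = coset p (a \<oplus> b)"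
  proof (intro equalityI subsetI)
    fix z assume "z \<in> {x \<oplus> y | x y. x \<in> coset p a \<and> y \<in> coset p b}"
    then obtain x y where x: "x \<in> carrier A" "p (x \<ominus> a) = 0" and y: "y \<in> carrier A" "p (y \<ominus> b) = 0"
      and z: "z = x \<oplus> y" by (auto simp: coset_def)
    have "(x \<oplus> y) \<ominus> (a \<oplus> b) = (x \<ominus> a) \<oplus> (y \<ominus> b)" using x(1) y(1) a b by algebra
    then have "p ((x \<oplus> y) \<ominus> (a \<oplus> b)) \<le> 0"
      using triangle[of "x \<ominus> a" "y \<ominus> b"] x y a b by simp
    then have "p ((x \<oplus> y) \<ominus> (a \<oplus> b)) = 0" using x y a b by (intro antisym nonneg) auto
    then show "z \<in> coset p (a \<oplus> b)" using x y z by (simp add: coset_def)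
  next
    fix z assume z: "z \<in> coset p (a \<oplus> b)"
    then have zA: "z \<in> carrier A" "p (z \<ominus> (a \<oplus> b)) = 0" by (auto simp: coset_def)
    have "z = (z \<ominus> b) \<oplus> b" using zA(1) b by algebra
    moreover have "(z \<ominus> b) \<ominus> a = z \<ominus> (a \<oplus> b)" using zA(1) a b by algebra
    then have "z \<ominus> b \<in> coset p a" using zA b by (simp add: coset_def)
    ultimately show "z \<in> {x \<oplus> y | x y. x \<in> coset p a \<and> y \<in> coset p b}"
      using coset_self[OF p b] by blast
  qed
  finally show ?thesis .
qed

lemma quotient_smult:
  assumes p: "p \<in> S" and a: "a \<in> carrier A"
  shows "c \<odot>\<^bsub>Q p\<^esub> coset p a = coset p (c \<odot> a)"
proof -
  interpret cstar_seminorm_on A p using p by (rule cont_seminorms_cstar)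
  have "(\<Union>x\<in>coset p a. seminorm_kernel A p +>\<^bsub>A\<^esub> (c \<odot> x)) = coset p (c \<odot> a)"
    by (rule coset_UN[OF p a]) (use a r_coset_eq[OF p] in \<open>auto simp: smult_diff_right[symmetric] homogeneous\<close>)
  then show ?thesis by (simp add: seminorm_quotient_def Let_def)
qed

lemma quotient_star:
  assumes p: "p \<in> S" and a: "a \<in> carrier A"
  shows "star (Q p) (coset p a) = coset p (star A a)"
proof -
  interpret cstar_seminorm_on A p using p by (rule cont_seminorms_cstar)
  have "(\<Union>x\<in>coset p a. seminorm_kernel A p +>\<^bsub>A\<^esub> star A x) = coset p (star A a)"
    by (rule coset_UN[OF p a]) (use a r_coset_eq[OF p] in \<open>auto simp: star_diff[symmetric]\<close>)
  then show ?thesis by (simp add: seminorm_quotient_def Let_def)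
qed

lemma quotient_mult:
  assumes p: "p \<in> S" and a: "a \<in> carrier A" and b: "b \<in> carrier A"
  shows "coset p a \<otimes>\<^bsub>Q p\<^esub> coset p b = coset p (a \<otimes> b)"
proof -
  interpret cstar_seminorm_on A p using p by (rule cont_seminorms_cstar)
  have "seminorm_kernel A p +>\<^bsub>A\<^esub> (x \<otimes> y) = coset p (a \<otimes> b)"
    if "x \<in> coset p a" "y \<in> coset p b" for x y
  proof -
    have x: "x \<in> carrier A" "p (x \<ominus> a) = 0" and y: "y \<in> carrier A" "p (y \<ominus> b) = 0"
      using that by (auto simp: coset_def)
    have "x \<otimes> y \<ominus> a \<otimes> b = (x \<ominus> a) \<otimes> y \<oplus> a \<otimes> (y \<ominus> b)" using x(1) y(1) a b by algebra
    then have "p (x \<otimes> y \<ominus> a \<otimes> b) \<le> p (x \<ominus> a) * p y + p a * p (y \<ominus> b)"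
      using triangle[of "(x \<ominus> a) \<otimes> y" "a \<otimes> (y \<ominus> b)"] submultiplicative[of "x \<ominus> a" y]
        submultiplicative[of a "y \<ominus> b"] x(1) y(1) a b by simp
    then have "p (x \<otimes> y \<ominus> a \<otimes> b) \<le> 0" using x y by simp
    then have "p (x \<otimes> y \<ominus> a \<otimes> b) = 0" using x y a b by (intro antisym nonneg) auto
    then show ?thesis using r_coset_eq[OF p, of "x \<otimes> y"] coset_eq_iff[OF p, of "x \<otimes> y" "a \<otimes> b"] x y a b by simp
  qed
  then show ?thesis
    using coset_self[OF p a] coset_self[OF p b]
    by (auto simp: seminorm_quotient_def Let_def FactRing_def rcoset_mult_def)
qed

lemma quotient_nrm:
  assumes p: "p \<in> S" and a: "a \<in> carrier A"
  shows "nrm (Q p) (coset p a) = p a"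
proof -
  interpret cstar_seminorm_on A p using p by (rule cont_seminorms_cstar)
  have const: "p x = p a" if "x \<in> coset p a" for x
  proof -
    have x: "x \<in> carrier A" "p (x \<ominus> a) = 0" using that by (auto simp: coset_def)
    then show ?thesis using le_add_diff[OF x(1) a] le_add_diff[OF a x(1)] diff_commute[OF x(1) a] by simp
  qed
  have "p ` coset p a = (\<lambda>_. p a) ` coset p a" by (rule image_cong[OF refl const])
  also have "\<dots> = {p a}" using coset_self[OF p a] by blast
  finally show ?thesis by (simp add: seminorm_quotient_def Let_def)
qed

lemma quotient_proj_coset:
  assumes p: "p \<in> S" and q: "q \<in> S" and le: "\<forall>x\<in>carrier A. q x \<le> p x" and a: "a \<in> carrier A"
  shows "quotient_proj A q (coset p a) = coset q a"
proof -
  interpret q: cstar_seminorm_on A q using q by (rule cont_seminorms_cstar)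
  have "seminorm_kernel A q +>\<^bsub>A\<^esub> x = coset q a" if "x \<in> coset p a" for x
  proof -
    have x: "x \<in> carrier A" "p (x \<ominus> a) = 0" using that by (auto simp: coset_def)
    have "q (x \<ominus> a) \<le> 0" using bspec[OF le, of "x \<ominus> a"] x a by simp
    then have "q (x \<ominus> a) = 0" using x a by (intro antisym q.nonneg) auto
    then show ?thesis using r_coset_eq[OF q x(1)] coset_eq_iff[OF q x(1) a] by simp
  qed
  then show ?thesis unfolding quotient_proj_def using coset_self[OF p a] by auto
qed

lemma quotient_elem:
  assumes "p \<in> S" "X \<in> carrier (Q p)"
  obtains a where "a \<in> carrier A" "X = coset p a"
  using assms by (auto simp: quotient_carrier)

lemma quotient_coset_closed [simp]: "\<lbrakk>p \<in> S; a \<in> carrier A\<rbrakk> \<Longrightarrow> coset p a \<in> carrier (Q p)"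
  by (simp add: quotient_carrier)

lemma quotient_seminormed_star_algebra:
  assumes p: "p \<in> S"
  shows "seminormed_star_algebra (Q p)"
proof -
  interpret cstar_seminorm_on A p using p by (rule cont_seminorms_cstar)
  note simps = quotient_carrier[OF p] quotient_add[OF p] quotient_zero[OF p] quotient_smult[OF p]
    quotient_mult[OF p] quotient_star[OF p] quotient_nrm[OF p]
  have grp: "abelian_group (Q p)"
  proof (rule abelian_groupI)
    fix X assume "X \<in> carrier (Q p)"
    then obtain a where a: "a \<in> carrier A" "X = coset p a" by (rule quotient_elem[OF p])
    show "\<exists>Y\<in>carrier (Q p). Y \<oplus>\<^bsub>Q p\<^esub> X = \<zero>\<^bsub>Q p\<^esub>"
      by (rule bexI[of _ "coset p (\<ominus> a)"]) (use a in \<open>auto simp: simps M.l_neg\<close>)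
  qed (auto simp: simps M.a_ac)
  have mod: "module complex_field (Q p)"
    by (rule moduleI[OF cring_complex_field grp]) (auto simp: simps smult_add_left smult_add_right)
  then have cm: "complex_module (Q p)" by (rule complex_module.intro)
  have "star_algebra (Q p)"
    by (intro star_algebra.intro mod star_algebra_axioms.intro)
      (auto simp: simps m_assoc l_distr r_distr smult_mult_left smult_mult_right star_add star_smult star_mult)
  moreover have "cseminorm (Q p) (nrm (Q p))"
    by (intro cseminorm.intro cm cseminorm_axioms.intro) (auto simp: simps triangle homogeneous)
  ultimately show ?thesis by (rule seminormed_star_algebra.intro)
qed

end


section \<open>Multipliers of a pro-$C^*$-algebra\<close>

context pro_cstar
begin

lemma coset_all_eq:
  assumes a: "a \<in> carrier A" and b: "b \<in> carrier A" and eq: "\<And>p. p \<in> S \<Longrightarrow> coset p a = coset p b"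
  shows "a = b"
proof -
  have "a \<ominus> b = \<zero>"
  proof (rule separating_seminorms)
    fix p assume p: "p \<in> S"
    show "p (a \<ominus> b) = 0" using eq[OF p] coset_eq_iff[OF p a b] by blast
  qed (use a b in simp)
  then show ?thesis using diff_eq_zero_iff[OF a b] by simp
qed

text \<open>Completeness identifies $A$ with the inverse limit of the $A_p$: the cosets of a compatible
  family form a Cauchy filter base.\<close>

lemma compatible_family_lift:
  assumes X: "\<And>p. p \<in> S \<Longrightarrow> X p \<in> carrier (Q p)"
    and compat: "\<And>p q. \<lbrakk>p \<in> S; q \<in> S; \<forall>x\<in>carrier A. q x \<le> p x\<rbrakk> \<Longrightarrow> quotient_proj A q (X p) = X q"
  shows "\<exists>b\<in>carrier A. \<forall>p\<in>S. coset p b = X p"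
proof -
  define F where "F = (INF p\<in>S. principal (X p))"
  \<comment> \<open>A larger seminorm has a smaller kernel, so the cosets shrink along
    \<open>S\<close> and form a filter base.\<close>
  have sub: "X p \<subseteq> X q" if p: "p \<in> S" and q: "q \<in> S" and le: "\<forall>x\<in>carrier A. q x \<le> p x" for p q
  proof -
    interpret q: cstar_seminorm_on A q using q by (rule cont_seminorms_cstar)
    obtain a where a: "a \<in> carrier A" "X p = coset p a" using X[OF p] by (rule quotient_elem[OF p])
    have Xq: "X q = coset q a" using compat[OF p q le] quotient_proj_coset[OF p q le a(1)] a(2) by simp
    show ?thesis
    proof
      fix x assume "x \<in> X p"
      then have x: "x \<in> carrier A" "p (x \<ominus> a) = 0" using a by (auto simp: coset_def)
      have "q (x \<ominus> a) \<le> 0" using bspec[OF le, of "x \<ominus> a"] x a by simp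
      then have "q (x \<ominus> a) = 0" using x a by (intro antisym q.nonneg) auto
      then show "x \<in> X q" using Xq x by (simp add: coset_def)
    qed
  qed
  have F_iff: "eventually P F \<longleftrightarrow> (\<exists>p\<in>S. eventually P (principal (X p)))" for P
    unfolding F_def
  proof (rule eventually_INF_base)
    show "S \<noteq> {}" by (rule nonempty)
    fix p q assume p: "p \<in> S" and q: "q \<in> S"
    obtain r where r: "r \<in> S" "\<forall>x\<in>carrier A. p x \<le> r x \<and> q x \<le> r x"
      using cont_seminorms_directed[OF p q] by blast
    have "X r \<subseteq> X p" "X r \<subseteq> X q" using sub[OF r(1) p] sub[OF r(1) q] r(2) by blast+
    then have "principal (X r) \<le> inf (principal (X p)) (principal (X q))" by simp
    then show "\<exists>x\<in>S. principal (X x) \<le> inf (principal (X p)) (principal (X q))" using r(1) by blast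
  qed
  have XA: "X p \<subseteq> carrier A" "X p \<noteq> {}" if p: "p \<in> S" for p
  proof -
    obtain a where a: "a \<in> carrier A" "X p = coset p a" using X[OF p] by (rule quotient_elem[OF p])
    then show "X p \<subseteq> carrier A" "X p \<noteq> {}" using coset_self[OF p a(1)] by (auto simp: coset_def)
  qed
  have ev: "\<forall>\<^sub>F x in F. x \<in> X p" if "p \<in> S" for p
    unfolding F_iff using that by (intro bexI[of _ p]) (simp_all add: eventually_principal)
  have nb: "F \<noteq> bot"
    unfolding trivial_limit_def F_iff eventually_principal using XA(2) by blast
  have FA: "\<forall>\<^sub>F x in F. x \<in> carrier A"
  proof -
    obtain p where p: "p \<in> S" using nonempty by blast
    show ?thesis using ev[OF p] by (rule eventually_mono) (use XA(1)[OF p] in blast)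
  qed
  have zero: "p (x \<ominus> y) = 0" if p: "p \<in> S" and "x \<in> X p" "y \<in> X p" for p x y
  proof -
    obtain a where a: "a \<in> carrier A" "X p = coset p a" using X[OF p] by (rule quotient_elem[OF p])
    interpret cstar_seminorm_on A p using p by (rule cont_seminorms_cstar)
    have x: "x \<in> carrier A" "p (x \<ominus> a) = 0" and y: "y \<in> carrier A" "p (y \<ominus> a) = 0"
      using that a by (auto simp: coset_def)
    have "p (x \<ominus> y) \<le> 0" using triangle_via[OF x(1) a(1) y(1)] x y diff_commute[OF a(1) y(1)] by simp
    then show ?thesis using x y by (intro antisym nonneg) auto
  qed
  have cauchy: "\<forall>\<^sub>F (x, y) in F \<times>\<^sub>F F. x \<in> carrier A \<and> y \<in> carrier A \<and> p (x \<ominus> y) < e"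
    if p: "p \<in> S" and e: "0 < e" for p e
    unfolding eventually_prod_filter
  proof (rule exI[of _ "\<lambda>x. x \<in> X p"], rule exI[of _ "\<lambda>x. x \<in> X p"], intro conjI allI impI ev p)
    fix x y assume xy: "x \<in> X p" "y \<in> X p"
    then have "x \<in> carrier A" "y \<in> carrier A" using XA(1)[OF p] by auto
    with zero[OF p xy] e show "case (x, y) of (x, y) \<Rightarrow> x \<in> carrier A \<and> y \<in> carrier A \<and> p (x \<ominus> y) < e" by simp
  qed
  have "\<exists>l\<in>carrier A. \<forall>p\<in>S. \<forall>e>0. \<forall>\<^sub>F x in F. p (x \<ominus> l) < e"
    by (rule complete_filter[OF nb FA]) (rule cauchy)
  then obtain l where l: "l \<in> carrier A" "\<forall>p\<in>S. \<forall>e>0. \<forall>\<^sub>F x in F. p (x \<ominus> l) < e" by (elim bexE)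
  \<comment> \<open>Elements of \<open>X p\<close> arbitrarily \<open>p\<close>-close to
    \<open>l\<close> exist, and all of them have \<open>p\<close>-distance 0 from
    \<open>a\<close>.\<close>
  have "coset p l = X p" if p: "p \<in> S" for p
  proof -
    obtain a where a: "a \<in> carrier A" "X p = coset p a" using X[OF p] by (rule quotient_elem[OF p])
    interpret cstar_seminorm_on A p using p by (rule cont_seminorms_cstar)
    have "p (a \<ominus> l) \<le> 0 + e" if e: "0 < e" for e
    proof -
      have "\<forall>\<^sub>F x in F. x \<in> X p \<and> p (x \<ominus> l) < e"
        using ev[OF p] l(2)[rule_format, OF p e] by (rule eventually_conj)
      then obtain x where x: "x \<in> X p" "p (x \<ominus> l) < e" using eventually_happens'[OF nb] by blast
      have xA: "x \<in> carrier A" using x(1) XA(1)[OF p] by blast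
      have "a \<in> X p" using a coset_self[OF p a(1)] by simp
      then have "p (a \<ominus> x) = 0" by (rule zero[OF p _ x(1)])
      then show ?thesis using triangle_via[OF a(1) xA l(1)] x(2) by simp
    qed
    then have "p (a \<ominus> l) \<le> 0" by (rule field_le_epsilon)
    then have "p (a \<ominus> l) = 0" using a l(1) by (intro antisym nonneg) auto
    then show ?thesis using a coset_eq_iff[OF p a(1) l(1)] by simp
  qed
  with l(1) show ?thesis by blast
qed

section \<open>Multipliers as operators on \<open>A\<close>\<close>

abbreviation "MA \<equiv> multiplier_algebra A"

lemma MA_carrier_iff:
  "x \<in> carrier MA \<longleftrightarrow> x \<in> extensional S \<and> (\<forall>p\<in>S. x p \<in> double_centralizers (Q p)) \<and>
    (\<forall>p\<in>S. \<forall>q\<in>S. (\<forall>a\<in>carrier A. q a \<le> p a) \<longrightarrow>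
      (\<forall>a\<in>carrier A. fst (x q) (coset q a) = quotient_proj A q (fst (x p) (coset p a)) \<and>
        snd (x q) (coset q a) = quotient_proj A q (snd (x p) (coset p a))))"
proof -
  have ext: "extension_maps_to (Q p) (quotient_proj A q) (x p) (x q) \<longleftrightarrow>
      (\<forall>a\<in>carrier A. fst (x q) (coset q a) = quotient_proj A q (fst (x p) (coset p a)) \<and>
        snd (x q) (coset q a) = quotient_proj A q (snd (x p) (coset p a)))"
    if "p \<in> S" "q \<in> S" "\<forall>a\<in>carrier A. q a \<le> p a" for p q
    using that by (simp add: extension_maps_to_def quotient_carrier quotient_proj_coset)
  have "x \<in> carrier MA \<longleftrightarrow> x \<in> (\<Pi>\<^sub>E p\<in>S. double_centralizers (Q p)) \<and>
    (\<forall>p\<in>S. \<forall>q\<in>S. (\<forall>a\<in>carrier A. q a \<le> p a) \<longrightarrow> extension_maps_to (Q p) (quotient_proj A q) (x p) (x q))"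
    by (simp add: multiplier_algebra_def Let_def cstar_multiplier_algebra_def)
  also have "\<dots> \<longleftrightarrow> x \<in> (\<Pi>\<^sub>E p\<in>S. double_centralizers (Q p)) \<and>
    (\<forall>p\<in>S. \<forall>q\<in>S. (\<forall>a\<in>carrier A. q a \<le> p a) \<longrightarrow>
      (\<forall>a\<in>carrier A. fst (x q) (coset q a) = quotient_proj A q (fst (x p) (coset p a)) \<and>
        snd (x q) (coset q a) = quotient_proj A q (snd (x p) (coset p a))))"
    using ext by (intro conj_cong refl ball_cong imp_cong)
  finally show ?thesis by (auto simp: PiE_iff)
qed

lemma MA_ops:
  "x \<oplus>\<^bsub>MA\<^esub> y = (\<lambda>p\<in>S. x p \<oplus>\<^bsub>quotient_multipliers A p\<^esub> y p)"
  "c \<odot>\<^bsub>MA\<^esub> x = (\<lambda>p\<in>S. c \<odot>\<^bsub>quotient_multipliers A p\<^esub> x p)"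
  "\<zero>\<^bsub>MA\<^esub> = (\<lambda>p\<in>S. \<zero>\<^bsub>quotient_multipliers A p\<^esub>)"
  by (simp_all add: multiplier_algebra_def Let_def)

lemma MA_component: "\<lbrakk>x \<in> carrier MA; p \<in> S\<rbrakk> \<Longrightarrow> x p \<in> double_centralizers (Q p)"
  unfolding MA_carrier_iff by blast

lemma MA_compatible:
  assumes "x \<in> carrier MA" "p \<in> S" "q \<in> S" "\<forall>a\<in>carrier A. q a \<le> p a" "a \<in> carrier A"
  shows "quotient_proj A q (fst (x p) (coset p a)) = fst (x q) (coset q a)"
    "quotient_proj A q (snd (x p) (coset p a)) = snd (x q) (coset q a)"
proof -
  have "\<forall>a\<in>carrier A. fst (x q) (coset q a) = quotient_proj A q (fst (x p) (coset p a)) \<and>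
        snd (x q) (coset q a) = quotient_proj A q (snd (x p) (coset p a))"
    using assms(1)[unfolded MA_carrier_iff, THEN conjunct2, THEN conjunct2, rule_format, OF assms(2,3)] assms(4)
    by blast
  from bspec[OF this assms(5)]
  show "quotient_proj A q (fst (x p) (coset p a)) = fst (x q) (coset q a)"
    "quotient_proj A q (snd (x p) (coset p a)) = snd (x q) (coset q a)" by simp_all
qed

text \<open>A multiplier takes the family of cosets of \<open>a\<close> to a compatible family,
  which comes from an element of \<open>A\<close>. In this way \<open>M(A)\<close> acts on
  \<open>A\<close> itself.\<close>

lemma MA_left_right_exist:
  assumes x: "x \<in> carrier MA" and a: "a \<in> carrier A"
  shows "\<exists>b\<in>carrier A. \<forall>p\<in>S. coset p b = fst (x p) (coset p a)"
    and "\<exists>b\<in>carrier A. \<forall>p\<in>S. coset p b = snd (x p) (coset p a)"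
proof -
  have cl: "fst (x p) (coset p a) \<in> carrier (Q p)" "snd (x p) (coset p a) \<in> carrier (Q p)" if p: "p \<in> S" for p
  proof -
    interpret B: seminormed_star_algebra "Q p" using p by (rule quotient_seminormed_star_algebra)
    show "fst (x p) (coset p a) \<in> carrier (Q p)" "snd (x p) (coset p a) \<in> carrier (Q p)"
      by (rule B.double_centralizers_closed[OF MA_component[OF x p] quotient_coset_closed[OF p a]])+
  qed
  show "\<exists>b\<in>carrier A. \<forall>p\<in>S. coset p b = fst (x p) (coset p a)"
  proof (rule compatible_family_lift)
    fix p q assume pq: "p \<in> S" "q \<in> S" "\<forall>a\<in>carrier A. q a \<le> p a"
    show "quotient_proj A q (fst (x p) (coset p a)) = fst (x q) (coset q a)"
      by (rule MA_compatible[OF x pq a])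
  qed (rule cl)
  show "\<exists>b\<in>carrier A. \<forall>p\<in>S. coset p b = snd (x p) (coset p a)"
  proof (rule compatible_family_lift)
    fix p q assume pq: "p \<in> S" "q \<in> S" "\<forall>a\<in>carrier A. q a \<le> p a"
    show "quotient_proj A q (snd (x p) (coset p a)) = snd (x q) (coset q a)"
      by (rule MA_compatible[OF x pq a])
  qed (rule cl)
qed

text \<open>\<open>lm x a\<close> and \<open>rm x a\<close> are the products $xa$ and $ax$ in $A$.\<close>

definition lm :: "'b multiplier \<Rightarrow> 'b \<Rightarrow> 'b" where
  "lm x a = (SOME b. b \<in> carrier A \<and> (\<forall>p\<in>S. coset p b = fst (x p) (coset p a)))"

definition rm :: "'b multiplier \<Rightarrow> 'b \<Rightarrow> 'b" where
  "rm x a = (SOME b. b \<in> carrier A \<and> (\<forall>p\<in>S. coset p b = snd (x p) (coset p a)))"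

lemma lm_rm:
  assumes "x \<in> carrier MA" "a \<in> carrier A"
  shows "lm x a \<in> carrier A" "p \<in> S \<Longrightarrow> coset p (lm x a) = fst (x p) (coset p a)"
    "rm x a \<in> carrier A" "p \<in> S \<Longrightarrow> coset p (rm x a) = snd (x p) (coset p a)"
proof -
  have 1: "lm x a \<in> carrier A \<and> (\<forall>p\<in>S. coset p (lm x a) = fst (x p) (coset p a))"
    unfolding lm_def using MA_left_right_exist(1)[OF assms] unfolding Bex_def by (rule someI_ex)
  have 2: "rm x a \<in> carrier A \<and> (\<forall>p\<in>S. coset p (rm x a) = snd (x p) (coset p a))"
    unfolding rm_def using MA_left_right_exist(2)[OF assms] unfolding Bex_def by (rule someI_ex)
  show "lm x a \<in> carrier A" "rm x a \<in> carrier A" by (rule 1[THEN conjunct1], rule 2[THEN conjunct1])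
  show "coset p (lm x a) = fst (x p) (coset p a)" if "p \<in> S" using 1[THEN conjunct2] that by (rule bspec)
  show "coset p (rm x a) = snd (x p) (coset p a)" if "p \<in> S" using 2[THEN conjunct2] that by (rule bspec)
qed

lemma lm_eqI:
  assumes "x \<in> carrier MA" "a \<in> carrier A" "b \<in> carrier A"
    and "\<And>p. p \<in> S \<Longrightarrow> fst (x p) (coset p a) = coset p b"
  shows "lm x a = b"
proof (rule coset_all_eq[OF lm_rm(1)[OF assms(1,2)] assms(3)])
  fix p assume p: "p \<in> S"
  show "coset p (lm x a) = coset p b" unfolding lm_rm(2)[OF assms(1,2) p] by (rule assms(4)[OF p])
qed

lemma rm_eqI:
  assumes "x \<in> carrier MA" "a \<in> carrier A" "b \<in> carrier A"
    and "\<And>p. p \<in> S \<Longrightarrow> snd (x p) (coset p a) = coset p b"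
  shows "rm x a = b"
proof (rule coset_all_eq[OF lm_rm(3)[OF assms(1,2)] assms(3)])
  fix p assume p: "p \<in> S"
  show "coset p (rm x a) = coset p b" unfolding lm_rm(4)[OF assms(1,2) p] by (rule assms(4)[OF p])
qed

lemma lm_rm_mult:
  assumes x: "x \<in> carrier MA" and a: "a \<in> carrier A" and b: "b \<in> carrier A"
  shows "lm x (a \<otimes> b) = lm x a \<otimes> b" "rm x (a \<otimes> b) = a \<otimes> rm x b" "rm x a \<otimes> b = a \<otimes> lm x b"
proof -
  note cl = a b lm_rm(1,3)[OF x a] lm_rm(1,3)[OF x b]
  have *: "fst (x p) (coset p (a \<otimes> b)) = coset p (lm x a \<otimes> b)"
      "snd (x p) (coset p (a \<otimes> b)) = coset p (a \<otimes> rm x b)"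
      "coset p (rm x a \<otimes> b) = coset p (a \<otimes> lm x b)" if p: "p \<in> S" for p
  proof -
    interpret B: seminormed_star_algebra "Q p" using p by (rule quotient_seminormed_star_algebra)
    have ca: "coset p a \<in> carrier (Q p)" "coset p b \<in> carrier (Q p)" using p a b by auto
    note dc = B.double_centralizersD(3-5)[OF MA_component[OF x p] ca]
    show "fst (x p) (coset p (a \<otimes> b)) = coset p (lm x a \<otimes> b)"
      using dc(1) cl by (simp add: quotient_mult[OF p, symmetric] lm_rm(2)[OF x a p])
    show "snd (x p) (coset p (a \<otimes> b)) = coset p (a \<otimes> rm x b)"
      using dc(2) cl by (simp add: quotient_mult[OF p, symmetric] lm_rm(4)[OF x b p])
    show "coset p (rm x a \<otimes> b) = coset p (a \<otimes> lm x b)"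
      using dc(3) cl by (simp add: quotient_mult[OF p, symmetric] lm_rm(4)[OF x a p] lm_rm(2)[OF x b p])
  qed
  show "lm x (a \<otimes> b) = lm x a \<otimes> b" by (rule lm_eqI[OF x]; (rule *)?) (use cl in simp_all)
  show "rm x (a \<otimes> b) = a \<otimes> rm x b" by (rule rm_eqI[OF x]; (rule *)?) (use cl in simp_all)
  show "rm x a \<otimes> b = a \<otimes> lm x b" by (rule coset_all_eq; (rule *)?) (use cl in simp_all)
qed

lemma lm_add_right:
  assumes x: "x \<in> carrier MA" and a: "a \<in> carrier A" and b: "b \<in> carrier A"
  shows "lm x (a \<oplus> b) = lm x a \<oplus> lm x b"
proof (rule lm_eqI)
  fix p assume p: "p \<in> S"
  interpret B: seminormed_star_algebra "Q p" using p by (rule quotient_seminormed_star_algebra)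
  have ca: "coset p a \<in> carrier (Q p)" "coset p b \<in> carrier (Q p)" using p a b by auto
  show "fst (x p) (coset p (a \<oplus> b)) = coset p (lm x a \<oplus> lm x b)"
    using B.bounded_operatorsD(3)[OF B.double_centralizersD(1)[OF MA_component[OF x p]] ca]
      lm_rm(1)[OF x a] lm_rm(1)[OF x b] a b
    by (simp add: quotient_add[OF p, symmetric] lm_rm(2)[OF x a p] lm_rm(2)[OF x b p])
qed (use x a b lm_rm(1)[OF x a] lm_rm(1)[OF x b] in simp_all)

lemma lm_smult_right:
  assumes x: "x \<in> carrier MA" and a: "a \<in> carrier A"
  shows "lm x (c \<odot> a) = c \<odot> lm x a"
proof (rule lm_eqI)
  fix p assume p: "p \<in> S"
  interpret B: seminormed_star_algebra "Q p" using p by (rule quotient_seminormed_star_algebra)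
  have ca: "coset p a \<in> carrier (Q p)" using p a by auto
  show "fst (x p) (coset p (c \<odot> a)) = coset p (c \<odot> lm x a)"
    using B.bounded_operatorsD(4)[OF B.double_centralizersD(1)[OF MA_component[OF x p]] ca]
      lm_rm(1)[OF x a] a by (simp add: quotient_smult[OF p, symmetric] lm_rm(2)[OF x a p])
qed (use x a lm_rm(1)[OF x a] in simp_all)

lemma lm_diff_right:
  assumes x: "x \<in> carrier MA" and a: "a \<in> carrier A" and b: "b \<in> carrier A"
  shows "lm x (a \<ominus> b) = lm x a \<ominus> lm x b"
  using lm_add_right[OF x a, of "\<ominus> b"] lm_smult_right[OF x b, of "- 1"] b lm_rm(1)[OF x b]
  by (simp add: a_minus_def smult_minus_1)

lemma lm_bound:
  assumes x: "x \<in> carrier MA" and p: "p \<in> S"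
  shows "\<exists>k\<ge>0. \<forall>a\<in>carrier A. p (lm x a) \<le> k * p a"
proof -
  interpret B: seminormed_star_algebra "Q p" using p by (rule quotient_seminormed_star_algebra)
  obtain k where k: "0 \<le> k" "\<forall>X\<in>carrier (Q p). nrm (Q p) (fst (x p) X) \<le> k * nrm (Q p) X"
    using B.bounded_operators_bound[OF B.double_centralizersD(1)[OF MA_component[OF x p]]] by blast
  have "p (lm x a) \<le> k * p a" if a: "a \<in> carrier A" for a
    using bspec[OF k(2) quotient_coset_closed[OF p a]]
    unfolding lm_rm(2)[OF x a p, symmetric] quotient_nrm[OF p a] quotient_nrm[OF p lm_rm(1)[OF x a]] .
  with k(1) show ?thesis by blast
qed

text \<open>Compatibility of the components is automatic when their action on cosets is induced by
  maps of \<open>A\<close>. Sums, multiples, zero and the embedding are all treated through this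
  rule.\<close>

lemma MA_closedI:
  assumes ext: "x \<in> extensional S" and dc: "\<And>p. p \<in> S \<Longrightarrow> x p \<in> double_centralizers (Q p)"
    and l: "\<And>a. a \<in> carrier A \<Longrightarrow> l a \<in> carrier A" "\<And>p a. \<lbrakk>p \<in> S; a \<in> carrier A\<rbrakk> \<Longrightarrow> fst (x p) (coset p a) = coset p (l a)"
    and r: "\<And>a. a \<in> carrier A \<Longrightarrow> r a \<in> carrier A" "\<And>p a. \<lbrakk>p \<in> S; a \<in> carrier A\<rbrakk> \<Longrightarrow> snd (x p) (coset p a) = coset p (r a)"
  shows "x \<in> carrier MA" "a \<in> carrier A \<Longrightarrow> lm x a = l a" "a \<in> carrier A \<Longrightarrow> rm x a = r a"
proof -
  show x: "x \<in> carrier MA"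
    unfolding MA_carrier_iff
  proof (intro conjI ballI impI ext dc)
    fix p q a assume p: "p \<in> S" and q: "q \<in> S" and le: "\<forall>a\<in>carrier A. q a \<le> p a" and a: "a \<in> carrier A"
    show "fst (x q) (coset q a) = quotient_proj A q (fst (x p) (coset p a))"
      unfolding l(2)[OF p a] l(2)[OF q a] by (rule quotient_proj_coset[OF p q le l(1)[OF a], symmetric])
    show "snd (x q) (coset q a) = quotient_proj A q (snd (x p) (coset p a))"
      unfolding r(2)[OF p a] r(2)[OF q a] by (rule quotient_proj_coset[OF p q le r(1)[OF a], symmetric])
  qed
  show "lm x a = l a" if "a \<in> carrier A" by (rule lm_eqI[OF x that l(1)[OF that]]) (rule l(2)[OF _ that])
  show "rm x a = r a" if "a \<in> carrier A" by (rule rm_eqI[OF x that r(1)[OF that]]) (rule r(2)[OF _ that])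
qed

lemma MA_add:
  assumes x: "x \<in> carrier MA" and y: "y \<in> carrier MA"
  shows "x \<oplus>\<^bsub>MA\<^esub> y \<in> carrier MA"
    "a \<in> carrier A \<Longrightarrow> lm (x \<oplus>\<^bsub>MA\<^esub> y) a = lm x a \<oplus> lm y a"
    "a \<in> carrier A \<Longrightarrow> rm (x \<oplus>\<^bsub>MA\<^esub> y) a = rm x a \<oplus> rm y a"
proof -
  have 1: "(x \<oplus>\<^bsub>MA\<^esub> y) p \<in> double_centralizers (Q p)" if p: "p \<in> S" for p
  proof -
    interpret B: seminormed_star_algebra "Q p" using p by (rule quotient_seminormed_star_algebra)
    show ?thesis using B.multiplier_add_closed[OF MA_component[OF x p] MA_component[OF y p]] p
      by (simp add: MA_ops)
  qed
  have 2: "fst ((x \<oplus>\<^bsub>MA\<^esub> y) p) (coset p a) = coset p (lm x a \<oplus> lm y a)"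
    "snd ((x \<oplus>\<^bsub>MA\<^esub> y) p) (coset p a) = coset p (rm x a \<oplus> rm y a)"
    if p: "p \<in> S" and a: "a \<in> carrier A" for p a
  proof -
    interpret B: seminormed_star_algebra "Q p" using p by (rule quotient_seminormed_star_algebra)
    note lr = lm_rm(1,3)[OF x a] lm_rm(1,3)[OF y a]
    have ca: "coset p a \<in> carrier (Q p)" using p a by simp
    show "fst ((x \<oplus>\<^bsub>MA\<^esub> y) p) (coset p a) = coset p (lm x a \<oplus> lm y a)"
      "snd ((x \<oplus>\<^bsub>MA\<^esub> y) p) (coset p a) = coset p (rm x a \<oplus> rm y a)"
      using p a lr ca
      by (simp_all add: MA_ops quotient_add[OF p, symmetric] lm_rm(2,4)[OF x a p] lm_rm(2,4)[OF y a p])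
  qed
  have ext: "x \<oplus>\<^bsub>MA\<^esub> y \<in> extensional S" by (simp add: MA_ops)
  have cl: "lm x a \<oplus> lm y a \<in> carrier A" "rm x a \<oplus> rm y a \<in> carrier A" if a: "a \<in> carrier A" for a
    using lm_rm(1,3)[OF x a] lm_rm(1,3)[OF y a] by auto
  note MA_closedI[of "x \<oplus>\<^bsub>MA\<^esub> y" "\<lambda>a. lm x a \<oplus> lm y a" "\<lambda>a. rm x a \<oplus> rm y a", OF ext 1 cl(1) 2(1) cl(2) 2(2)]
  then show "x \<oplus>\<^bsub>MA\<^esub> y \<in> carrier MA"
    "a \<in> carrier A \<Longrightarrow> lm (x \<oplus>\<^bsub>MA\<^esub> y) a = lm x a \<oplus> lm y a"
    "a \<in> carrier A \<Longrightarrow> rm (x \<oplus>\<^bsub>MA\<^esub> y) a = rm x a \<oplus> rm y a" by blast+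
qed

lemma MA_smult:
  assumes x: "x \<in> carrier MA"
  shows "c \<odot>\<^bsub>MA\<^esub> x \<in> carrier MA"
    "a \<in> carrier A \<Longrightarrow> lm (c \<odot>\<^bsub>MA\<^esub> x) a = c \<odot> lm x a"
    "a \<in> carrier A \<Longrightarrow> rm (c \<odot>\<^bsub>MA\<^esub> x) a = c \<odot> rm x a"
proof -
  have 1: "(c \<odot>\<^bsub>MA\<^esub> x) p \<in> double_centralizers (Q p)" if p: "p \<in> S" for p
  proof -
    interpret B: seminormed_star_algebra "Q p" using p by (rule quotient_seminormed_star_algebra)
    show ?thesis using B.multiplier_smult_closed[OF MA_component[OF x p]] p by (simp add: MA_ops)
  qed
  have 2: "fst ((c \<odot>\<^bsub>MA\<^esub> x) p) (coset p a) = coset p (c \<odot> lm x a)"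
    "snd ((c \<odot>\<^bsub>MA\<^esub> x) p) (coset p a) = coset p (c \<odot> rm x a)"
    if p: "p \<in> S" and a: "a \<in> carrier A" for p a
  proof -
    interpret B: seminormed_star_algebra "Q p" using p by (rule quotient_seminormed_star_algebra)
    show "fst ((c \<odot>\<^bsub>MA\<^esub> x) p) (coset p a) = coset p (c \<odot> lm x a)"
      "snd ((c \<odot>\<^bsub>MA\<^esub> x) p) (coset p a) = coset p (c \<odot> rm x a)"
      using p a lm_rm(1,3)[OF x a] by (simp_all add: MA_ops quotient_smult[OF p, symmetric] lm_rm(2,4)[OF x a p])
  qed
  have ext: "c \<odot>\<^bsub>MA\<^esub> x \<in> extensional S" by (simp add: MA_ops)
  have cl: "c \<odot> lm x a \<in> carrier A" "c \<odot> rm x a \<in> carrier A" if a: "a \<in> carrier A" for a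
    using lm_rm(1,3)[OF x a] by auto
  note MA_closedI[of "c \<odot>\<^bsub>MA\<^esub> x" "\<lambda>a. c \<odot> lm x a" "\<lambda>a. c \<odot> rm x a", OF ext 1 cl(1) 2(1) cl(2) 2(2)]
  then show "c \<odot>\<^bsub>MA\<^esub> x \<in> carrier MA"
    "a \<in> carrier A \<Longrightarrow> lm (c \<odot>\<^bsub>MA\<^esub> x) a = c \<odot> lm x a"
    "a \<in> carrier A \<Longrightarrow> rm (c \<odot>\<^bsub>MA\<^esub> x) a = c \<odot> rm x a" by blast+
qed

text \<open>The canonical inclusion of \<open>A\<close> in \<open>M(A)\<close>.\<close>

definition embed :: "'b \<Rightarrow> 'b multiplier" where
  "embed c = (\<lambda>p\<in>S. (\<lambda>X\<in>carrier (Q p). coset p c \<otimes>\<^bsub>Q p\<^esub> X, \<lambda>X\<in>carrier (Q p). X \<otimes>\<^bsub>Q p\<^esub> coset p c))"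

lemma embed:
  assumes c: "c \<in> carrier A"
  shows "embed c \<in> carrier MA" "a \<in> carrier A \<Longrightarrow> lm (embed c) a = c \<otimes> a"
    "a \<in> carrier A \<Longrightarrow> rm (embed c) a = a \<otimes> c"
proof -
  have 1: "embed c p \<in> double_centralizers (Q p)" if p: "p \<in> S" for p
  proof -
    interpret B: seminormed_star_algebra "Q p" using p by (rule quotient_seminormed_star_algebra)
    interpret cstar_seminorm_on A p using p by (rule cont_seminorms_cstar)
    have cc: "coset p c \<in> carrier (Q p)" using p c by auto
    have bound: "nrm (Q p) (coset p c \<otimes>\<^bsub>Q p\<^esub> X) \<le> p c * nrm (Q p) X \<and>
        nrm (Q p) (X \<otimes>\<^bsub>Q p\<^esub> coset p c) \<le> p c * nrm (Q p) X" if X: "X \<in> carrier (Q p)" for X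
    proof -
      obtain a where a: "a \<in> carrier A" "X = coset p a" using X by (rule quotient_elem[OF p])
      show ?thesis
        using submultiplicative[OF a(1) c] submultiplicative[OF c a(1)] a c
        by (simp add: quotient_mult[OF p] quotient_nrm[OF p] mult.commute)
    qed
    have "(\<lambda>X\<in>carrier (Q p). coset p c \<otimes>\<^bsub>Q p\<^esub> X) \<in> bounded_operators (Q p)"
      by (rule B.bounded_operatorsI[where k = "p c"])
        (use cc bound in \<open>simp_all add: B.r_distr B.smult_mult_right\<close>)
    moreover have "(\<lambda>X\<in>carrier (Q p). X \<otimes>\<^bsub>Q p\<^esub> coset p c) \<in> bounded_operators (Q p)"
      by (rule B.bounded_operatorsI[where k = "p c"])
        (use cc bound in \<open>simp_all add: B.l_distr B.smult_mult_left\<close>)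
    ultimately have "(\<lambda>X\<in>carrier (Q p). coset p c \<otimes>\<^bsub>Q p\<^esub> X, \<lambda>X\<in>carrier (Q p). X \<otimes>\<^bsub>Q p\<^esub> coset p c)
        \<in> double_centralizers (Q p)"
      by (rule B.double_centralizersI) (use cc in \<open>simp_all add: B.m_assoc\<close>)
    then show ?thesis using p by (simp add: embed_def)
  qed
  have 2: "fst (embed c p) (coset p a) = coset p (c \<otimes> a)" "snd (embed c p) (coset p a) = coset p (a \<otimes> c)"
    if p: "p \<in> S" and a: "a \<in> carrier A" for p a
    using p a c by (simp_all add: embed_def quotient_mult)
  have ext: "embed c \<in> extensional S" by (simp add: embed_def)
  have cl: "c \<otimes> a \<in> carrier A" "a \<otimes> c \<in> carrier A" if a: "a \<in> carrier A" for a
    using a c by auto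
  note MA_closedI[of "embed c" "\<lambda>a. c \<otimes> a" "\<lambda>a. a \<otimes> c", OF ext 1 cl(1) 2(1) cl(2) 2(2)]
  then show "embed c \<in> carrier MA" "a \<in> carrier A \<Longrightarrow> lm (embed c) a = c \<otimes> a"
    "a \<in> carrier A \<Longrightarrow> rm (embed c) a = a \<otimes> c" by blast+
qed

text \<open>Every element of \<open>A_p\<close> is the coset of an element of \<open>A\<close>, so
  the two actions on \<open>A\<close> determine a multiplier. The vector space laws of
  \<open>M(A)\<close> thereby reduce to those of \<open>A\<close>.\<close>

lemma MA_eqI:
  assumes x: "x \<in> carrier MA" and y: "y \<in> carrier MA"
    and eq: "\<And>a. a \<in> carrier A \<Longrightarrow> lm x a = lm y a" "\<And>a. a \<in> carrier A \<Longrightarrow> rm x a = rm y a"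
  shows "x = y"
proof (rule extensionalityI[of _ S])
  show "x \<in> extensional S" "y \<in> extensional S" using x y by (simp_all add: MA_carrier_iff)
  fix p assume p: "p \<in> S"
  interpret B: seminormed_star_algebra "Q p" using p by (rule quotient_seminormed_star_algebra)
  show "x p = y p"
  proof (rule B.double_centralizers_eqI[OF MA_component[OF x p] MA_component[OF y p]])
    fix X assume "X \<in> carrier (Q p)"
    then obtain a where a: "a \<in> carrier A" "X = coset p a" by (rule quotient_elem[OF p])
    show "fst (x p) X = fst (y p) X \<and> snd (x p) X = snd (y p) X"
      using lm_rm[OF x a(1)] lm_rm[OF y a(1)] eq[OF a(1)] p unfolding a(2) by metis
  qed
qed

lemma MA_zero:
  "\<zero>\<^bsub>MA\<^esub> \<in> carrier MA" "a \<in> carrier A \<Longrightarrow> lm \<zero>\<^bsub>MA\<^esub> a = \<zero>" "a \<in> carrier A \<Longrightarrow> rm \<zero>\<^bsub>MA\<^esub> a = \<zero>"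
proof -
  have 1: "\<zero>\<^bsub>MA\<^esub> p \<in> double_centralizers (Q p)" if p: "p \<in> S" for p
  proof -
    interpret B: seminormed_star_algebra "Q p" using p by (rule quotient_seminormed_star_algebra)
    show ?thesis using B.multiplier_zero_closed p by (simp add: MA_ops)
  qed
  have 2: "fst (\<zero>\<^bsub>MA\<^esub> p) (coset p a) = coset p \<zero>" "snd (\<zero>\<^bsub>MA\<^esub> p) (coset p a) = coset p \<zero>"
    if p: "p \<in> S" and a: "a \<in> carrier A" for p a
  proof -
    interpret B: seminormed_star_algebra "Q p" using p by (rule quotient_seminormed_star_algebra)
    show "fst (\<zero>\<^bsub>MA\<^esub> p) (coset p a) = coset p \<zero>" "snd (\<zero>\<^bsub>MA\<^esub> p) (coset p a) = coset p \<zero>"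
      using p a by (simp_all add: MA_ops quotient_zero)
  qed
  have ext: "\<zero>\<^bsub>MA\<^esub> \<in> extensional S" by (simp add: MA_ops)
  note MA_closedI[of "\<zero>\<^bsub>MA\<^esub>" "\<lambda>_. \<zero>" "\<lambda>_. \<zero>", OF ext 1 _ 2(1) _ 2(2)]
  then show "\<zero>\<^bsub>MA\<^esub> \<in> carrier MA" "a \<in> carrier A \<Longrightarrow> lm \<zero>\<^bsub>MA\<^esub> a = \<zero>"
    "a \<in> carrier A \<Longrightarrow> rm \<zero>\<^bsub>MA\<^esub> a = \<zero>" by blast+
qed

lemma complex_module_MA: "complex_module MA"
proof (rule complex_module.intro, rule moduleI)
  show "cring complex_field" by (rule cring_complex_field)
  note closed = MA_add(1) MA_smult(1) MA_zero(1)
  note simps = MA_add(2,3) MA_smult(2,3) MA_zero(2,3) MA_add(1) MA_smult(1) MA_zero(1)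
  show "abelian_group MA"
  proof (rule abelian_groupI)
    fix x assume x: "x \<in> carrier MA"
    have "(- 1) \<odot>\<^bsub>MA\<^esub> x \<oplus>\<^bsub>MA\<^esub> x = \<zero>\<^bsub>MA\<^esub>"
      by (rule MA_eqI; (intro closed x)?) (simp_all add: simps x lm_rm(1,3)[OF x] smult_minus_1 M.l_neg)
    then show "\<exists>y\<in>carrier MA. y \<oplus>\<^bsub>MA\<^esub> x = \<zero>\<^bsub>MA\<^esub>"
      by (rule bexI[of _ "(- 1) \<odot>\<^bsub>MA\<^esub> x", OF _ MA_smult(1)[OF x]])
    show "\<zero>\<^bsub>MA\<^esub> \<oplus>\<^bsub>MA\<^esub> x = x"
      by (rule MA_eqI; (intro closed x)?) (simp_all add: simps x lm_rm(1,3)[OF x])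
  next
    fix x y assume x: "x \<in> carrier MA" and y: "y \<in> carrier MA"
    show "x \<oplus>\<^bsub>MA\<^esub> y = y \<oplus>\<^bsub>MA\<^esub> x"
      by (rule MA_eqI; (intro closed x y)?)
        (simp_all add: simps x y lm_rm(1,3)[OF x] lm_rm(1,3)[OF y] M.a_comm)
    fix z assume z: "z \<in> carrier MA"
    show "x \<oplus>\<^bsub>MA\<^esub> y \<oplus>\<^bsub>MA\<^esub> z = x \<oplus>\<^bsub>MA\<^esub> (y \<oplus>\<^bsub>MA\<^esub> z)"
      by (rule MA_eqI; (intro closed x y z)?)
        (simp_all add: simps x y z lm_rm(1,3)[OF x] lm_rm(1,3)[OF y] lm_rm(1,3)[OF z] M.a_assoc)
  qed (rule closed; assumption)+
  fix a b :: complex and x assume x: "x \<in> carrier MA"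
  note cl = lm_rm(1,3)[OF x]
  show "a \<odot>\<^bsub>MA\<^esub> x \<in> carrier MA" by (intro closed x)
  show "(a \<oplus>\<^bsub>complex_field\<^esub> b) \<odot>\<^bsub>MA\<^esub> x = a \<odot>\<^bsub>MA\<^esub> x \<oplus>\<^bsub>MA\<^esub> b \<odot>\<^bsub>MA\<^esub> x"
    by (rule MA_eqI; (intro closed x)?) (simp_all add: simps x cl smult_add_left)
  show "(a \<otimes>\<^bsub>complex_field\<^esub> b) \<odot>\<^bsub>MA\<^esub> x = a \<odot>\<^bsub>MA\<^esub> (b \<odot>\<^bsub>MA\<^esub> x)"
    by (rule MA_eqI; (intro closed x)?) (simp_all add: simps x cl)
  show "\<one>\<^bsub>complex_field\<^esub> \<odot>\<^bsub>MA\<^esub> x = x"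
    by (rule MA_eqI; (intro closed x)?) (simp_all add: simps x cl)
  fix y assume y: "y \<in> carrier MA"
  show "a \<odot>\<^bsub>MA\<^esub> (x \<oplus>\<^bsub>MA\<^esub> y) = a \<odot>\<^bsub>MA\<^esub> x \<oplus>\<^bsub>MA\<^esub> a \<odot>\<^bsub>MA\<^esub> y"
    by (rule MA_eqI; (intro closed x y)?)
      (simp_all add: simps x y cl lm_rm(1,3)[OF y] smult_add_right)
qed

text \<open>The seminorms taking \<open>x\<close> to \<open>p (x a)\<close> and to
  \<open>p (a x)\<close>; \<open>strict_topology_eq\<close> shows that they generate the limit of
  the strict topologies of the \<open>M(A_p)\<close>.\<close>

definition MA_seminorms :: "('b multiplier \<Rightarrow> real) set" where
  "MA_seminorms = {\<lambda>x. p (lm x a) | p a. p \<in> S \<and> a \<in> carrier A} \<union> {\<lambda>x. p (rm x a) | p a. p \<in> S \<and> a \<in> carrier A}"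

lemma MA_seminorm:
  assumes p: "p \<in> S" and a: "a \<in> carrier A"
  shows "cseminorm MA (\<lambda>x. p (lm x a))" "cseminorm MA (\<lambda>x. p (rm x a))"
proof -
  interpret cstar_seminorm_on A p using p by (rule cont_seminorms_cstar)
  show "cseminorm MA (\<lambda>x. p (lm x a))" "cseminorm MA (\<lambda>x. p (rm x a))"
    by (intro cseminorm.intro complex_module_MA cseminorm_axioms.intro;
        simp add: MA_add MA_smult lm_rm(1,3) a triangle homogeneous)+
qed

sublocale MA: seminorm_family MA MA_seminorms
proof (intro seminorm_family.intro seminorm_family_axioms.intro complex_module_MA)
  show "MA_seminorms \<noteq> {}" unfolding MA_seminorms_def using zero_in_cont_seminorms M.zero_closed by blast
  fix f assume "f \<in> MA_seminorms"
  then show "cseminorm MA f" unfolding MA_seminorms_def using MA_seminorm by blast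
qed

end


section \<open>Locally convex topologies agreeing on bounded sets\<close>

context complex_module
begin

lemma linear_topology_translate:
  assumes T: "linear_topology V T" and x: "x \<in> carrier V"
  shows "continuous_map T T (\<lambda>y. y \<oplus> x)"
proof -
  have "continuous_map T (prod_topology T T) (\<lambda>y. (y, x))"
    using T x by (intro continuous_map_pairedI) (auto simp: linear_topology_def)
  moreover have "continuous_map (prod_topology T T) T (\<lambda>(x, y). x \<oplus> y)"
    using T unfolding linear_topology_def by blast
  ultimately have "continuous_map T T ((\<lambda>(x, y). x \<oplus> y) \<circ> (\<lambda>y. (y, x)))"
    by (rule continuous_map_compose)
  then show ?thesis by (simp add: o_def)
qed

lemma linear_topology_scale:
  assumes T: "linear_topology V T"
  shows "continuous_map T T (\<lambda>y. c \<odot> y)"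
proof -
  have "continuous_map T (prod_topology euclidean T) (\<lambda>y. (c, y))"
    by (intro continuous_map_pairedI) auto
  moreover have "continuous_map (prod_topology euclidean T) T (\<lambda>(c, y). c \<odot> y)"
    using T unfolding linear_topology_def by blast
  ultimately have "continuous_map T T ((\<lambda>(c, y). c \<odot> y) \<circ> (\<lambda>y. (c, y)))"
    by (rule continuous_map_compose)
  then show ?thesis by (simp add: o_def)
qed

text \<open>Local convexity provides a convex neighbourhood \<open>C\<close>. Its balanced core
  \<open>W\<close> is absolutely convex because phases can be moved into the vectors, and it is a
  neighbourhood because scalar multiplication is jointly continuous at
  \<open>(0, 0)\<close>.\<close>

lemma absolutely_convex_nbhd:
  assumes T: "locally_convex V T" and U: "zero_nbhd V T U"
  obtains W where "absolutely_convex V W" "zero_nbhd V T W" "W \<subseteq> U"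
proof -
  have lin: "linear_topology V T" using T by (simp add: locally_convex_def)
  then have top: "topspace T = carrier V" by (simp add: linear_topology_def)
  obtain C where C: "convex_in V C" "zero_nbhd V T C" "C \<subseteq> U"
    using T U unfolding locally_convex_def by blast
  have CV: "C \<subseteq> carrier V" using C by (simp add: convex_in_def)
  have C0: "\<zero> \<in> C"
    using conjunct2[OF C(2)[unfolded zero_nbhd_def]] by (rule subsetD[OF interior_of_subset])
  define W where "W = {x \<in> carrier V. \<forall>c. cmod c \<le> 1 \<longrightarrow> c \<odot> x \<in> C}"
  have sgn_eq': "of_real (cmod z) * sgn z = z" for z :: complex
    by (cases "z = 0") (simp_all add: sgn_eq)
  have conv: "of_real t \<odot> x \<oplus> of_real (1 - t) \<odot> y \<in> C" if "x \<in> C" "y \<in> C" "0 \<le> t" "t \<le> 1" for x y t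
    using C(1) that unfolding convex_in_def by auto
  have "absolutely_convex V W"
    unfolding absolutely_convex_def
  proof (intro conjI ballI allI impI)
    show "W \<subseteq> carrier V" by (auto simp: W_def)
    fix x y a b assume x: "x \<in> W" and y: "y \<in> W" and ab: "cmod a + cmod b \<le> 1"
    have xV: "x \<in> carrier V" "y \<in> carrier V" using x y by (auto simp: W_def)
    have "c \<odot> (a \<odot> x \<oplus> b \<odot> y) \<in> C" if c: "cmod c \<le> 1" for c
    proof -
      \<comment> \<open>The phase of \<open>c * a\<close> is absorbed by the vector, as membership
        in \<open>W\<close> allows. What remains has nonnegative weights \<open>t\<close>,
        \<open>u\<close> with \<open>t + u <= 1\<close>: a convex combination shrunk towards
        zero.\<close>
      define t where "t = cmod (c * a)"
      define u where "u = cmod (c * b)"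
      have tu: "0 \<le> t" "0 \<le> u" by (simp_all add: t_def u_def)
      have "t + u = cmod c * (cmod a + cmod b)" by (simp add: t_def u_def norm_mult algebra_simps)
      also have "\<dots> \<le> 1 * 1" using c ab by (intro mult_mono) auto
      finally have tu1: "t + u \<le> 1" by simp
      have shrink: "of_real s \<odot> z \<in> C" if "z \<in> C" "0 \<le> s" "s \<le> 1" for s z
        using conv[OF that(1) C0 that(2,3)] that(1) CV by auto
      have x': "(sgn (c * a)) \<odot> x \<in> C" and y': "(sgn (c * b)) \<odot> y \<in> C"
        using x y by (auto simp: W_def norm_sgn)
      have eq: "c \<odot> (a \<odot> x \<oplus> b \<odot> y) = of_real t \<odot> (sgn (c * a) \<odot> x) \<oplus> of_real u \<odot> (sgn (c * b) \<odot> y)"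
      proof -
        have "of_real t * sgn (c * a) = c * a" "of_real u * sgn (c * b) = c * b"
          unfolding t_def u_def by (rule sgn_eq')+
        then show ?thesis using xV by (simp add: smult_add_right)
      qed
      show ?thesis
      proof (cases "t + u = 0")
        case True
        then have "t = 0" "u = 0" using tu by linarith+
        then show ?thesis unfolding eq using xV C0 by simp
      next
        case False
        then have pos: "0 < t + u" using tu by linarith
        define s where "s = t / (t + u)"
        have s: "0 \<le> s" "s \<le> 1" "(t + u) * s = t" "(t + u) * (1 - s) = u"
          using pos tu by (auto simp: s_def field_simps)
        have in1: "of_real s \<odot> (sgn (c * a) \<odot> x) \<oplus> of_real (1 - s) \<odot> (sgn (c * b) \<odot> y) \<in> C"
          using conv[OF x' y' s(1,2)] .
        have "of_real (t + u) \<odot> (of_real s \<odot> (sgn (c * a) \<odot> x) \<oplus> of_real (1 - s) \<odot> (sgn (c * b) \<odot> y)) =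
            of_real ((t + u) * s) \<odot> (sgn (c * a) \<odot> x) \<oplus> of_real ((t + u) * (1 - s)) \<odot> (sgn (c * b) \<odot> y)"
          using xV by (simp add: smult_add_right mult.assoc del: of_real_add of_real_diff)
        then show ?thesis
          unfolding eq using shrink[OF in1 less_imp_le[OF pos] tu1] unfolding s(3,4) by simp
      qed
    qed
    then show "a \<odot> x \<oplus> b \<odot> y \<in> W" using xV by (simp add: W_def)
  qed
  moreover have "zero_nbhd V T W"
  proof -
    obtain G where G: "openin T G" "\<zero> \<in> G" "G \<subseteq> C"
      using C(2) by (auto simp: zero_nbhd_def interior_of_def)
    have cont: "continuous_map (prod_topology euclidean T) T (\<lambda>(c, x). c \<odot> x)"
      using lin unfolding linear_topology_def by blast
    define Z where "Z = {z \<in> topspace (prod_topology euclidean T). (case z of (c, x) \<Rightarrow> c \<odot> x) \<in> G}"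
    have Z: "openin (prod_topology euclidean T) Z"
      unfolding Z_def using cont G(1) by (rule openin_continuous_map_preimage)
    have Z0: "(0 :: complex, \<zero>) \<in> Z"
      using G(2) by (simp add: Z_def top)
    obtain D N where D: "openin euclidean D" "openin T N" "(0 :: complex) \<in> D" "\<zero> \<in> N"
      and DN: "D \<times> N \<subseteq> Z"
      using Z[unfolded openin_prod_topology_alt, rule_format, OF Z0] by blast
    obtain \<delta> where \<delta>: "0 < \<delta>" "ball 0 \<delta> \<subseteq> D" using D(1,3) open_contains_ball by (metis open_openin)
    \<comment> \<open>For \<open>cmod c <= 1\<close> the vector \<open>c y\<close> is
      \<open>c * \<delta> / 2\<close> times \<open>(2 / \<delta>) y\<close>, and the first factor
      lies in the open ball of radius \<open>\<delta>\<close>.\<close>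
    define N' where "N' = {y \<in> topspace T. of_real (2 / \<delta>) \<odot> y \<in> N}"
    have "openin T N'"
      unfolding N'_def using linear_topology_scale[OF lin] D(2) by (rule openin_continuous_map_preimage)
    moreover have "\<zero> \<in> N'" using D(4) by (simp add: N'_def top)
    moreover have "N' \<subseteq> W"
    proof
      fix y assume y: "y \<in> N'"
      then have yV: "y \<in> carrier V" "of_real (2 / \<delta>) \<odot> y \<in> N" by (auto simp: N'_def top)
      have "c \<odot> y \<in> C" if c: "cmod c \<le> 1" for c
      proof -
        have "cmod (c * of_real (\<delta> / 2)) \<le> 1 * (\<delta> / 2)"
          unfolding norm_mult norm_of_real using c \<delta> by (intro mult_mono) auto
        then have "c * of_real (\<delta> / 2) \<in> D" using \<delta> by (intro subsetD[OF \<delta>(2)]) (simp add: dist_norm)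
        then have "(c * of_real (\<delta> / 2), of_real (2 / \<delta>) \<odot> y) \<in> D \<times> N" using yV(2) by simp
        from subsetD[OF DN this] have "(c * of_real (\<delta> / 2)) \<odot> (of_real (2 / \<delta>) \<odot> y) \<in> G"
          by (simp add: Z_def)
        moreover have "(c * of_real (\<delta> / 2)) \<odot> (of_real (2 / \<delta>) \<odot> y) = c \<odot> y"
          using yV(1) \<delta>(1) by simp
        ultimately show ?thesis using G(3) by auto
      qed
      then show "y \<in> W" using yV by (simp add: W_def)
    qed
    ultimately show ?thesis
      unfolding zero_nbhd_def interior_of_def by (auto simp: W_def)
  qed
  moreover have "W \<subseteq> U"
  proof
    fix x assume "x \<in> W"
    then have x: "x \<in> carrier V" "\<forall>c. cmod c \<le> 1 \<longrightarrow> c \<odot> x \<in> C" unfolding W_def by blast+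
    have "1 \<odot> x \<in> C" by (rule x(2)[rule_format]) simp
    then show "x \<in> U" using C(3) x(1) by auto
  qed
  ultimately show ?thesis by (rule that)
qed

end

section \<open>Comparison with topologies agreeing on bounded sets\<close>

context seminorm_family
begin

text \<open>Translations are continuous for \<open>T'\<close>, and they shift the basic
  neighbourhoods of \<open>T\<close>; so neighbourhoods of zero decide.\<close>

lemma coarser_if_zero_nbhds:
  assumes T': "linear_topology V T'" and nb: "\<And>U. zero_nbhd V T' U \<Longrightarrow> zero_nbhd V T U" and U: "openin T' U"
  shows "openin T U"
  unfolding openin_iff
proof (intro conjI ballI)
  have top: "topspace T' = carrier V" using T' by (simp add: linear_topology_def)
  show UV: "U \<subseteq> carrier V" using openin_subset[OF U] top by simp
  fix x assume x: "x \<in> U"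
  have xV: "x \<in> carrier V" using x UV by blast
  define U0 where "U0 = {y \<in> topspace T'. y \<oplus> x \<in> U}"
  have "openin T' U0"
    unfolding U0_def using linear_topology_translate[OF T' xV] U by (rule openin_continuous_map_preimage)
  moreover have "\<zero> \<in> U0" using x xV by (simp add: U0_def top)
  ultimately have "zero_nbhd V T' U0"
    using openin_subset[of T' U0] by (simp add: zero_nbhd_def interior_of_openin top)
  then have "zero_nbhd V T U0" by (rule nb)
  then obtain F e where F: "finite F" "F \<subseteq> P" "0 < e" "{y \<in> carrier V. \<forall>p\<in>F. p y < e} \<subseteq> U0"
    unfolding zero_nbhd_iff by blast
  have "{y \<in> carrier V. \<forall>p\<in>F. p (y \<ominus> x) < e} \<subseteq> U"
  proof
    fix y assume y: "y \<in> {y \<in> carrier V. \<forall>p\<in>F. p (y \<ominus> x) < e}"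
    then have "y \<ominus> x \<in> U0" using F(4) xV by auto
    moreover have "(y \<ominus> x) \<oplus> x = y" using y xV by (elim CollectE conjE) algebra
    ultimately show "y \<in> U" by (simp add: U0_def)
  qed
  then show "\<exists>F e. finite F \<and> F \<subseteq> P \<and> 0 < e \<and> {y \<in> carrier V. \<forall>p\<in>F. p (y \<ominus> x) < e} \<subseteq> U"
    using F(1-3) by blast
qed

text \<open>Equality of the subspace topologies on \<open>B\<close> transfers an open trace from
  \<open>T'\<close> to \<open>T\<close>; zero must lie in \<open>B\<close> for that trace to contain
  it.\<close>

lemma agreeing_nbhd:
  assumes agree: "agrees_on_bounded V T T'" and W: "zero_nbhd V T' W"
    and B: "bounded_in V T B" "\<zero> \<in> B"
  obtains F e where "finite F" "F \<subseteq> P" "0 < e" "{y \<in> B. \<forall>p\<in>F. p y < e} \<subseteq> W"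
proof -
  obtain G where G: "openin T' G" "\<zero> \<in> G" "G \<subseteq> W"
    using W by (auto simp: zero_nbhd_def interior_of_def)
  have "openin (subtopology T' B) (G \<inter> B)" using G(1) by (auto simp: openin_subtopology)
  then have "openin (subtopology T B) (G \<inter> B)" using agree B(1) by (simp add: agrees_on_bounded_def)
  then obtain H where H: "openin T H" "G \<inter> B = H \<inter> B" by (auto simp: openin_subtopology)
  have "\<zero> \<in> H" using G(2) B(2) H(2) by blast
  then have "zero_nbhd V T H"
    using H(1) openin_subset[OF H(1)] by (simp add: zero_nbhd_def interior_of_openin)
  then obtain F e where F: "finite F" "F \<subseteq> P" "0 < e" "{y \<in> carrier V. \<forall>p\<in>F. p y < e} \<subseteq> H"
    unfolding zero_nbhd_iff by blast
  have BV: "B \<subseteq> carrier V" using B(1) by (simp add: bounded_in_def)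
  have "{y \<in> B. \<forall>p\<in>F. p y < e} \<subseteq> W"
  proof
    fix y assume y: "y \<in> {y \<in> B. \<forall>p\<in>F. p y < e}"
    then have "y \<in> {y \<in> carrier V. \<forall>p\<in>F. p y < e}" using BV by blast
    then have "y \<in> H" by (rule subsetD[OF F(4)])
    then show "y \<in> W" using y H(2) G(3) by blast
  qed
  with F(1-3) show ?thesis by (rule that)
qed

text \<open>\<open>B\<close> is enlarged to the bounded set \<open>B'\<close> of its multiples by
  scalars of modulus at most 1, together with zero. For large \<open>c\<close> the element
  \<open>b / c\<close> lies in \<open>B'\<close> and is small, hence is in \<open>W\<close>.\<close>

lemma agreeing_nbhd_absorbs:
  assumes agree: "agrees_on_bounded V T T'" and W: "zero_nbhd V T' W" and B: "bounded_in V T B"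
  shows "absorbs V W B"
proof -
  have BV: "B \<subseteq> carrier V" using B by (simp add: bounded_in_def)
  obtain K where K: "\<And>p b. \<lbrakk>p \<in> P; b \<in> B\<rbrakk> \<Longrightarrow> p b \<le> K p" using B unfolding bounded_in_iff by metis
  define B' where "B' = {c \<odot> b | c b. cmod c \<le> 1 \<and> b \<in> B} \<union> {\<zero>}"
  have "bounded_in V T B'"
    unfolding bounded_in_iff
  proof (intro conjI ballI)
    show "B' \<subseteq> carrier V" using BV by (auto simp: B'_def)
    fix p assume p: "p \<in> P"
    interpret cseminorm V p by (rule seminorms) fact
    have "p b \<le> \<bar>K p\<bar>" if bB: "b \<in> B'" for b
    proof (cases "b = \<zero>")
      case False
      then obtain c b' where b: "b = c \<odot> b'" "cmod c \<le> 1" "b' \<in> B" using bB by (auto simp: B'_def)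
      have b'V: "b' \<in> carrier V" using b BV by blast
      have "p b = cmod c * p b'" using b b'V by (simp add: homogeneous)
      also have "\<dots> \<le> 1 * p b'" using b(2) b'V by (intro mult_right_mono nonneg)
      also have "\<dots> \<le> \<bar>K p\<bar>" using K[OF p b(3)] by simp
      finally show ?thesis .
    qed simp
    then show "\<exists>K. \<forall>b\<in>B'. p b \<le> K" by blast
  qed
  moreover have "\<zero> \<in> B'" by (simp add: B'_def)
  ultimately obtain F e where F: "finite F" "F \<subseteq> P" "0 < e" "{y \<in> B'. \<forall>p\<in>F. p y < e} \<subseteq> W"
    by (rule agreeing_nbhd[OF agree W])
  define m where "m = (\<Sum>p\<in>F. \<bar>K p\<bar>)"
  have m: "K p \<le> m" if "p \<in> F" for p
    unfolding m_def using that F(1) member_le_sum[of p F "\<lambda>p. \<bar>K p\<bar>"] by auto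
  \<comment> \<open>The 1 keeps \<open>b / c\<close> in \<open>B'\<close>; the quotient makes its
    finitely many seminorms smaller than \<open>e\<close>.\<close>
  define r where "r = max 1 ((\<bar>m\<bar> + 1) / e)"
  have "b \<in> (\<lambda>u. c \<odot> u) ` W" if c: "r \<le> cmod c" and b: "b \<in> B" for c b
  proof
    have c1: "1 \<le> cmod c" "(\<bar>m\<bar> + 1) / e \<le> cmod c" using c by (auto simp: r_def)
    then have c0: "c \<noteq> 0" by auto
    have bV: "b \<in> carrier V" using b BV by blast
    show "b = c \<odot> ((1 / c) \<odot> b)" using bV c0 by simp
    have "p ((1 / c) \<odot> b) < e" if p: "p \<in> F" for p
    proof -
      interpret cseminorm V p using p F(2) seminorms by blast
      have "p b < \<bar>m\<bar> + 1" using K[of p b] m[OF p] p F(2) b by fastforce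
      also have "\<dots> \<le> cmod c * e" using c1(2) F(3) by (simp add: field_simps)
      finally show ?thesis using bV c0 by (simp add: homogeneous norm_divide field_simps)
    qed
    moreover have "(1 / c) \<odot> b \<in> B'"
    proof -
      have "cmod (1 / c) \<le> 1" using c1(1) c0 by (simp add: norm_divide divide_le_eq)
      then show ?thesis unfolding B'_def using b by blast
    qed
    ultimately show "(1 / c) \<odot> b \<in> W" by (intro subsetD[OF F(4)]) simp
  qed
  then have "\<forall>c. r \<le> cmod c \<longrightarrow> B \<subseteq> (\<lambda>u. c \<odot> u) ` W" by blast
  moreover have "0 < r" by (simp add: r_def)
  ultimately show ?thesis unfolding absorbs_def by blast
qed

end


section \<open>The strict topology and its localization\<close>

context pro_cstar
begin

lemma nrm_component:
  assumes x: "x \<in> carrier MA" and p: "p \<in> S" and a: "a \<in> carrier A"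
  shows "nrm (Q p) (fst (x p) (coset p a)) = p (lm x a)" "nrm (Q p) (snd (x p) (coset p a)) = p (rm x a)"
  unfolding lm_rm(2,4)[OF x a p, symmetric]
  using quotient_nrm[OF p lm_rm(1)[OF x a]] quotient_nrm[OF p lm_rm(3)[OF x a]] by simp_all

lemma MA_minus_component:
  assumes x: "x \<in> carrier MA" and y: "y \<in> carrier MA" and p: "p \<in> S"
  shows "(y \<ominus>\<^bsub>MA\<^esub> x) p = y p \<ominus>\<^bsub>quotient_multipliers A p\<^esub> x p"
proof -
  interpret B: seminormed_star_algebra "Q p" using p by (rule quotient_seminormed_star_algebra)
  interpret Mp: complex_module "quotient_multipliers A p" by (rule B.complex_module_multiplier)
  have xp: "x p \<in> carrier (quotient_multipliers A p)"
    unfolding B.multiplier_carrier by (rule MA_component[OF x p])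
  have "y \<ominus>\<^bsub>MA\<^esub> x = y \<oplus>\<^bsub>MA\<^esub> (- 1) \<odot>\<^bsub>MA\<^esub> x" unfolding a_minus_def MA.smult_minus_1[OF x] ..
  then have "(y \<ominus>\<^bsub>MA\<^esub> x) p = y p \<oplus>\<^bsub>quotient_multipliers A p\<^esub> (- 1) \<odot>\<^bsub>quotient_multipliers A p\<^esub> x p"
    using p by (simp add: MA_ops)
  then show ?thesis unfolding a_minus_def Mp.smult_minus_1[OF xp] .
qed

lemma topspace_strict_topology: "topspace (strict_topology A) = carrier MA"
proof -
  have top: "topspace (cstar_strict_topology (Q p)) = double_centralizers (Q p)" if p: "p \<in> S" for p
  proof -
    interpret B: seminormed_star_algebra "Q p" using p by (rule quotient_seminormed_star_algebra)
    interpret F: seminorm_family "quotient_multipliers A p" B.strict_seminorms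
      by (rule B.strict_seminorms_family)
    show ?thesis unfolding B.cstar_strict_topology_eq using F.topspace B.multiplier_carrier by simp
  qed
  have "carrier MA \<subseteq> topspace (product_topology (\<lambda>p. cstar_strict_topology (Q p)) S)"
  proof
    fix x assume x: "x \<in> carrier MA"
    then have "x \<in> extensional S" unfolding MA_carrier_iff by blast
    then show "x \<in> topspace (product_topology (\<lambda>p. cstar_strict_topology (Q p)) S)"
      unfolding topspace_product_topology PiE_iff using MA_component[OF x] top by simp
  qed
  then show ?thesis unfolding strict_topology_def by auto
qed

text \<open>The identity is continuous in both directions: \<open>p (x a)\<close> and
  \<open>p (a x)\<close> are the strict seminorms of \<open>M(A_p)\<close> at the coset of
  \<open>a\<close>, evaluated at the component of \<open>x\<close>, and every strict seminorm of
  \<open>M(A_p)\<close> arises in this way.\<close>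

lemma strict_topology_eq: "strict_topology A = MA.T"
proof -
  have "continuous_map (strict_topology A) MA.T (\<lambda>x. x)"
  proof (rule MA.continuous_mapI)
    fix s assume "s \<in> topspace (strict_topology A)"
    then show "s \<in> carrier MA" by (simp add: topspace_strict_topology)
  next
    fix s f and e :: real
    assume "s \<in> topspace (strict_topology A)" and f: "f \<in> MA_seminorms" and e: "0 < e"
    then have s: "s \<in> carrier MA" by (simp add: topspace_strict_topology)
    obtain p a where p: "p \<in> S" and a: "a \<in> carrier A" and fcase: "f = (\<lambda>x. p (lm x a)) \<or> f = (\<lambda>x. p (rm x a))"
      using f unfolding MA_seminorms_def by blast
    interpret B: seminormed_star_algebra "Q p" using p by (rule quotient_seminormed_star_algebra)
    interpret F: seminorm_family "quotient_multipliers A p" B.strict_seminorms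
      by (rule B.strict_seminorms_family)
    obtain g where g: "g \<in> B.strict_seminorms" and fg: "\<And>x. x \<in> carrier MA \<Longrightarrow> f x = g (x p)"
    proof (cases "f = (\<lambda>x. p (lm x a))")
      case True
      have "(\<lambda>z. nrm (Q p) (fst z (coset p a))) \<in> B.strict_seminorms"
        unfolding B.strict_seminorms_def using quotient_coset_closed[OF p a] by blast
      then show ?thesis by (rule that) (use nrm_component(1)[OF _ p a] True in simp)
    next
      case False
      then have fr: "f = (\<lambda>x. p (rm x a))" using fcase by blast
      have "(\<lambda>z. nrm (Q p) (snd z (coset p a))) \<in> B.strict_seminorms"
        unfolding B.strict_seminorms_def using quotient_coset_closed[OF p a] by blast
      then show ?thesis by (rule that) (use nrm_component(2)[OF _ p a] fr in simp)
    qed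
    have sp: "s p \<in> carrier (quotient_multipliers A p)"
      unfolding B.multiplier_carrier by (rule MA_component[OF s p])
    define N where "N = {z \<in> carrier (quotient_multipliers A p). g (z \<ominus>\<^bsub>quotient_multipliers A p\<^esub> s p) < e}"
    have N: "openin (cstar_strict_topology (Q p)) N"
      unfolding N_def B.cstar_strict_topology_eq by (rule F.openin_subbasic[OF g sp])
    have "continuous_map (strict_topology A) (cstar_strict_topology (Q p)) (\<lambda>x. x p)"
      unfolding strict_topology_def
      by (intro continuous_map_from_subtopology continuous_map_product_projection p)
    then have "openin (strict_topology A) {x \<in> topspace (strict_topology A). x p \<in> N}"
      using N by (rule openin_continuous_map_preimage)
    moreover have eq: "f (x \<ominus>\<^bsub>MA\<^esub> s) = g (x p \<ominus>\<^bsub>quotient_multipliers A p\<^esub> s p)" if x: "x \<in> carrier MA" for x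
      using fg[OF MA.M.minus_closed[OF x s]] MA_minus_component[OF s x p] by simp
    have "f (s \<ominus>\<^bsub>MA\<^esub> s) < e"
    proof -
      interpret cseminorm MA f by (rule MA.seminorms[OF f])
      show ?thesis using s e by (simp add: a_minus_def MA.M.r_neg)
    qed
    then have "s \<in> {x \<in> topspace (strict_topology A). x p \<in> N}"
      using s sp eq[OF s] by (simp add: N_def topspace_strict_topology)
    moreover have "f (x \<ominus>\<^bsub>MA\<^esub> s) < e" if "x \<in> {x \<in> topspace (strict_topology A). x p \<in> N}" for x
      using that eq[of x] by (simp add: N_def topspace_strict_topology)
    ultimately show "\<exists>U. openin (strict_topology A) U \<and> s \<in> U \<and> (\<forall>s'\<in>U. f (s' \<ominus>\<^bsub>MA\<^esub> s) < e)"
      by blast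
  qed
  moreover have "continuous_map MA.T (strict_topology A) (\<lambda>x. x)"
  proof -
    have "continuous_map MA.T (cstar_strict_topology (Q p)) (\<lambda>x. x p)" if p: "p \<in> S" for p
    proof -
      interpret B: seminormed_star_algebra "Q p" using p by (rule quotient_seminormed_star_algebra)
      interpret F: seminorm_family "quotient_multipliers A p" B.strict_seminorms
        by (rule B.strict_seminorms_family)
      show ?thesis
        unfolding B.cstar_strict_topology_eq
      proof (rule F.continuous_mapI)
        fix s assume "s \<in> topspace MA.T"
        then have s: "s \<in> carrier MA" by simp
        then show "s p \<in> carrier (quotient_multipliers A p)"
          unfolding B.multiplier_carrier by (rule MA_component[OF _ p])
        fix g and e :: real
        assume g: "g \<in> B.strict_seminorms" and e: "0 < e"
        obtain f where f: "f \<in> MA_seminorms" and fg: "\<And>x. x \<in> carrier MA \<Longrightarrow> f x = g (x p)"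
        proof -
          obtain X where X: "X \<in> carrier (Q p)"
            and gcase: "g = (\<lambda>z. nrm (Q p) (fst z X)) \<or> g = (\<lambda>z. nrm (Q p) (snd z X))"
            using g unfolding B.strict_seminorms_def by blast
          obtain a where a: "a \<in> carrier A" "X = coset p a" using X by (rule quotient_elem[OF p])
          have 1: "(\<lambda>x. p (lm x a)) \<in> MA_seminorms" "(\<lambda>x. p (rm x a)) \<in> MA_seminorms"
            unfolding MA_seminorms_def using p a by blast+
          show ?thesis using gcase
          proof
            assume "g = (\<lambda>z. nrm (Q p) (fst z X))"
            then show ?thesis using that[OF 1(1)] nrm_component(1)[OF _ p a(1)] a(2) by simp
          next
            assume "g = (\<lambda>z. nrm (Q p) (snd z X))"
            then show ?thesis using that[OF 1(2)] nrm_component(2)[OF _ p a(1)] a(2) by simp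
          qed
        qed
        have eq: "f (x \<ominus>\<^bsub>MA\<^esub> s) = g (x p \<ominus>\<^bsub>quotient_multipliers A p\<^esub> s p)" if x: "x \<in> carrier MA" for x
          using fg[OF MA.M.minus_closed[OF x s]] MA_minus_component[OF s x p] by simp
        interpret cseminorm MA f by (rule MA.seminorms[OF f])
        have "openin MA.T {x \<in> carrier MA. f (x \<ominus>\<^bsub>MA\<^esub> s) < e}" by (rule MA.openin_subbasic[OF f s])
        moreover have "s \<in> {x \<in> carrier MA. f (x \<ominus>\<^bsub>MA\<^esub> s) < e}" using s e by (simp add: a_minus_def MA.M.r_neg)
        moreover have "\<forall>x\<in>{x \<in> carrier MA. f (x \<ominus>\<^bsub>MA\<^esub> s) < e}. g (x p \<ominus>\<^bsub>quotient_multipliers A p\<^esub> s p) < e"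
        proof
          fix x assume "x \<in> {x \<in> carrier MA. f (x \<ominus>\<^bsub>MA\<^esub> s) < e}"
          then show "g (x p \<ominus>\<^bsub>quotient_multipliers A p\<^esub> s p) < e" using eq[of x] by simp
        qed
        ultimately show "\<exists>U. openin MA.T U \<and> s \<in> U \<and> (\<forall>x\<in>U. g (x p \<ominus>\<^bsub>quotient_multipliers A p\<^esub> s p) < e)"
          by blast
      qed
    qed
    moreover have "(\<lambda>x. x) \<in> topspace MA.T \<rightarrow> extensional S" by (auto simp: MA_carrier_iff)
    ultimately have "continuous_map MA.T (product_topology (\<lambda>p. cstar_strict_topology (Q p)) S) (\<lambda>x. x)"
      by (auto simp: continuous_map_componentwise)
    then show ?thesis
      unfolding strict_topology_def by (simp add: continuous_map_in_subtopology)
  qed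
  moreover have "X = Y" if "continuous_map X Y (\<lambda>x. x)" "continuous_map Y X (\<lambda>x. x)" for X Y :: "'b multiplier topology"
  proof -
    have top: "topspace X = topspace Y" using that by (auto simp: continuous_map_def)
    have "openin X U" if "continuous_map X Y (\<lambda>x. x)" "openin Y U" "topspace X = topspace Y" for X Y U
    proof -
      have "openin X {x \<in> topspace X. x \<in> U}" using that(1,2) by (rule openin_continuous_map_preimage)
      moreover have "{x \<in> topspace X. x \<in> U} = U" using openin_subset[OF that(2)] that(3) by blast
      ultimately show ?thesis by simp
    qed
    then show ?thesis using that top unfolding topology_eq by metis
  qed
  ultimately show ?thesis by blast
qed

text \<open>Directedness of \<open>S\<close> lets one \<open>q\<close> serve for all of
  \<open>F\<close>, while \<open>G\<close> collects the elements of \<open>A\<close> that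
  occur.\<close>

lemma finite_MA_seminorms:
  assumes "finite F" "F \<subseteq> MA_seminorms"
  shows "\<exists>q\<in>S. \<exists>G. finite G \<and> G \<subseteq> carrier A \<and>
    (\<forall>x\<in>carrier MA. \<forall>f\<in>F. \<exists>a\<in>G. f x \<le> q (lm x a) \<or> f x \<le> q (rm x a))"
  using assms
proof (induction F rule: finite_induct)
  case empty
  obtain q where "q \<in> S" using nonempty by blast
  then show ?case by (intro bexI[of _ q] exI[of _ "{}"]) simp_all
next
  case (insert f F)
  then obtain q G where q: "q \<in> S" and G: "finite G" "G \<subseteq> carrier A"
    and qG: "\<forall>x\<in>carrier MA. \<forall>f\<in>F. \<exists>a\<in>G. f x \<le> q (lm x a) \<or> f x \<le> q (rm x a)" by auto
  obtain p a where p: "p \<in> S" and a: "a \<in> carrier A" and fcase: "f = (\<lambda>x. p (lm x a)) \<or> f = (\<lambda>x. p (rm x a))"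
    using insert.prems unfolding MA_seminorms_def by blast
  obtain r where r: "r \<in> S" "\<forall>x\<in>carrier A. p x \<le> r x \<and> q x \<le> r x"
    using cont_seminorms_directed[OF p q] by blast
  have pr: "p y \<le> r y" and qr: "q y \<le> r y" if "y \<in> carrier A" for y using r(2) that by blast+
  have "\<exists>b\<in>insert a G. f' x \<le> r (lm x b) \<or> f' x \<le> r (rm x b)" if x: "x \<in> carrier MA" and f': "f' \<in> insert f F" for x f'
  proof (cases "f' = f")
    case True
    have "f x \<le> r (lm x a) \<or> f x \<le> r (rm x a)"
      using fcase pr[OF lm_rm(1)[OF x a]] pr[OF lm_rm(3)[OF x a]] by auto
    then show ?thesis using True by blast
  next
    case False
    then obtain b where b: "b \<in> G" "f' x \<le> q (lm x b) \<or> f' x \<le> q (rm x b)" using qG x f' by blast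
    then have bA: "b \<in> carrier A" using G by blast
    have "f' x \<le> r (lm x b) \<or> f' x \<le> r (rm x b)"
      using b(2) qr[OF lm_rm(1)[OF x bA]] qr[OF lm_rm(3)[OF x bA]] by linarith
    then show ?thesis using b(1) by blast
  qed
  then show ?case
    using r(1) G a by (intro bexI[of _ r] exI[of _ "insert a G"] conjI ballI) simp_all
qed

lemma embed_add:
  assumes a: "a \<in> carrier A" and b: "b \<in> carrier A"
  shows "embed (a \<oplus> b) = embed a \<oplus>\<^bsub>MA\<^esub> embed b"
  by (rule MA_eqI) (use a b in \<open>simp_all add: embed MA_add l_distr r_distr\<close>)

lemma embed_smult:
  assumes a: "a \<in> carrier A"
  shows "embed (c \<odot> a) = c \<odot>\<^bsub>MA\<^esub> embed a"
  by (rule MA_eqI) (use a in \<open>simp_all add: embed MA_smult smult_mult_left smult_mult_right\<close>)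

text \<open>By submultiplicativity, multiplying by a fixed \<open>a\<close> enlarges
  \<open>p\<close> at most by the factor \<open>p a\<close>.\<close>

lemma embed_bounded:
  assumes B: "B \<subseteq> carrier A" and K: "\<And>p b. \<lbrakk>p \<in> S; b \<in> B\<rbrakk> \<Longrightarrow> p b \<le> K p"
  shows "bounded_in MA MA.T (embed ` B)"
  unfolding MA.bounded_in_iff
proof (intro conjI ballI)
  show "embed ` B \<subseteq> carrier MA" using B embed(1) by blast
  fix f assume f: "f \<in> MA_seminorms"
  obtain p a where p: "p \<in> S" and a: "a \<in> carrier A" and fcase: "f = (\<lambda>x. p (lm x a)) \<or> f = (\<lambda>x. p (rm x a))"
    using f unfolding MA_seminorms_def by blast
  interpret cstar_seminorm_on A p using p by (rule cont_seminorms_cstar)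
  have "f (embed b) \<le> K p * p a" if b: "b \<in> B" for b
  proof -
    have bA: "b \<in> carrier A" using b B by blast
    have "f (embed b) \<le> p b * p a"
      using fcase submultiplicative[OF bA a] submultiplicative[OF a bA] embed(2,3)[OF bA a]
      by (auto simp: mult.commute)
    also have "\<dots> \<le> K p * p a" using K[OF p b] nonneg[OF a] by (intro mult_right_mono)
    finally show ?thesis .
  qed
  then show "\<exists>K. \<forall>x\<in>embed ` B. f x \<le> K" by blast
qed

text \<open>Here the bornology of \<open>A\<close> is used: \<open>W\<close> absorbs strictly
  bounded sets, so its trace on \<open>A\<close> absorbs the bounded sets of \<open>A\<close> and is
  a neighbourhood. Agreement on the images of uniformly bounded sets yields the strict
  neighbourhoods.\<close>

lemma bornological_strict_zero_nbhd:
  assumes born: "bornological A (topo A)"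
    and agree: "agrees_on_bounded MA MA.T T'" and W: "zero_nbhd MA T' W" "absolutely_convex MA W"
  obtains p where "p \<in> S" "strict_zero_nbhd p {a \<in> carrier A. embed a \<in> W}"
proof -
  let ?C = "{a \<in> carrier A. embed a \<in> W}"
  have ac: "absolutely_convex A ?C"
    unfolding absolutely_convex_def
  proof (intro conjI ballI allI impI)
    fix x y a b assume x: "x \<in> ?C" and y: "y \<in> ?C" and ab: "cmod a + cmod b \<le> 1"
    have "a \<odot>\<^bsub>MA\<^esub> embed x \<oplus>\<^bsub>MA\<^esub> b \<odot>\<^bsub>MA\<^esub> embed y \<in> W"
      using W(2) x y ab unfolding absolutely_convex_def by blast
    then show "a \<odot> x \<oplus> b \<odot> y \<in> ?C" using x y by (simp add: embed_add embed_smult)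
  qed auto
  have "absorbs A ?C B" if B: "bounded_in A (topo A) B" for B
  proof -
    have BA: "B \<subseteq> carrier A" and Bp: "\<forall>p\<in>S. \<exists>K. \<forall>b\<in>B. p b \<le> K"
      using B unfolding topo_eq bounded_in_iff by blast+
    obtain K where K: "\<And>p b. \<lbrakk>p \<in> S; b \<in> B\<rbrakk> \<Longrightarrow> p b \<le> K p" using Bp by metis
    have "bounded_in MA MA.T (embed ` B)" using BA K by (rule embed_bounded)
    then have "absorbs MA W (embed ` B)" by (rule MA.agreeing_nbhd_absorbs[OF agree W(1)])
    then obtain r where r: "0 < r" "\<forall>c. r \<le> cmod c \<longrightarrow> embed ` B \<subseteq> (\<lambda>u. c \<odot>\<^bsub>MA\<^esub> u) ` W"
      unfolding absorbs_def by blast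
    have "B \<subseteq> (\<lambda>u. c \<odot> u) ` ?C" if c: "r \<le> cmod c" for c
    proof
      fix b assume b: "b \<in> B"
      have bA: "b \<in> carrier A" using b BA by blast
      have c0: "c \<noteq> 0" using r(1) c by auto
      have "embed b \<in> (\<lambda>u. c \<odot>\<^bsub>MA\<^esub> u) ` W" using r(2)[rule_format, OF c] b by blast
      then obtain w where w: "embed b = c \<odot>\<^bsub>MA\<^esub> w" "w \<in> W" by (rule imageE)
      have wM: "w \<in> carrier MA" using w(2) W(2) by (auto simp: absolutely_convex_def)
      have "embed ((1 / c) \<odot> b) = (1 / c) \<odot>\<^bsub>MA\<^esub> (c \<odot>\<^bsub>MA\<^esub> w)" unfolding embed_smult[OF bA] w(1) ..
      also have "\<dots> = w" using c0 wM by simp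
      finally have "(1 / c) \<odot> b \<in> ?C" using w(2) bA by simp
      moreover have "b = c \<odot> ((1 / c) \<odot> b)" using bA c0 by simp
      ultimately show "b \<in> (\<lambda>u. c \<odot> u) ` ?C" by (rule rev_image_eqI)
    qed
    then show ?thesis unfolding absorbs_def using r(1) by blast
  qed
  then have "zero_nbhd A (topo A) ?C" using born ac unfolding bornological_def by blast
  then obtain p e where p: "p \<in> S" and e: "0 < e" "{y \<in> carrier A. p y < e} \<subseteq> ?C"
    unfolding zero_nbhd_topo_iff by blast
  have "\<exists>G q \<epsilon>. finite G \<and> G \<subseteq> carrier A \<and> q \<in> S \<and> 0 < \<epsilon> \<and> Collect (strict_small C G q \<epsilon>) \<subseteq> ?C" for C
  proof -
    \<comment> \<open>The absolute value keeps zero in \<open>B\<close> even for negative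
      \<open>C\<close>, as \<open>agreeing_nbhd\<close> demands.\<close>
    define B where "B = {b \<in> carrier A. \<forall>r\<in>S. r b \<le> \<bar>C\<bar>}"
    have bdd: "bounded_in MA MA.T (embed ` B)"
      by (rule embed_bounded[where K = "\<lambda>_. \<bar>C\<bar>"]) (auto simp: B_def)
    have "r \<zero> \<le> \<bar>C\<bar>" if "r \<in> S" for r
    proof -
      interpret cstar_seminorm_on A r using that by (rule cont_seminorms_cstar)
      show ?thesis by simp
    qed
    then have "\<zero> \<in> B" unfolding B_def by blast
    moreover have "embed \<zero> = \<zero>\<^bsub>MA\<^esub>" by (rule MA_eqI) (simp_all add: embed MA_zero)
    ultimately have zero: "\<zero>\<^bsub>MA\<^esub> \<in> embed ` B" by force
    obtain F \<epsilon> where F: "finite F" "F \<subseteq> MA_seminorms" "0 < \<epsilon>" "{y \<in> embed ` B. \<forall>f\<in>F. f y < \<epsilon>} \<subseteq> W"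
      by (rule MA.agreeing_nbhd[OF agree W(1) bdd zero])
    obtain q G where q: "q \<in> S" and G: "finite G" "G \<subseteq> carrier A"
      and qG: "\<forall>x\<in>carrier MA. \<forall>f\<in>F. \<exists>a\<in>G. f x \<le> q (lm x a) \<or> f x \<le> q (rm x a)"
      using finite_MA_seminorms[OF F(1,2)] by blast
    have "y \<in> ?C" if "strict_small C G q \<epsilon> y" for y
    proof -
      have y: "y \<in> carrier A" "\<forall>r\<in>S. r y \<le> C" and small: "\<forall>a\<in>G. q (y \<otimes> a) < \<epsilon> \<and> q (a \<otimes> y) < \<epsilon>"
        using that unfolding strict_small_def by simp_all
      have "f (embed y) < \<epsilon>" if f: "f \<in> F" for f
      proof -
        obtain a where a: "a \<in> G" "f (embed y) \<le> q (lm (embed y) a) \<or> f (embed y) \<le> q (rm (embed y) a)"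
          using qG embed(1)[OF y(1)] f by blast
        have aA: "a \<in> carrier A" using a(1) G by blast
        have "q (y \<otimes> a) < \<epsilon>" "q (a \<otimes> y) < \<epsilon>" using small a(1) by blast+
        then show ?thesis using a(2) unfolding embed(2,3)[OF y(1) aA] by linarith
      qed
      moreover have "r y \<le> \<bar>C\<bar>" if "r \<in> S" for r
        using bspec[OF y(2) that] by linarith
      then have "y \<in> B" unfolding B_def using y(1) by blast
      ultimately have "embed y \<in> {y \<in> embed ` B. \<forall>f\<in>F. f y < \<epsilon>}" by blast
      then show ?thesis using subsetD[OF F(4)] y(1) by blast
    qed
    then have "Collect (strict_small C G q \<epsilon>) \<subseteq> ?C" by blast
    then show ?thesis using G q F(3) by blast
  qed
  moreover have "\<exists>\<delta>>0. \<forall>y\<in>carrier A. p y \<le> \<delta> \<longrightarrow> y \<in> ?C"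
  proof (intro exI[of _ "e / 2"] conjI ballI impI)
    fix y assume y: "y \<in> carrier A" "p y \<le> e / 2"
    then have "p y < e" using e(1) by linarith
    then have "y \<in> {y \<in> carrier A. p y < e}" using y(1) by blast
    then show "y \<in> ?C" by (rule subsetD[OF e(2)])
  qed (use e in simp)
  ultimately have "strict_zero_nbhd p ?C" unfolding strict_zero_nbhd_def using ac by blast
  with p show ?thesis by (rule that)
qed

text \<open>In \<open>x = (x - x e) + x e\<close> the element \<open>e\<close> is chosen for the
  single \<open>x\<close>. The product \<open>x e\<close> lies in \<open>A\<close>, where
  \<open>strict_zero_nbhd_contains\<close> applies; \<open>x - x e\<close> becomes strictly small
  within a bounded set. Both are doubled and combined with weights 1/2. Only \<open>e\<close>
  depends on \<open>x\<close>, not the seminorms \<open>f\<close> and \<open>g\<close>.\<close>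

lemma bornological_zero_nbhd:
  assumes born: "bornological A (topo A)"
    and agree: "agrees_on_bounded MA MA.T T'" and W: "zero_nbhd MA T' W" "absolutely_convex MA W"
  shows "zero_nbhd MA MA.T W"
proof -
  have WM: "W \<subseteq> carrier MA" using W(2) by (simp add: absolutely_convex_def)
  obtain p where p: "p \<in> S" and sz: "strict_zero_nbhd p {a \<in> carrier A. embed a \<in> W}"
    by (rule bornological_strict_zero_nbhd[OF born agree W])
  interpret cstar_seminorm_on A p using p by (rule cont_seminorms_cstar)
  obtain a c where a: "a \<in> carrier A" and c: "0 < c"
    and inC: "\<forall>x\<in>carrier A. p (a \<otimes> x) \<le> c \<and> p (x \<otimes> star A a) \<le> c \<longrightarrow> x \<in> {a \<in> carrier A. embed a \<in> W}"
    using strict_zero_nbhd_contains[OF sz p] by blast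
  define a' where "a' = star A a"
  have a': "a' \<in> carrier A" using a by (simp add: a'_def)
  define f where "f = (\<lambda>x. p (rm x a))"
  define g where "g = (\<lambda>x. p (lm x a'))"
  have fg: "{f, g} \<subseteq> MA_seminorms" unfolding MA_seminorms_def f_def g_def using p a a' by blast
  \<comment> \<open>The margin 4: doubling \<open>x e\<close> and the factor 2 in
    \<open>damping_mult_le\<close> give \<open>4 * f x < c\<close>. On the other side the bound is
    \<open>2 * (c / 4 + c / 8)\<close>, where \<open>c / 8\<close> is the error allowed to
    \<open>e\<close>.\<close>
  have "x \<in> W" if x: "x \<in> carrier MA" "f x < c / 4" "g x < c / 4" for x
  proof -
    let ?z = "\<lambda>e. 2 \<odot>\<^bsub>MA\<^esub> (x \<ominus>\<^bsub>MA\<^esub> embed (lm x e))"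
    have lr: "lm x b \<in> carrier A" "rm x b \<in> carrier A" if "b \<in> carrier A" for b using lm_rm(1,3)[OF x(1) that] .
    have z: "?z e \<in> carrier MA" "b \<in> carrier A \<Longrightarrow> lm (?z e) b = 2 \<odot> lm x (b \<ominus> e \<otimes> b)"
      "b \<in> carrier A \<Longrightarrow> rm (?z e) b = 2 \<odot> (rm x b \<ominus> rm x b \<otimes> e)" if e: "e \<in> carrier A" for e b
    proof -
      note le = embed[OF lr(1)[OF e]]
      have d: "x \<ominus>\<^bsub>MA\<^esub> embed (lm x e) = x \<oplus>\<^bsub>MA\<^esub> (- 1) \<odot>\<^bsub>MA\<^esub> embed (lm x e)"
        unfolding a_minus_def MA.smult_minus_1[OF le(1)] ..
      have cl: "(- 1) \<odot>\<^bsub>MA\<^esub> embed (lm x e) \<in> carrier MA" "x \<oplus>\<^bsub>MA\<^esub> (- 1) \<odot>\<^bsub>MA\<^esub> embed (lm x e) \<in> carrier MA"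
        using x(1) le(1) by (auto intro: MA_add(1) MA_smult(1))
      show "?z e \<in> carrier MA" unfolding d by (rule MA_smult(1)[OF cl(2)])
      show "lm (?z e) b = 2 \<odot> lm x (b \<ominus> e \<otimes> b)" if b: "b \<in> carrier A"
        unfolding d MA_smult(2)[OF cl(2) b] MA_add(2)[OF x(1) cl(1) b] MA_smult(2)[OF le(1) b] le(2)[OF b]
        using lm_diff_right[OF x(1) b, of "e \<otimes> b"] lm_rm_mult(1)[OF x(1) e b] lr e b
        by (simp add: smult_minus_1 a_minus_def)
      show "rm (?z e) b = 2 \<odot> (rm x b \<ominus> rm x b \<otimes> e)" if b: "b \<in> carrier A"
        unfolding d MA_smult(3)[OF cl(2) b] MA_add(3)[OF x(1) cl(1) b] MA_smult(3)[OF le(1) b] le(3)[OF b]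
        using lm_rm_mult(3)[OF x(1) b e] lr e b by (simp add: smult_minus_1 a_minus_def)
    qed
    \<comment> \<open>These constants depend on \<open>x\<close>, which is harmless because
      \<open>e\<close> is chosen after \<open>x\<close>.\<close>
    obtain k where k: "\<And>q. q \<in> S \<Longrightarrow> 0 \<le> k q" "\<And>q b. \<lbrakk>q \<in> S; b \<in> carrier A\<rbrakk> \<Longrightarrow> q (lm x b) \<le> k q * q b"
      using lm_bound[OF x(1)] by metis
    have qz: "q (lm (?z e) b) \<le> 2 * (k q * q (b \<ominus> e \<otimes> b))" "q (rm (?z e) b) = 2 * q (rm x b \<ominus> rm x b \<otimes> e)"
      if e: "damping e" and q: "q \<in> S" and b: "b \<in> carrier A" for e q b
    proof -
      interpret Q: cstar_seminorm_on A q using q by (rule cont_seminorms_cstar)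
      have eA: "e \<in> carrier A" using e by auto
      have bA: "b \<ominus> e \<otimes> b \<in> carrier A" using b eA by simp
      show "q (lm (?z e) b) \<le> 2 * (k q * q (b \<ominus> e \<otimes> b))"
        unfolding z(2)[OF eA b] Q.homogeneous[OF lr(1)[OF bA]] using k(2)[OF q bA] by simp
      have "rm x b \<ominus> rm x b \<otimes> e \<in> carrier A" using lr(2)[OF b] eA by simp
      then show "q (rm (?z e) b) = 2 * q (rm x b \<ominus> rm x b \<otimes> e)"
        unfolding z(3)[OF eA b] by (simp add: Q.homogeneous)
    qed
    \<comment> \<open>Bounded because \<open>1 - e\<close> is a contraction for every damping
      \<open>e\<close>. So agreement applies to the whole family before a particular
      \<open>e\<close> is picked.\<close>
    define B where "B = ?z ` Collect damping \<union> {\<zero>\<^bsub>MA\<^esub>}"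
    have bdd: "bounded_in MA MA.T B"
      unfolding MA.bounded_in_iff
    proof (intro conjI ballI)
      show "B \<subseteq> carrier MA" unfolding B_def using z(1) MA_zero(1) by auto
      fix h assume h: "h \<in> MA_seminorms"
      obtain q b where q: "q \<in> S" and b: "b \<in> carrier A" and hcase: "h = (\<lambda>x. q (lm x b)) \<or> h = (\<lambda>x. q (rm x b))"
        using h unfolding MA_seminorms_def by blast
      interpret Q: cstar_seminorm_on A q using q by (rule cont_seminorms_cstar)
      define K where "K = 2 * (k q * q b) + 2 * q (rm x b)"
      have nn: "0 \<le> k q * q b" "0 \<le> q (rm x b)" using k(1)[OF q] Q.nonneg[OF b] Q.nonneg[OF lr(2)[OF b]] by simp_all
      have "h y \<le> K" if y: "y \<in> B" for y
      proof (cases "y = \<zero>\<^bsub>MA\<^esub>")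
        case True
        interpret H: cseminorm MA h by (rule MA.seminorms[OF h])
        show ?thesis unfolding True H.at_zero K_def using nn by linarith
      next
        case False
        then obtain e where e: "damping e" "y = ?z e" using y unfolding B_def by blast
        have "k q * q (b \<ominus> e \<otimes> b) \<le> k q * q b" by (rule mult_left_mono[OF damping_left[OF e(1) q b] k(1)[OF q]])
        then have "q (lm y b) \<le> 2 * (k q * q b)" unfolding e(2) using qz(1)[OF e(1) q b] by linarith
        moreover have "q (rm y b) \<le> 2 * q (rm x b)"
          unfolding e(2) qz(2)[OF e(1) q b] using damping_right[OF e(1) q lr(2)[OF b]] by linarith
        ultimately have "q (lm y b) \<le> K" "q (rm y b) \<le> K" unfolding K_def using nn by linarith+
        then show ?thesis using hcase by blast
      qed
      then show "\<exists>K. \<forall>y\<in>B. h y \<le> K" by blast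
    qed
    have zB: "\<zero>\<^bsub>MA\<^esub> \<in> B" by (simp add: B_def)
    obtain F \<epsilon> where F: "finite F" "F \<subseteq> MA_seminorms" "0 < \<epsilon>" "{y \<in> B. \<forall>f\<in>F. f y < \<epsilon>} \<subseteq> W"
      by (rule MA.agreeing_nbhd[OF agree W(1) bdd zB])
    obtain q G where q: "q \<in> S" and G: "finite G" "G \<subseteq> carrier A"
      and qG: "\<forall>x\<in>carrier MA. \<forall>f\<in>F. \<exists>a\<in>G. f x \<le> q (lm x a) \<or> f x \<le> q (rm x a)"
      using finite_MA_seminorms[OF F(1,2)] by blast
    obtain s where s: "s \<in> S" "\<forall>x\<in>carrier A. p x \<le> s x \<and> q x \<le> s x"
      using cont_seminorms_directed[OF p q] by blast
    \<comment> \<open>Dominates the factors \<open>2 * k p\<close> and \<open>2 * k q\<close> of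
      left multiplication by \<open>x\<close>, and the factor 2 of the products from the other side,
      so that one \<open>\<zeta>\<close> serves all estimates.\<close>
    define m where "m = 2 * (k p + k q + 1)"
    have m: "0 < m" using k(1)[OF p] k(1)[OF q] by (simp add: m_def)
    define \<zeta> where "\<zeta> = min (\<epsilon> / 2) (c / 4) / m"
    have \<zeta>0: "0 < \<zeta>" using F(3) c m by (simp add: \<zeta>_def)
    have m\<zeta>: "m * \<zeta> \<le> \<epsilon> / 2" "m * \<zeta> \<le> c / 4" using m by (simp_all add: \<zeta>_def)
    \<comment> \<open>For \<open>z = 2 (x - x e)\<close>: \<open>G\<close> controls the products
      \<open>z b = 2 x (b - e b)\<close>, its image under \<open>rm x\<close> controls
      \<open>b z = 2 (b x - b x e)\<close>, and \<open>a'\<close> controls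
      \<open>y a'\<close>.\<close>
    have fin: "finite (G \<union> rm x ` G \<union> {a'})" using G(1) by simp
    have sub: "G \<union> rm x ` G \<union> {a'} \<subseteq> carrier A" using G(2) a' lr(2) by blast
    have "\<exists>e. damping e \<and> (\<forall>b\<in>G \<union> rm x ` G \<union> {a'}. s (b \<ominus> e \<otimes> b) \<le> \<zeta> \<and> s (b \<ominus> b \<otimes> e) \<le> \<zeta>)"
      by (rule damping_finite[OF s(1) fin sub \<zeta>0]) blast
    then obtain e where e: "damping e"
      and e': "\<forall>b\<in>G \<union> rm x ` G \<union> {a'}. s (b \<ominus> e \<otimes> b) \<le> \<zeta> \<and> s (b \<ominus> b \<otimes> e) \<le> \<zeta>"
      by (elim exE conjE)
    note left = e'[rule_format, THEN conjunct1] and right = e'[rule_format, THEN conjunct2]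
    have eA: "e \<in> carrier A" using e by auto
    have kbound: "2 * (k r * \<zeta>) \<le> m * \<zeta>" if "r = p \<or> r = q" for r
    proof -
      have "2 * k r \<le> m" using that k(1)[OF p] k(1)[OF q] by (auto simp: m_def)
      then have "2 * k r * \<zeta> \<le> m * \<zeta>" using \<zeta>0 by (intro mult_right_mono) auto
      then show ?thesis by (simp add: mult.assoc)
    qed
    have zW: "?z e \<in> W"
    proof (rule subsetD[OF F(4)], intro CollectI conjI ballI)
      show "?z e \<in> B" unfolding B_def using e by blast
      fix h assume h: "h \<in> F"
      obtain b where b: "b \<in> G" "h (?z e) \<le> q (lm (?z e) b) \<or> h (?z e) \<le> q (rm (?z e) b)"
        using qG z(1)[OF eA] h by blast
      have bA: "b \<in> carrier A" using b(1) G(2) by blast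
      have cl: "b \<ominus> e \<otimes> b \<in> carrier A" "rm x b \<ominus> rm x b \<otimes> e \<in> carrier A" using bA eA lr(2)[OF bA] by simp_all
      have "s (b \<ominus> e \<otimes> b) \<le> \<zeta>" by (rule left) (use b(1) in simp)
      then have "q (b \<ominus> e \<otimes> b) \<le> \<zeta>" using bspec[OF s(2) cl(1)] by linarith
      then have "k q * q (b \<ominus> e \<otimes> b) \<le> k q * \<zeta>" using k(1)[OF q] by (rule mult_left_mono)
      then have 1: "q (lm (?z e) b) < \<epsilon>" using qz(1)[OF e q bA] kbound[OF disjI2[OF refl]] m\<zeta> F(3) by linarith
      have "s (rm x b \<ominus> rm x b \<otimes> e) \<le> \<zeta>" by (rule right) (use b(1) in simp)
      then have "q (rm x b \<ominus> rm x b \<otimes> e) \<le> \<zeta>" using bspec[OF s(2) cl(2)] by linarith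
      moreover have "2 * \<zeta> \<le> m * \<zeta>" using \<zeta>0 k(1)[OF p] k(1)[OF q] by (intro mult_right_mono) (auto simp: m_def)
      ultimately have "q (rm (?z e) b) < \<epsilon>" unfolding qz(2)[OF e q bA] using m\<zeta> F(3) by linarith
      with 1 b(2) show "h (?z e) < \<epsilon>" by linarith
    qed
    define y where "y = 2 \<odot> lm x e"
    have y: "y \<in> carrier A" using lr(1)[OF eA] by (simp add: y_def)
    have yW: "embed y \<in> W"
    proof -
      have "p (a \<otimes> y) = 2 * p (rm x a \<otimes> e)"
        using lm_rm_mult(3)[OF x(1) a eA] lr a eA by (simp add: y_def smult_mult_right homogeneous)
      also have "\<dots> \<le> 2 * (2 * p (rm x a))" using damping_mult_le[OF e p lr(2)[OF a]] by simp
      also have "\<dots> \<le> c" using x(2) by (simp add: f_def)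
      finally have 1: "p (a \<otimes> y) \<le> c" .
      have cl: "a' \<ominus> e \<otimes> a' \<in> carrier A" using a' eA by simp
      have "y \<otimes> a' = 2 \<odot> lm x (e \<otimes> a')"
        using lm_rm_mult(1)[OF x(1) eA a'] lr(1)[OF eA] a' by (simp add: y_def smult_mult_left)
      then have ya: "p (y \<otimes> a') = 2 * p (lm x (e \<otimes> a'))" using lr(1)[of "e \<otimes> a'"] eA a' by (simp add: homogeneous)
      have ea: "lm x a' \<ominus> lm x (a' \<ominus> e \<otimes> a') = lm x (e \<otimes> a')"
      proof -
        have "lm x (a' \<ominus> e \<otimes> a') = lm x a' \<ominus> lm x (e \<otimes> a')" by (rule lm_diff_right[OF x(1) a']) (use eA a' in simp)
        moreover have "u \<ominus> (u \<ominus> v) = v" if "u \<in> carrier A" "v \<in> carrier A" for u v using that by algebra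
        ultimately show ?thesis using lr(1)[OF a'] lr(1)[of "e \<otimes> a'"] eA a' by simp
      qed
      have "p (lm x (e \<otimes> a')) \<le> p (lm x a') + p (lm x (a' \<ominus> e \<otimes> a'))"
        unfolding ea[symmetric] by (rule triangle_diff[OF lr(1)[OF a'] lr(1)[OF cl]])
      also have "p (lm x (a' \<ominus> e \<otimes> a')) \<le> k p * p (a' \<ominus> e \<otimes> a')" by (rule k(2)[OF p cl])
      also have "\<dots> \<le> k p * \<zeta>"
      proof (rule mult_left_mono[OF _ k(1)[OF p]])
        have "s (a' \<ominus> e \<otimes> a') \<le> \<zeta>" by (rule left) simp
        then show "p (a' \<ominus> e \<otimes> a') \<le> \<zeta>" using bspec[OF s(2) cl] by linarith
      qed
      finally have "p (lm x (e \<otimes> a')) \<le> c / 4 + c / 8"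
        using kbound[OF disjI1[OF refl]] m\<zeta> x(3) unfolding g_def by linarith
      then have 2: "p (y \<otimes> star A a) \<le> c" using ya c unfolding a'_def by linarith
      show ?thesis using inC[rule_format, OF y conjI[OF 1 2]] by blast
    qed
    have "x = (1 / 2) \<odot>\<^bsub>MA\<^esub> ?z e \<oplus>\<^bsub>MA\<^esub> (1 / 2) \<odot>\<^bsub>MA\<^esub> embed y"
    proof -
      have le: "embed (lm x e) \<in> carrier MA" by (rule embed(1)[OF lr(1)[OF eA]])
      have "(1 / 2) \<odot>\<^bsub>MA\<^esub> ?z e = x \<ominus>\<^bsub>MA\<^esub> embed (lm x e)" using x(1) le by simp
      moreover have "(1 / 2) \<odot>\<^bsub>MA\<^esub> embed y = embed (lm x e)"
        unfolding y_def embed_smult[OF lr(1)[OF eA]] using le by simp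
      moreover have "u = (u \<ominus>\<^bsub>MA\<^esub> v) \<oplus>\<^bsub>MA\<^esub> v" if "u \<in> carrier MA" "v \<in> carrier MA" for u v
        using that by (simp add: a_minus_def MA.M.a_assoc MA.M.l_neg)
      ultimately show ?thesis using x(1) le by simp
    qed
    also have "\<dots> \<in> W" using W(2) zW yW unfolding absolutely_convex_def by (auto simp: norm_divide)
    finally show ?thesis .
  qed
  then have "{x \<in> carrier MA. \<forall>h\<in>{f, g}. h x < c / 4} \<subseteq> W" by blast
  then show ?thesis
    unfolding MA.zero_nbhd_iff using WM fg c by (intro conjI exI[of _ "{f, g}"] exI[of _ "c / 4"]) simp_all
qed

text \<open>Openness in an agreeing locally convex topology is tested at zero, and there on
  absolutely convex neighbourhoods.\<close>

lemma strict_is_localization: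
  assumes born: "bornological A (topo A)"
  shows "is_localization MA (strict_topology A) (strict_topology A)"
  unfolding is_localization_def strict_topology_eq
proof (intro conjI allI impI)
  show "locally_convex MA MA.T" by (rule MA.locally_convex)
  show "agrees_on_bounded MA MA.T MA.T" by (simp add: agrees_on_bounded_def)
  fix T' U assume T': "locally_convex MA T' \<and> agrees_on_bounded MA MA.T T'" and U: "openin T' U"
  show "openin MA.T U"
  proof (rule MA.coarser_if_zero_nbhds[OF _ _ U])
    show "linear_topology MA T'" using T' by (simp add: locally_convex_def)
    fix N assume N: "zero_nbhd MA T' N"
    obtain W where W: "absolutely_convex MA W" "zero_nbhd MA T' W" "W \<subseteq> N"
      by (rule MA.absolutely_convex_nbhd[OF conjunct1[OF T'] N])
    have "zero_nbhd MA MA.T W" by (rule bornological_zero_nbhd[OF born conjunct2[OF T'] W(2,1)])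
    moreover have "N \<subseteq> carrier MA" using N by (simp add: zero_nbhd_def)
    ultimately show "zero_nbhd MA MA.T N"
      using interior_of_mono[OF W(3)] unfolding zero_nbhd_def by blast
  qed
qed

end

theorem theoremA:
  fixes A :: "'a top_star_algebra"
  assumes "pro_cstar_algebra A"
  shows "(bornological A (topo A) \<longrightarrow>
            strict_topology A = localization (multiplier_algebra A) (strict_topology A)) \<and>
         (sigma_cstar_algebra A \<longrightarrow> bornological A (topo A))"
proof (intro conjI impI)
  interpret pro_cstar A by (rule pro_cstar.intro[OF assms])
  assume "bornological A (topo A)"
  then have "is_localization MA (strict_topology A) (strict_topology A)" by (rule strict_is_localization)
  then show "strict_topology A = localization (multiplier_algebra A) (strict_topology A)"
    by (rule localization_eqI[symmetric])
next
  assume "sigma_cstar_algebra A"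
  then show "bornological A (topo A)" by (rule sigma_cstar_imp_bornological)
qed

end
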